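(* For every integer $n \geq 1$ and every $f \in \mathcal{A}_n$, it holds $$ \delta_{LS}(f) \;\geq\; \frac{1}{2}\, d_n(f\varphi_n, \varphi_n)^2 , $$ where $\mathcal{A}_n$ is the set of $\mathcal{C}^1$ functions $f \colon \mathbb{R}^n \to (0,+\infty)$ such that $\int_{\mathbb{R}^n} f \, d\gamma_n = 1$ and $\int_{\mathbb{R}^n} \frac{|\nabla f|^2}{f}\, d\gamma_n < \infty$, and $$ \delta_{LS}(f) := \frac{1}{2} \int_{\mathbb{R}^n} \frac{|\nabla f|^2}{f}\, d\gamma_n - \operatorname{Ent}_{\gamma_n}(f) $$ is the deficit in the log-Sobolev inequality.
   Context: Gaussian measure. $\varphi_n(x) := (2\pi)^{-n/2} e^{-|x|^2/2}$, $x \in \mathbb{R}^n$, with $|\cdot|$ the Euclidean norm, and $\gamma_n(dx) = \varphi_n(x)\,dx$ is the standard Gaussian measure on $\mathbb{R}^n$. The entropy of a positive function $f$ is $$\operatorname{Ent}_{\gamma_n}(f) := \int_{\mathbb{R}^n} f \log f \, d\gamma_n - \int_{\mathbb{R}^n} f\, d\gamma_n \, \log \int_{\mathbb{R}^n} f \, d\gamma_n .$$ The one-dimensional distance $d$. Let $\mathcal{B}$ be the set of continuous functions $u \colon \mathbb{R} \to (0,+\infty)$ with $\int_{\mathbb{R}} u(x)\,dx = 1$. For $u, v \in \mathcal{B}$, let $\mu(dx) = u(x)dx$, $\nu(dx) = v(x)dx$, $F_\mu(x) := \int_{-\infty}^x u(y)\,dy$, $F_\nu(x) := \int_{-\infty}^x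 v(y)\,dy$, and let $T := F_\nu^{-1} \circ F_\mu$ (the increasing map pushing $\mu$ forward onto $\nu$). Define $$ d(u,v) := \int_{\mathbb{R}} \frac{|1-T'|}{\max(1,T')}\, d\mu . $$ The $n$-dimensional distance $d_n$. For a direction $\xi \in \mathbb{S}^{n-1}$ (the unit sphere of $\mathbb{R}^n$), let $H_\xi := \{ y \in \mathbb{R}^n : \langle \xi, y\rangle = 0\}$, and write each $x\in\mathbb{R}^n$ as $x = x' + t\xi$ with $x' \in H_\xi$, $t \in \mathbb{R}$. For an integrable $g \colon \mathbb{R}^n \to \mathbb{R}$ set $$ g_\xi(t) := \int_{H_\xi} g(x' + t\xi)\, d\mathcal{H}^{n-1}(x'), \quad t \in \mathbb{R}, $$ where $\mathcal{H}^{n-1}$ is the $(n-1)$-dimensional Hausdorff measure on $H_\xi$. Let $$ \mathcal{B}_n := \{ g \in L^1(\mathbb{R}^n, \mathbb{R}_+) : x\,g(x) \in L^1(\mathbb{R}^n,\mathbb{R}^n),\ g_\xi \in \mathcal{B} \text{ for all } \xi \in \mathbb{S}^{n-1} \}, $$ and for $g, h \in \mathcal{B}_n$ define $$ d_n(g,h) := \sup_{\xi \in \mathbb{S}^{n-1}} d(g_\xi, h_\xi). $$ For $f \in \mathcal{A}_n$ the function $f\varphi_n$ is regarded as an element of $\mathcal{B}_n$, so that $d_n(f\varphi_n,\varphi_n)$ is defined. *)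

theory Defs
  imports "HOL-Analysis.Analysis"
begin

subsection \<open>Hausdorff measure of integer dimension\<close>

text \<open>
  The normalisation constant is the volume of the \<open>m\<close>-dimensional unit ball, so that on
  \<open>m\<close>-dimensional subspaces the Hausdorff measure is Lebesgue measure; for \<open>m = 0\<close> it is
  counting measure. The empty set is charged 0 also for \<open>m = 0\<close>, where \<open>diameter {} ^ 0 = 1\<close>.
  Boundedness of the covering sets is explicit since \<open>diameter\<close> is only meaningful
  for bounded sets.
\<close>

definition hausdorff_gauge :: "nat \<Rightarrow> 'a::metric_space set \<Rightarrow> ennreal" where
  "hausdorff_gauge m E =
     (if E = {} then 0 else ennreal (unit_ball_vol (real m) * (diameter E / 2) ^ m))"

definition hausdorff_content :: "nat \<Rightarrow> real \<Rightarrow> 'a::metric_space set \<Rightarrow> ennreal" where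
  "hausdorff_content m \<delta> A =
     (INF E \<in> {E :: nat \<Rightarrow> 'a set.
                 A \<subseteq> (\<Union>i. E i) \<and> (\<forall>i. bounded (E i) \<and> diameter (E i) \<le> \<delta>)}.
        (\<Sum>i. hausdorff_gauge m (E i)))"

definition hausdorff_outer :: "nat \<Rightarrow> 'a::metric_space set \<Rightarrow> ennreal" where
  "hausdorff_outer m A = (SUP \<delta> \<in> {0<..}. hausdorff_content m \<delta> A)"

definition hausdorff_measure :: "nat \<Rightarrow> 'a::metric_space measure" where
  "hausdorff_measure m = measure_of UNIV (sets borel) (hausdorff_outer m)"

subsection \<open>The one-dimensional distance\<close>

text \<open>
  The functionals \<open>dist1\<close> and \<open>dist_n\<close> are total functions; they carry their intended meaning
  for arguments in \<open>class_B\<close> and \<open>class_Bn\<close>, respectively. For \<open>v\<close> in \<open>class_B\<close> the function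
  \<open>cdf_of v\<close> is a strictly increasing bijection onto the open interval from 0 to 1, so \<open>inv\<close>
  is its genuine inverse at every value of \<open>cdf_of u\<close>.
\<close>

definition class_B :: "(real \<Rightarrow> real) set" where
  "class_B = {u. continuous_on UNIV u \<and> (\<forall>x. u x > 0) \<and> has_bochner_integral lborel u 1}"

definition cdf_of :: "(real \<Rightarrow> real) \<Rightarrow> real \<Rightarrow> real" where
  "cdf_of u x = (LINT y:{..x}|lborel. u y)"

definition transport :: "(real \<Rightarrow> real) \<Rightarrow> (real \<Rightarrow> real) \<Rightarrow> real \<Rightarrow> real" where
  "transport u v = inv (cdf_of v) \<circ> cdf_of u"

definition dist1 :: "(real \<Rightarrow> real) \<Rightarrow> (real \<Rightarrow> real) \<Rightarrow> real" where
  "dist1 u v =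
     (LINT x|density lborel (\<lambda>x. ennreal (u x)).
        \<bar>1 - deriv (transport u v) x\<bar> / max 1 (deriv (transport u v) x))"

subsection \<open>The n-dimensional distance\<close>

definition hyperplane_perp :: "'a::euclidean_space \<Rightarrow> 'a set" where
  "hyperplane_perp \<xi> = {y. \<xi> \<bullet> y = 0}"

definition marginal :: "'a::euclidean_space \<Rightarrow> ('a \<Rightarrow> real) \<Rightarrow> real \<Rightarrow> real" where
  "marginal \<xi> g t =
     (LINT y:hyperplane_perp \<xi>|hausdorff_measure (DIM('a) - 1). g (y + t *\<^sub>R \<xi>))"

definition class_Bn :: "('a::euclidean_space \<Rightarrow> real) set" where
  "class_Bn = {g. (\<forall>x. g x \<ge> 0) \<and> integrable lborel g \<and> integrable lborel (\<lambda>x. g x *\<^sub>R x)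
                  \<and> (\<forall>\<xi> \<in> sphere 0 1. marginal \<xi> g \<in> class_B)}"

definition dist_n :: "('a::euclidean_space \<Rightarrow> real) \<Rightarrow> ('a \<Rightarrow> real) \<Rightarrow> real" where
  "dist_n g h = (SUP \<xi> \<in> sphere 0 1. dist1 (marginal \<xi> g) (marginal \<xi> h))"

subsection \<open>Gaussian measure, entropy and the log-Sobolev deficit\<close>

definition gauss_density :: "'a::euclidean_space \<Rightarrow> real" where
  "gauss_density x = (2 * pi) powr (- real DIM('a) / 2) * exp (- (norm x)\<^sup>2 / 2)"

definition gauss :: "'a::euclidean_space measure" where
  "gauss = density lborel (\<lambda>x. ennreal (gauss_density x))"

definition Ent :: "'a measure \<Rightarrow> ('a \<Rightarrow> real) \<Rightarrow> real" where
  "Ent M f = (LINT x|M. f x * ln (f x)) - (LINT x|M. f x) * ln (LINT x|M. f x)"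

definition gradient :: "('a::euclidean_space \<Rightarrow> real) \<Rightarrow> 'a \<Rightarrow> 'a" where
  "gradient f x = (THE D. GDERIV f x :> D)"

definition C1_fun :: "('a::euclidean_space \<Rightarrow> real) \<Rightarrow> bool" where
  "C1_fun f \<longleftrightarrow> (\<forall>x. f differentiable (at x)) \<and> continuous_on UNIV (gradient f)"

definition class_An :: "('a::euclidean_space \<Rightarrow> real) set" where
  "class_An = {f. C1_fun f \<and> (\<forall>x. f x > 0) \<and> has_bochner_integral gauss f 1
                  \<and> integrable gauss (\<lambda>x. (norm (gradient f x))\<^sup>2 / f x)}"

definition LS_deficit :: "('a::euclidean_space \<Rightarrow> real) \<Rightarrow> real" where
  "LS_deficit f = 1/2 * (LINT x|gauss. (norm (gradient f x))\<^sup>2 / f x) - Ent gauss f"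

end

theory Submission
  imports Defs "HOL-Probability.Probability"
begin

text \<open>
  Fix a unit vector \<open>\<xi>\<close> and split \<open>x = x' + t \<xi>\<close>. Let \<open>f\<^sub>1 t\<close> be the Gaussian average of
  \<open>f\<close> over the hyperplane at height \<open>t\<close>, so that the marginal of \<open>f \<phi>\<^sub>n\<close> in direction \<open>\<xi>\<close> is
  \<open>u = f\<^sub>1 \<phi>\<^sub>1\<close>. The entropy of \<open>f\<close> is the entropy of \<open>f\<^sub>1\<close> plus the average of the entropies of
  \<open>f\<close> on the hyperplanes, and by the log-Sobolev inequality in the hyperplane variables the latter is
  at most half of the tangential part of the Fisher information. For the remaining direction, let
  \<open>T\<close> be the increasing map that transports \<open>u\<close> to \<open>\<phi>\<^sub>1\<close>. Taking logarithms in the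
  Monge-Ampere equation \<open>u = \<phi>\<^sub>1(T) T'\<close> gives
  \<open>ln f\<^sub>1 = t\<^sup>2/2 - T\<^sup>2/2 + ln T'\<close>; after an integration by parts and a completion of the square, the
  entropy of \<open>f\<^sub>1\<close> is at most half of the Fisher information in direction \<open>\<xi>\<close>, minus
  \<open>\<integral> (T' - 1 - ln T') u\<close>. Since \<open>2 (x - 1 - ln x) \<ge> (\<bar>1 - x\<bar> / max 1 x)\<^sup>2\<close>, the Cauchy-Schwarz
  inequality bounds the latter integral below by half of the squared one-dimensional distance. Taking
  the supremum over \<open>\<xi>\<close> gives the theorem.

  The integration by parts is carried out along each line parallel to \<open>\<xi>\<close>, where \<open>f\<close> is \<open>C\<^sup>1\<close>,
  because \<open>f\<^sub>1\<close> need only be continuous with an integrable weak derivative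
  (\<open>pointwise_bound\<close>, \<open>interval_bound\<close>). Along suitable sequences of intervals the boundary terms are
  bounded above by quantities that tend to 0, because \<open>- T u\<close> is the derivative of the bounded
  function \<open>\<phi>\<^sub>1 \<circ> T\<close> (\<open>boundary_right\<close>, \<open>boundary_left\<close>, \<open>marginal_deficit\<close>). One step of the chain
  rule, with the transport gain retained, is \<open>log_sobolev_deficit_step\<close>. Dropping the gain and
  inducting on the number of coordinates yields the log-Sobolev inequality that the step presupposes
  (\<open>log_sobolev_product\<close>); only slices of \<open>f\<close>, which inherit its smoothness, are passed to the
  induction hypothesis. Entropies are integrals of the nonnegative function
  \<open>x ln (x / y) - x + y\<close>, so that integrability of \<open>f ln f\<close> comes out as a consequence.

  The marginals are defined with the Hausdorff measure on the hyperplane. If that is infinite on some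
  ball, then both marginals vanish (\<open>marginal_eq_0\<close>). Otherwise its product with Lebesgue measure on the line is translation-invariant, hence a constant multiple \<open>c\<close> of Lebesgue measure
  (\<open>perp_times_line\<close>). Both marginals therefore carry the same factor \<open>c\<close>, under which the transport
  map is unchanged and the distance is multiplied by \<open>c\<close>; it remains to see that \<open>c \<le> 1\<close>, which
  follows from a Vitali covering by balls (\<open>hausdorff_content_disc_le\<close>, \<open>perp_measure_le_lebesgue\<close>).
\<close>

section \<open>Translation-invariant measures and orthonormal coordinates\<close>

lemma sigma_finite_borel_locally_finite:
  fixes M :: "'a::euclidean_space measure"
  assumes sets_M: "sets M = sets borel" and fin: "\<And>r. emeasure M (cball 0 r) < \<infinity>"
  shows "sigma_finite_measure M"
proof
  show "\<exists>A. countable A \<and> A \<subseteq> sets M \<and> \<Union>A = space M \<and> (\<forall>a\<in>A. emeasure M a \<noteq> \<infinity>)"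
  proof (intro exI conjI)
    show "countable (range (\<lambda>n. cball (0::'a) (real n)))" by simp
    show "range (\<lambda>n. cball 0 (real n)) \<subseteq> sets M" by (auto simp: sets_M)
    show "\<Union> (range (\<lambda>n. cball (0::'a) (real n))) = space M"
      using sets_eq_imp_space_eq[OF sets_M] by (auto intro: real_arch_simple)
    show "\<forall>a\<in>range (\<lambda>n. cball 0 (real n)). emeasure M a \<noteq> \<infinity>" using fin by (auto simp: less_top)
  qed
qed

text \<open>
  Uniqueness of Haar measure, by Fubini's theorem: integrating \<open>1\<^sub>A(x) 1\<^sub>B(y - x)\<close> against
  \<open>M \<otimes> lborel\<close> in the two possible orders gives \<open>M(A) vol(B) = M(-B) vol(A)\<close>; a ball \<open>B\<close> is symmetric.
\<close>

lemma translation_invariant_measure_unique: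
  fixes M :: "'a::euclidean_space measure"
  assumes sets_M[measurable_cong]: "sets M = sets borel"
    and inv: "\<And>a. distr M borel (\<lambda>x. x + a) = M"
    and fin: "\<And>r. emeasure M (cball 0 r) < \<infinity>"
  shows "\<exists>c\<ge>0. M = density lborel (\<lambda>_. ennreal c)"
proof -
  interpret M: sigma_finite_measure M by (rule sigma_finite_borel_locally_finite[OF sets_M fin])
  interpret P: pair_sigma_finite M lborel by standard
  define B where "B = cball (0::'a) 1"
  have B[measurable]: "B \<in> sets borel" by (simp add: B_def)
  have shift: "(\<integral>\<^sup>+x. f (x + a) \<partial>M) = (\<integral>\<^sup>+x. f x \<partial>M)" if [measurable]: "f \<in> borel_measurable borel"
    for f :: "'a \<Rightarrow> ennreal" and a
    by (subst (2) inv[of a, symmetric]) (simp add: nn_integral_distr)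
  have shiftL: "(\<integral>\<^sup>+x. f (a + x) \<partial>lborel) = (\<integral>\<^sup>+x. f x \<partial>lborel)" if [measurable]: "f \<in> borel_measurable borel"
    for f :: "'a \<Rightarrow> ennreal" and a
    by (subst lborel_distr_plus[of a, symmetric]) (simp add: nn_integral_distr)
  have key: "emeasure M A * emeasure lborel B = emeasure M B * emeasure lborel A"
    if A[measurable]: "A \<in> sets borel" for A
  proof -
    have "emeasure M A * emeasure lborel B = (\<integral>\<^sup>+x. indicator A x * emeasure lborel B \<partial>M)"
      by (simp add: nn_integral_multc)
    also have "\<dots> = (\<integral>\<^sup>+x. \<integral>\<^sup>+y. indicator A x * indicator B (-x + y) \<partial>lborel \<partial>M)"
      by (intro nn_integral_cong, subst nn_integral_cmult, simp, subst shiftL[of "indicator B"]) simp_all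
    also have "\<dots> = (\<integral>\<^sup>+y. \<integral>\<^sup>+x. indicator A x * indicator B (-x + y) \<partial>M \<partial>lborel)"
      by (rule P.Fubini'[symmetric]) simp
    also have "\<dots> = (\<integral>\<^sup>+y. \<integral>\<^sup>+x. indicator A (x + y) * indicator B (-x) \<partial>M \<partial>lborel)"
    proof (rule nn_integral_cong)
      fix y :: 'a
      show "(\<integral>\<^sup>+x. indicator A x * indicator B (-x + y) \<partial>M) = (\<integral>\<^sup>+x. indicator A (x + y) * indicator B (-x) \<partial>M)"
        using shift[of "\<lambda>x. indicator A x * indicator B (-x + y)" y] by simp
    qed
    also have "\<dots> = (\<integral>\<^sup>+x. \<integral>\<^sup>+y. indicator A (x + y) * indicator B (-x) \<partial>lborel \<partial>M)"
      by (rule P.Fubini') simp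
    also have "\<dots> = (\<integral>\<^sup>+x. emeasure lborel A * indicator B x \<partial>M)"
      by (intro nn_integral_cong, subst nn_integral_multc, simp, subst shiftL[of "indicator A"])
         (simp_all add: B_def indicator_def)
    also have "\<dots> = emeasure M B * emeasure lborel A"
      by (subst nn_integral_cmult) (simp_all add: mult.commute)
    finally show ?thesis .
  qed
  define c where "c = measure M B / measure lborel B"
  have LB: "emeasure lborel B = ennreal (measure lborel B)"
    by (simp add: B_def emeasure_cball content_cball)
  have LB0: "measure lborel B > 0" by (simp add: B_def content_cball)
  have MB: "emeasure M B = ennreal (measure M B)"
    using fin[of 1] by (simp add: B_def emeasure_eq_ennreal_measure less_top)
  show ?thesis
  proof (intro exI conjI)
    show "c \<ge> 0" by (simp add: c_def)
    show "M = density lborel (\<lambda>_. ennreal c)"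
    proof (rule measure_eqI)
      show "sets M = sets (density lborel (\<lambda>_. ennreal c))" by (simp add: sets_M)
      fix A assume "A \<in> sets M"
      then have A: "A \<in> sets borel" by (simp add: sets_M)
      have "emeasure M A = emeasure M A * emeasure lborel B / emeasure lborel B"
        using LB0 by (simp add: LB ennreal_mult_divide_eq)
      also have "\<dots> = emeasure M B * emeasure lborel A / emeasure lborel B"
        by (simp add: key[OF A])
      also have "\<dots> = ennreal c * emeasure lborel A"
        using LB0 unfolding LB MB c_def
        by (simp add: divide_ennreal[symmetric] ennreal_times_divide mult.commute)
      finally show "emeasure M A = emeasure (density lborel (\<lambda>_. ennreal c)) A"
        using A by (simp add: emeasure_density nn_integral_cmult)
    qed
  qed
qed

text \<open>
  The elements of an orthonormal basis serve as indices of the coordinates, so that a hyperplane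
  is the product over the remaining indices although there is no type of one dimension less.
\<close>

locale orthonormal_basis =
  fixes B :: "'a::euclidean_space set"
  assumes finite_B: "finite B" and orthogonal_B: "pairwise orthogonal B"
    and norm_B: "\<And>b. b \<in> B \<Longrightarrow> norm b = 1" and card_B: "card B = DIM('a)"
begin

definition comb :: "('a \<Rightarrow> real) \<Rightarrow> 'a" where
  "comb x = (\<Sum>b\<in>B. x b *\<^sub>R b)"

lemma comb_measurable[measurable]: "comb \<in> PiM B (\<lambda>_. borel) \<rightarrow>\<^sub>M borel"
  unfolding comb_def[abs_def] by measurable

lemma comb_inner: "b \<in> B \<Longrightarrow> comb x \<bullet> b = x b"
proof -
  assume b: "b \<in> B"
  have "comb x \<bullet> b = (\<Sum>c\<in>B. if c = b then x b else 0)"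
    unfolding comb_def inner_sum_left using orthogonal_B norm_B b
    by (intro sum.cong) (auto simp: pairwise_def orthogonal_def dot_square_norm)
  then show ?thesis using b finite_B by simp
qed

lemma norm_comb: "(norm (comb x))\<^sup>2 = (\<Sum>b\<in>B. (x b)\<^sup>2)"
proof -
  have "(norm (comb x))\<^sup>2 = comb x \<bullet> (\<Sum>b\<in>B. x b *\<^sub>R b)" by (simp add: comb_def dot_square_norm)
  also have "\<dots> = (\<Sum>b\<in>B. (x b)\<^sup>2)" unfolding inner_sum_right
    by (intro sum.cong) (auto simp: comb_inner power2_eq_square)
  finally show ?thesis .
qed

lemma comb_coordinates: "comb (\<lambda>b. a \<bullet> b) = a"
proof -
  have "independent B" by (rule pairwise_orthogonal_independent[OF orthogonal_B]) (use norm_B in force)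
  then have "a \<in> span B" using card_ge_dim_independent[of B UNIV] card_B by auto
  then obtain u where u: "a = comb u" unfolding span_finite[OF finite_B] comb_def by auto
  then have "a \<bullet> b = u b" if "b \<in> B" for b using comb_inner[OF that, of u] by simp
  then show ?thesis using u by (simp add: comb_def)
qed

lemma comb_upd:
  assumes "\<xi> \<in> B" shows "comb (w(\<xi> := t)) = comb (w(\<xi> := 0)) + t *\<^sub>R \<xi>"
proof -
  have "comb (w(\<xi> := s)) = s *\<^sub>R \<xi> + (\<Sum>b\<in>B - {\<xi>}. w b *\<^sub>R b)" for s
    unfolding comb_def using finite_B assms by (subst sum.remove[of B \<xi>]) (auto intro!: sum.cong)
  from this[of t] this[of 0] show ?thesis by (simp add: add.commute)
qed

lemma comb_upd_measurable:
  assumes "\<xi> \<in> B" shows "(\<lambda>w. comb (w(\<xi> := t))) \<in> PiM (B - {\<xi>}) (\<lambda>_. borel) \<rightarrow>\<^sub>M borel"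
proof -
  have "(\<lambda>w. w(\<xi> := t)) \<in> PiM (B - {\<xi>}) (\<lambda>_. borel) \<rightarrow>\<^sub>M PiM B (\<lambda>_. borel)"
    by (rule measurable_fun_upd[where J = "B - {\<xi>}"]) (use assms in auto)
  then show ?thesis by (rule measurable_compose) measurable
qed

text \<open>
  Rotation invariance of Lebesgue measure. The image measure is translation-invariant, and the
  constant is found on a ball, whose preimage is the ball in the product space.
\<close>

lemma distr_comb_lborel: "distr (PiM B (\<lambda>_. lborel)) borel comb = lborel"
proof -
  interpret product_sigma_finite "\<lambda>_::'a. lborel :: real measure" by standard
  interpret F: finite_product_sigma_finite "\<lambda>_::'a. lborel :: real measure" B by standard (rule finite_B)
  define M where "M = distr (PiM B (\<lambda>_. lborel)) borel comb"
  have ball: "emeasure M (cball 0 r) = unit_ball_vol (real DIM('a)) * r ^ DIM('a)" if "r > 0" for r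
  proof -
    have "comb -` cball 0 r \<inter> space (PiM B (\<lambda>_. lborel)) =
      {f. sqrt (\<Sum>i\<in>B. (f i)\<^sup>2) \<le> r} \<inter> space (PiM B (\<lambda>_. lborel))"
      by (auto simp: norm_comb[symmetric])
    then show ?thesis using emeasure_cball_aux[OF finite_B that]
      by (simp add: M_def emeasure_distr card_B)
  qed
  have inv: "distr M borel (\<lambda>x. x + a) = M" for a
  proof -
    define t where "t = (\<lambda>x::'a\<Rightarrow>real. \<lambda>b\<in>B. x b + a \<bullet> b)"
    have t[measurable]: "t \<in> PiM B (\<lambda>_. lborel) \<rightarrow>\<^sub>M PiM B (\<lambda>_. lborel)"
      unfolding t_def by measurable
    have "PiM B (\<lambda>_. lborel) = distr (PiM B (\<lambda>_. lborel)) (PiM B (\<lambda>_. lborel)) t"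
    proof (rule PiM_eqI[symmetric])
      show "finite B" by (rule finite_B)
      show "sets (distr (PiM B (\<lambda>_. lborel)) (PiM B (\<lambda>_. lborel)) t) = sets (PiM B (\<lambda>_. lborel))" by simp
      fix A :: "'a \<Rightarrow> real set" assume A: "\<And>b. b \<in> B \<Longrightarrow> A b \<in> sets lborel"
      have shift: "emeasure lborel ((\<lambda>x. x + c) -` C) = emeasure lborel C"
        if "C \<in> sets borel" for C and c :: real
        using that by (subst (2) lborel_distr_plus[of c, symmetric])
                      (simp add: emeasure_distr add.commute[of _ c])
      have "t -` PiE B A \<inter> space (PiM B (\<lambda>_. lborel)) = PiE B (\<lambda>b. (\<lambda>x. x + a \<bullet> b) -` A b)"
        by (auto simp: t_def space_PiM PiE_iff)
      moreover have "(\<lambda>x. x + a \<bullet> b) -` A b \<in> sets borel" if "b \<in> B" for b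
        using measurable_sets[of "\<lambda>x. x + a \<bullet> b" borel borel "A b"] A[OF that] by simp
      ultimately show "emeasure (distr (PiM B (\<lambda>_. lborel)) (PiM B (\<lambda>_. lborel)) t) (PiE B A)
          = (\<Prod>b\<in>B. emeasure lborel (A b))"
        using A finite_B by (simp add: emeasure_distr sets_PiM_I_finite emeasure_PiM shift)
    qed
    then have "M = distr (distr (PiM B (\<lambda>_. lborel)) (PiM B (\<lambda>_. lborel)) t) borel comb"
      unfolding M_def by simp
    also have "\<dots> = distr (PiM B (\<lambda>_. lborel)) borel (comb \<circ> t)"
      by (subst distr_distr) simp_all
    also have "comb \<circ> t = (\<lambda>x. comb x + a)"
      by (subst comb_coordinates[of a, symmetric]) (auto simp: comb_def t_def fun_eq_iff sum.distrib[symmetric] scaleR_add_left intro!: sum.cong)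
    also have "distr (PiM B (\<lambda>_. lborel)) borel (\<lambda>x. comb x + a) = distr M borel (\<lambda>x. x + a)"
      unfolding M_def by (subst distr_distr) (simp_all add: comp_def)
    finally show ?thesis ..
  qed
  have "emeasure M (cball 0 r) < \<infinity>" for r
  proof (cases "r > 0")
    case True then show ?thesis by (simp add: ball)
  next
    case False
    then have "emeasure M (cball 0 r) \<le> emeasure M (cball 0 1)"
      by (intro emeasure_mono) (auto simp: M_def)
    then show ?thesis using ball[of 1] by (auto simp: less_top[symmetric] top_unique)
  qed
  then obtain c where c: "c \<ge> 0" "M = density lborel (\<lambda>_. ennreal c)"
    using translation_invariant_measure_unique[of M] inv by (auto simp: M_def)
  have "emeasure M (cball 0 1) = ennreal c * emeasure lborel (cball (0::'a) 1)"
    by (simp add: c emeasure_density nn_integral_cmult_indicator)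
  then have "ennreal (unit_ball_vol (real DIM('a))) = ennreal (c * unit_ball_vol (real DIM('a)))"
    using ball[of 1] c(1) by (simp add: emeasure_cball ennreal_mult)
  moreover have "unit_ball_vol (real DIM('a)) \<noteq> 0"
    by (metis less_irrefl unit_ball_vol_pos of_nat_0_le_iff)
  ultimately have "c = 1" using c(1) by simp
  then have "M = density lborel (\<lambda>_. 1)" using c by simp
  then show ?thesis by (simp add: M_def density_1)
qed
end

section \<open>Hausdorff contents\<close>

lemma hausdorff_content_translate:
  fixes A :: "'a::euclidean_space set"
  shows "hausdorff_content m d ((+) a ` A) \<le> hausdorff_content m d A"
  unfolding hausdorff_content_def
proof (rule INF_mono)
  fix E :: "nat \<Rightarrow> 'a set"
  assume E: "E \<in> {E. A \<subseteq> (\<Union>i. E i) \<and> (\<forall>i. bounded (E i) \<and> diameter (E i) \<le> d)}"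
  have diam: "diameter ((+) a ` X) = diameter X" for X :: "'a set"
  proof -
    have "(+) a ` X \<times> (+) a ` X = (\<lambda>(x, y). (a + x, a + y)) ` (X \<times> X)" by auto
    then show ?thesis unfolding diameter_def by (simp add: image_image case_prod_unfold)
  qed
  have gauge: "hausdorff_gauge m ((+) a ` X) = hausdorff_gauge m X" for X :: "'a set"
    by (cases "X = {}") (simp_all add: hausdorff_gauge_def diam)
  show "\<exists>F\<in>{F. (+) a ` A \<subseteq> (\<Union>i. F i) \<and> (\<forall>i. bounded (F i) \<and> diameter (F i) \<le> d)}.
      (\<Sum>i. hausdorff_gauge m (F i)) \<le> (\<Sum>i. hausdorff_gauge m (E i))"
  proof (intro bexI[of _ "\<lambda>i. (+) a ` E i"])
    have "(+) a ` A \<subseteq> (+) a ` (\<Union>i. E i)" using E by (intro image_mono) simp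
    then show "(\<lambda>i. (+) a ` E i) \<in> {F. (+) a ` A \<subseteq> (\<Union>i. F i) \<and> (\<forall>i. bounded (F i) \<and> diameter (F i) \<le> d)}"
      using E by (simp add: image_UN diam bounded_translation)
  qed (simp add: gauge)
qed

lemma hausdorff_outer_translate:
  fixes A :: "'a::euclidean_space set"
  shows "hausdorff_outer m ((+) a ` A) = hausdorff_outer m A"
proof (rule antisym)
  have le: "hausdorff_outer m ((+) a ` A) \<le> hausdorff_outer m A" for a and A :: "'a set"
    unfolding hausdorff_outer_def by (intro SUP_mono) (auto intro: hausdorff_content_translate)
  show "hausdorff_outer m ((+) a ` A) \<le> hausdorff_outer m A" by (rule le)
  show "hausdorff_outer m A \<le> hausdorff_outer m ((+) a ` A)"
    using le[of "-a" "(+) a ` A"] by (simp add: image_image)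
qed

lemma sets_hausdorff_measure[simp, measurable_cong]: "sets (hausdorff_measure m) = sets borel"
  unfolding hausdorff_measure_def using sets.sigma_sets_eq[of borel] by (simp add: sets.space_closed[of borel, simplified])

lemma space_hausdorff_measure[simp]: "space (hausdorff_measure m) = UNIV"
  by (simp add: hausdorff_measure_def)

text \<open>
  A measure built from a set function that is not countably additive is zero by convention. Keeping
  this case apart replaces a proof of countable additivity: the zero measure only decreases the
  marginals.
\<close>

lemma emeasure_hausdorff_measure:
  fixes A :: "'a::metric_space set"
  assumes "A \<in> sets borel"
  shows "emeasure (hausdorff_measure m) A =
    (if measure_space UNIV (sets (borel :: 'a measure)) (hausdorff_outer m) then hausdorff_outer m A else 0)"
proof -
  have "sigma_sets UNIV (sets (borel :: 'a measure)) = sets borel"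
    using sets.sigma_sets_eq[of borel] by simp
  then show ?thesis using assms
    unfolding hausdorff_measure_def emeasure_measure_of_conv by simp
qed

lemma emeasure_hausdorff_measure_translate:
  fixes A :: "'a::euclidean_space set"
  assumes "A \<in> sets borel"
  shows "emeasure (hausdorff_measure m) ((+) a ` A) = emeasure (hausdorff_measure m) A"
proof -
  have "(+) a ` A = (\<lambda>x. x - a) -` A \<inter> space borel" by (auto simp: image_iff intro!: bexI[of _ "_ - a"])
  also have "\<dots> \<in> sets borel" using assms by measurable
  finally show ?thesis using assms by (simp add: emeasure_hausdorff_measure hausdorff_outer_translate)
qed

lemma hausdorff_content_le_outer: "0 < d \<Longrightarrow> hausdorff_content m d A \<le> hausdorff_outer m A"
  unfolding hausdorff_outer_def by (intro SUP_upper) auto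

text \<open>
  The index set is countable but not enumerated, and a remainder of zero content is allowed, so that
  the family of balls of a Vitali covering can be used as it comes. The two covers are merged through
  the bijection between \<open>nat + nat\<close> and \<open>nat\<close>.
\<close>

lemma hausdorff_content_le_cover:
  fixes C :: "'i set" and E :: "'i \<Rightarrow> 'a::metric_space set"
  assumes "countable C" "A \<subseteq> (\<Union>i\<in>C. E i) \<union> N" "\<And>i. i \<in> C \<Longrightarrow> bounded (E i)"
    "\<And>i. i \<in> C \<Longrightarrow> diameter (E i) \<le> d" "hausdorff_content m d N = 0"
    "\<And>i. i \<in> C \<Longrightarrow> hausdorff_gauge m (E i) \<le> g i" and d: "0 \<le> d"
  shows "hausdorff_content m d A \<le> (\<integral>\<^sup>+i. g i \<partial>count_space C)"
proof (rule ennreal_le_epsilon)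
  fix e :: real assume e: "0 < e"
  have "hausdorff_content m d N < ennreal e" using assms(5) e by simp
  then obtain F where F: "N \<subseteq> (\<Union>i. F i)" "\<And>i::nat. bounded (F i)" "\<And>i. diameter (F i) \<le> d"
    and Fs: "(\<Sum>i. hausdorff_gauge m (F i)) < ennreal e"
    unfolding hausdorff_content_def INF_less_iff by auto
  define D where "D = to_nat_on C ` C"
  define G where "G = case_sum (\<lambda>j. if j \<in> D then E (from_nat_into C j) else {}) F"
  define H where "H i = G (sum_decode i)" for i
  have fn: "from_nat_into C j \<in> C" if "j \<in> D" for j using that assms(1) by (auto simp: D_def)
  have "A \<subseteq> (\<Union>i. H i)"
  proof
    fix x assume "x \<in> A"
    then consider i where "i \<in> C" "x \<in> E i" | i where "x \<in> F i" using assms(2) F(1) by blast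
    then show "x \<in> (\<Union>i. H i)"
    proof cases
      case 1
      then have "x \<in> H (sum_encode (Inl (to_nat_on C i)))" using assms(1)
        by (simp add: H_def G_def D_def)
      then show ?thesis by blast
    next
      case 2
      then have "x \<in> H (sum_encode (Inr i))" by (simp add: H_def G_def)
      then show ?thesis by blast
    qed
  qed
  moreover have "bounded (H i) \<and> diameter (H i) \<le> d" for i
    using F assms fn d by (auto simp: H_def G_def split: sum.splits)
  ultimately have "hausdorff_content m d A \<le> (\<Sum>i. hausdorff_gauge m (H i))"
    unfolding hausdorff_content_def by (intro INF_lower) auto
  also have "\<dots> = (\<integral>\<^sup>+i. hausdorff_gauge m (G (sum_decode i)) \<partial>count_space UNIV)"
    by (simp add: nn_integral_count_space_nat H_def)
  also have "\<dots> = (\<integral>\<^sup>+i. hausdorff_gauge m (G i) \<partial>count_space UNIV)"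
    by (rule nn_integral_bij_count_space) (rule bij_sum_decode)
  also have "\<dots> = (\<integral>\<^sup>+i. hausdorff_gauge m (G (Inl i)) \<partial>count_space UNIV) + (\<integral>\<^sup>+i. hausdorff_gauge m (G (Inr i)) \<partial>count_space UNIV)"
  proof -
    let ?f = "\<lambda>i. hausdorff_gauge m (G i)"
    have "(\<integral>\<^sup>+i. ?f i \<partial>count_space UNIV) = (\<integral>\<^sup>+i. ?f i * indicator (range Inl) i + ?f i * indicator (range Inr) i \<partial>count_space UNIV)"
      by (intro nn_integral_cong) (auto simp: indicator_def UNIV_sum split: if_splits)
    also have "\<dots> = (\<integral>\<^sup>+i. ?f i * indicator (range Inl) i \<partial>count_space UNIV) + (\<integral>\<^sup>+i. ?f i * indicator (range Inr) i \<partial>count_space UNIV)"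
      by (rule nn_integral_add) simp_all
    also have "(\<integral>\<^sup>+i. ?f i * indicator (range Inl) i \<partial>count_space UNIV) = (\<integral>\<^sup>+i. ?f i \<partial>count_space (range Inl))"
      by (simp add: nn_integral_count_space_indicator)
    also have "(\<integral>\<^sup>+i. ?f i * indicator (range Inr) i \<partial>count_space UNIV) = (\<integral>\<^sup>+i. ?f i \<partial>count_space (range Inr))"
      by (simp add: nn_integral_count_space_indicator)
    also have "(\<integral>\<^sup>+i. ?f i \<partial>count_space (range Inl)) = (\<integral>\<^sup>+i. ?f (Inl i) \<partial>count_space UNIV)"
      by (rule nn_integral_bij_count_space[symmetric]) (simp add: bij_betw_def)
    also have "(\<integral>\<^sup>+i. ?f i \<partial>count_space (range Inr)) = (\<integral>\<^sup>+i. ?f (Inr i) \<partial>count_space UNIV)"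
      by (rule nn_integral_bij_count_space[symmetric]) (simp add: bij_betw_def)
    finally show ?thesis .
  qed
  also have "(\<integral>\<^sup>+i. hausdorff_gauge m (G (Inl i)) \<partial>count_space UNIV) \<le> (\<integral>\<^sup>+i. g i \<partial>count_space C)"
  proof -
    have "(\<integral>\<^sup>+i. hausdorff_gauge m (G (Inl i)) \<partial>count_space UNIV) \<le>
      (\<integral>\<^sup>+j. g (from_nat_into C j) * indicator D j \<partial>count_space UNIV)"
      using assms(6) fn by (intro nn_integral_mono) (auto simp: G_def hausdorff_gauge_def[of m "{}"])
    also have "\<dots> = (\<integral>\<^sup>+j. g (from_nat_into C j) \<partial>count_space D)"
      by (simp add: nn_integral_count_space_indicator)
    also have "\<dots> = (\<integral>\<^sup>+i. g (from_nat_into C (to_nat_on C i)) \<partial>count_space C)"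
      by (rule nn_integral_bij_count_space[symmetric]) (simp add: D_def bij_betw_def assms(1) inj_on_to_nat_on)
    also have "\<dots> = (\<integral>\<^sup>+i. g i \<partial>count_space C)"
      using assms(1) by (intro nn_integral_cong) simp
    finally show ?thesis .
  qed
  also have "(\<integral>\<^sup>+i. hausdorff_gauge m (G (Inr i)) \<partial>count_space UNIV) \<le> ennreal e"
    using Fs by (simp add: nn_integral_count_space_nat G_def less_imp_le)
  finally show "hausdorff_content m d A \<le> (\<integral>\<^sup>+i. g i \<partial>count_space C) + ennreal e"
    by (simp add: add_mono)
qed

text \<open>
  Volume of the \<open>(m + 1)\<close>-dimensional ball as the integral of its \<open>m\<close>-dimensional slices.
\<close>

lemma nn_integral_ball_slices:
  assumes "r > 0"
  shows "(\<integral>\<^sup>+s. indicator {-r..r} s * ennreal (unit_ball_vol (real m) * sqrt (r\<^sup>2 - s\<^sup>2) ^ m) \<partial>lborel)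
     = ennreal (unit_ball_vol (real (Suc m)) * r ^ Suc m)"
proof -
  have sc: "ennreal r * (indicator {-r..r} (r * x) * ennreal (unit_ball_vol (real m) * sqrt (r\<^sup>2 - (r * x)\<^sup>2) ^ m))
      = ennreal (unit_ball_vol (real m) * r ^ Suc m) * ennreal (indicator {-1..1} x * sqrt (1 - x\<^sup>2) ^ m)" for x
  proof -
    have "r\<^sup>2 - (r * x)\<^sup>2 = r\<^sup>2 * (1 - x\<^sup>2)" by (simp add: algebra_simps)
    then have "sqrt (r\<^sup>2 - (r * x)\<^sup>2) = r * sqrt (1 - x\<^sup>2)" using assms by (simp add: real_sqrt_mult)
    moreover have "- r \<le> r * x \<longleftrightarrow> -1 \<le> x" "r * x \<le> r \<longleftrightarrow> x \<le> 1"
      using assms mult_le_cancel_left_pos[of r "-1" x] mult_le_cancel_left_pos[of r x 1] by auto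
    ultimately show ?thesis using assms
      by (auto simp: indicator_def ennreal_mult'[symmetric] power_mult_distrib mult_ac)
  qed
  have "(\<integral>\<^sup>+s. indicator {-r..r} s * ennreal (unit_ball_vol (real m) * sqrt (r\<^sup>2 - s\<^sup>2) ^ m) \<partial>lborel)
     = (\<integral>\<^sup>+x. ennreal (unit_ball_vol (real m) * r ^ Suc m) * ennreal (indicator {-1..1} x * sqrt (1 - x\<^sup>2) ^ m) \<partial>lborel)"
    using assms by (subst nn_integral_real_affine[where c = r and t = 0])
      (auto simp: nn_integral_cmult[symmetric] sc intro!: nn_integral_cong)
  also have "\<dots> = ennreal (unit_ball_vol (real m) * r ^ Suc m) * ennreal (Beta (1 / 2) (real m / 2 + 1))"
    by (subst nn_integral_cmult) (simp_all add: emeasure_cball_aux_integral)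
  also have "\<dots> = ennreal (unit_ball_vol (real m) * Beta (1 / 2) (real m / 2 + 1) * r ^ Suc m)"
    using assms by (simp add: ennreal_mult'[symmetric] mult_ac)
  also have "unit_ball_vol (real m) * Beta (1 / 2) (real m / 2 + 1) = unit_ball_vol (real (Suc m))"
    by (auto simp: unit_ball_vol_def Beta_def Gamma_eq_zero_iff field_simps
          Gamma_one_half_real powr_half_sqrt[symmetric] powr_add[symmetric])
  finally show ?thesis .
qed

section \<open>The Hausdorff measure of a hyperplane\<close>

text \<open>
  The Hausdorff measure of codimension one on the hyperplane through 0, extended by zero so that it
  can be multiplied with measures on the whole space.
\<close>

definition perp_measure :: "'a::euclidean_space \<Rightarrow> 'a measure" where
  "perp_measure \<xi> = density (hausdorff_measure (DIM('a) - 1)) (indicator (hyperplane_perp \<xi>))"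

lemma hyperplane_perp_borel[measurable]: "hyperplane_perp \<xi> \<in> sets borel"
  unfolding hyperplane_perp_def by measurable

lemma sets_perp_measure[simp, measurable_cong]: "sets (perp_measure \<xi>) = sets borel"
  by (simp add: perp_measure_def)

lemma space_perp_measure[simp]: "space (perp_measure \<xi>) = UNIV"
  by (simp add: perp_measure_def)

lemma emeasure_perp_measure:
  "A \<in> sets borel \<Longrightarrow> emeasure (perp_measure \<xi>) A
     = emeasure (hausdorff_measure (DIM('a) - 1)) (hyperplane_perp (\<xi>::'a::euclidean_space) \<inter> A)"
  unfolding perp_measure_def
  by (simp add: emeasure_density indicator_inter_arith[symmetric] del: indicator_inter_arith)

lemma AE_perp_measure: "AE y in perp_measure \<xi>. \<xi> \<bullet> y = 0"
  unfolding perp_measure_def by (subst AE_density) (auto simp: hyperplane_perp_def indicator_def)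

lemma distr_perp_measure:
  fixes \<xi> :: "'a::euclidean_space"
  assumes "\<xi> \<bullet> a = 0"
  shows "distr (perp_measure \<xi>) borel (\<lambda>y. y + a) = perp_measure \<xi>"
proof (rule measure_eqI)
  fix A assume "A \<in> sets (distr (perp_measure \<xi>) borel (\<lambda>y. y + a))"
  then have A[measurable]: "A \<in> sets borel" by simp
  have "(\<lambda>y. y + a) -` A = (\<lambda>y. y + a) -` A \<inter> space borel" by simp
  also have "\<dots> \<in> sets borel" by measurable
  finally have A'[measurable]: "(\<lambda>y. y + a) -` A \<in> sets borel" .
  have "(+) a ` (hyperplane_perp \<xi> \<inter> (\<lambda>y. y + a) -` A) = hyperplane_perp \<xi> \<inter> A"
    using assms by (auto simp: hyperplane_perp_def inner_simps image_iff add.commute intro!: bexI[of _ "_ - a"])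
  then show "emeasure (distr (perp_measure \<xi>) borel (\<lambda>y. y + a)) A = emeasure (perp_measure \<xi>) A"
    using emeasure_hausdorff_measure_translate[of "hyperplane_perp \<xi> \<inter> (\<lambda>y. y + a) -` A" "DIM('a) - 1" a]
    by (simp add: emeasure_distr emeasure_perp_measure)
qed simp

text \<open>
  The product measure is invariant under translations along the hyperplane and along the line, so
  uniqueness of translation-invariant measures applies to its image in the whole space.
\<close>

lemma perp_times_line:
  fixes \<xi> :: "'a::euclidean_space"
  assumes norm1: "norm \<xi> = 1" and fin: "\<And>r. emeasure (perp_measure \<xi>) (cball 0 r) < \<infinity>"
  shows "\<exists>c\<ge>0. \<forall>f\<in>borel_measurable borel.
    (\<integral>\<^sup>+t. \<integral>\<^sup>+y. f (y + t *\<^sub>R \<xi>) \<partial>perp_measure \<xi> \<partial>lborel) = ennreal c * (\<integral>\<^sup>+x. f x \<partial>lborel)"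
proof -
  let ?\<mu> = "perp_measure \<xi>"
  interpret mu: sigma_finite_measure ?\<mu> by (rule sigma_finite_borel_locally_finite) (use fin in auto)
  interpret P: pair_sigma_finite ?\<mu> "lborel :: real measure" by standard
  define M where "M = distr (?\<mu> \<Otimes>\<^sub>M (lborel :: real measure)) borel (\<lambda>(y, t). y + t *\<^sub>R \<xi>)"
  have sets_M[simp, measurable_cong]: "sets M = sets borel" by (simp add: M_def)
  have [measurable]: "(\<lambda>(y, t). y + t *\<^sub>R \<xi>) \<in> borel_measurable (?\<mu> \<Otimes>\<^sub>M (lborel :: real measure))"
    by measurable
  have nnM: "(\<integral>\<^sup>+x. f x \<partial>M) = (\<integral>\<^sup>+t. \<integral>\<^sup>+y. f (y + t *\<^sub>R \<xi>) \<partial>?\<mu> \<partial>lborel)"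
    if [measurable]: "f \<in> borel_measurable borel" for f
    unfolding M_def by (simp add: nn_integral_distr case_prod_unfold P.nn_integral_snd[symmetric])
  have shift: "(\<integral>\<^sup>+y. f (y + a) \<partial>?\<mu>) = (\<integral>\<^sup>+y. f y \<partial>?\<mu>)"
    if [measurable]: "f \<in> borel_measurable borel" and "\<xi> \<bullet> a = 0" for f :: "'a \<Rightarrow> ennreal" and a
    by (subst (2) distr_perp_measure[OF that(2), symmetric]) (simp add: nn_integral_distr)
  have shiftL: "(\<integral>\<^sup>+x. f (s + x) \<partial>lborel) = (\<integral>\<^sup>+x. f x \<partial>lborel)"
    if [measurable]: "f \<in> borel_measurable borel" for f :: "real \<Rightarrow> ennreal" and s
    by (subst (2) lborel_distr_plus[of s, symmetric]) (simp add: nn_integral_distr)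
  have inv: "distr M borel (\<lambda>x. x + a) = M" for a
  proof (rule measure_eqI)
    fix A assume "A \<in> sets (distr M borel (\<lambda>x. x + a))"
    then have A[measurable]: "A \<in> sets borel" by simp
    \<comment> \<open>Split the translation vector into its components along the line and in the hyperplane.\<close>
    define s where "s = a \<bullet> \<xi>"
    define a' where "a' = a - s *\<^sub>R \<xi>"
    have a': "\<xi> \<bullet> a' = 0" using norm1
      by (simp add: a'_def s_def inner_simps inner_commute dot_square_norm)
    have "emeasure (distr M borel (\<lambda>x. x + a)) A = (\<integral>\<^sup>+x. indicator A x \<partial>distr M borel (\<lambda>x. x + a))" by simp
    also have "\<dots> = (\<integral>\<^sup>+x. indicator A (x + a) \<partial>M)"
      by (subst nn_integral_distr) auto
    also have "\<dots> = (\<integral>\<^sup>+t. \<integral>\<^sup>+y. indicator A (y + t *\<^sub>R \<xi> + a) \<partial>?\<mu> \<partial>lborel)" by (simp add: nnM)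
    also have "\<dots> = (\<integral>\<^sup>+t. \<integral>\<^sup>+y. indicator A (y + a' + (s + t) *\<^sub>R \<xi>) \<partial>?\<mu> \<partial>lborel)"
      by (intro nn_integral_cong arg_cong[where f="indicator A"]) (simp add: a'_def algebra_simps)
    also have "\<dots> = (\<integral>\<^sup>+t. \<integral>\<^sup>+y. indicator A (y + (s + t) *\<^sub>R \<xi>) \<partial>?\<mu> \<partial>lborel)"
      by (intro nn_integral_cong shift[where f="\<lambda>y. indicator A (y + _ *\<^sub>R \<xi>)"] a') simp
    also have "\<dots> = (\<integral>\<^sup>+t. \<integral>\<^sup>+y. indicator A (y + t *\<^sub>R \<xi>) \<partial>?\<mu> \<partial>lborel)"
      by (rule shiftL) simp
    also have "\<dots> = emeasure M A" by (simp add: nnM[symmetric])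
    finally show "emeasure (distr M borel (\<lambda>x. x + a)) A = emeasure M A" .
  qed simp
  have fin_M: "emeasure M (cball 0 r) < \<infinity>" for r
  proof -
    have "emeasure M (cball 0 r) = (\<integral>\<^sup>+t. \<integral>\<^sup>+y. indicator (cball 0 r) (y + t *\<^sub>R \<xi>) \<partial>?\<mu> \<partial>lborel)"
      by (subst nnM[symmetric]) (simp_all add: borel_measurable_indicator)
    also have "\<dots> \<le> (\<integral>\<^sup>+t. \<integral>\<^sup>+y. indicator {-r..r} t * indicator (cball 0 r) y \<partial>?\<mu> \<partial>lborel)"
    proof (rule nn_integral_mono, rule nn_integral_mono_AE)
      fix t :: real
      show "AE y in ?\<mu>. indicator (cball 0 r) (y + t *\<^sub>R \<xi>) \<le> (indicator {-r..r} t * indicator (cball 0 r) y :: ennreal)"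
        using AE_perp_measure[of \<xi>]
      proof eventually_elim
        case (elim y)
        have sq: "(norm (y + t *\<^sub>R \<xi>))\<^sup>2 = (norm y)\<^sup>2 + t\<^sup>2"
          using elim norm1 by (simp add: power2_norm_eq_inner inner_simps inner_commute) (simp add: norm_eq_1 power2_eq_square)
        show ?case
        proof (cases "norm (y + t *\<^sub>R \<xi>) \<le> r")
          case True
          then have r: "0 \<le> r" and "(norm (y + t *\<^sub>R \<xi>))\<^sup>2 \<le> r\<^sup>2" using norm_ge_zero order_trans power_mono by blast+
          then have "(norm y)\<^sup>2 \<le> r\<^sup>2" "t\<^sup>2 \<le> r\<^sup>2" unfolding sq by (smt (verit) zero_le_power2)+
          then have "norm y \<le> r" "\<bar>t\<bar> \<le> r" using r by (auto simp: power2_le_iff_abs_le)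
          then show ?thesis by (auto simp: indicator_def)
        qed (simp add: indicator_def)
      qed
    qed
    also have "\<dots> = (\<integral>\<^sup>+t. indicator {-r..r} t * emeasure ?\<mu> (cball 0 r) \<partial>lborel)"
      by (rule nn_integral_cong, subst nn_integral_cmult) (simp_all add: borel_measurable_indicator)
    also have "\<dots> = emeasure lborel {-r..r} * emeasure ?\<mu> (cball 0 r)"
      by (subst nn_integral_multc) simp_all
    also have "\<dots> < \<infinity>" using fin[of r] by (simp add: emeasure_lborel_Icc_eq ennreal_mult_less_top)
    finally show ?thesis .
  qed
  obtain c where c: "c \<ge> 0" "M = density lborel (\<lambda>_. ennreal c)"
    using translation_invariant_measure_unique[OF sets_M inv fin_M] by auto
  show ?thesis
  proof (intro exI conjI ballI)
    fix f :: "'a \<Rightarrow> ennreal" assume [measurable]: "f \<in> borel_measurable borel"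
    show "(\<integral>\<^sup>+t. \<integral>\<^sup>+y. f (y + t *\<^sub>R \<xi>) \<partial>?\<mu> \<partial>lborel) = ennreal c * (\<integral>\<^sup>+x. f x \<partial>lborel)"
      by (simp add: nnM[symmetric] c(2) nn_integral_density nn_integral_cmult)
  qed fact
qed

lemma slice_of_ball:
  fixes \<xi> :: "'a::euclidean_space"
  assumes norm1: "norm \<xi> = 1" and y: "\<xi> \<bullet> y = 0" and b: "y + t *\<^sub>R \<xi> \<in> ball a r"
  shows "\<bar>t - a \<bullet> \<xi>\<bar> \<le> r" "y \<in> cball (a - (a \<bullet> \<xi>) *\<^sub>R \<xi>) (sqrt (r\<^sup>2 - (t - a \<bullet> \<xi>)\<^sup>2))"
proof -
  let ?a = "a - (a \<bullet> \<xi>) *\<^sub>R \<xi>"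
  have eq: "y + t *\<^sub>R \<xi> - a = (y - ?a) + (t - a \<bullet> \<xi>) *\<^sub>R \<xi>" by (simp add: algebra_simps)
  have "(y - ?a) \<bullet> \<xi> = 0" using y norm1 by (simp add: inner_simps inner_commute norm_eq_1)
  then have "(norm (y + t *\<^sub>R \<xi> - a))\<^sup>2 = (norm (y - ?a))\<^sup>2 + (t - a \<bullet> \<xi>)\<^sup>2"
    unfolding eq power2_norm_eq_inner using norm1
    by (simp add: inner_add_left inner_add_right inner_commute norm_eq_1 power2_eq_square)
  moreover have "norm (y + t *\<^sub>R \<xi> - a) < r" using b by (simp add: dist_norm norm_minus_commute)
  moreover then have "(norm (y + t *\<^sub>R \<xi> - a))\<^sup>2 \<le> r\<^sup>2" and r: "0 < r"
    using norm_ge_zero[of "y + t *\<^sub>R \<xi> - a"] by (auto intro: power_mono less_imp_le simp del: norm_ge_zero)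
  ultimately have *: "(norm (y - ?a))\<^sup>2 + (t - a \<bullet> \<xi>)\<^sup>2 \<le> r\<^sup>2" by simp
  then have "(t - a \<bullet> \<xi>)\<^sup>2 \<le> r\<^sup>2" using zero_le_power2[of "norm (y - ?a)"] by linarith
  then show "\<bar>t - a \<bullet> \<xi>\<bar> \<le> r" using r by (simp add: power2_le_iff_abs_le)
  have "norm (y - ?a) \<le> sqrt (r\<^sup>2 - (t - a \<bullet> \<xi>)\<^sup>2)" using * by (intro real_le_rsqrt) simp
  then show "y \<in> cball ?a (sqrt (r\<^sup>2 - (t - a \<bullet> \<xi>)\<^sup>2))" by (simp add: dist_norm norm_minus_commute)
qed

text \<open>
  Fill a cylinder over the disc by disjoint balls of diameter at most \<open>d\<close>, up to a null set. At almost
  every height \<open>t\<close> the slices of the balls cover the disc up to a set of zero content, so the content of the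
  disc is at most the sum of the gauges of these slices, which are discs of one dimension less.
  Integrating over \<open>t\<close> turns the gauges into the volumes of the balls, whose sum is at most the volume of the
  cylinder.
\<close>

lemma hausdorff_content_disc_le:
  fixes \<xi> :: "'a::euclidean_space"
  assumes norm1: "norm \<xi> = 1" and d: "d > 0"
    and fin: "\<And>r. emeasure (perp_measure \<xi>) (cball 0 r) < \<infinity>"
    and meas: "measure_space UNIV (sets (borel :: 'a measure)) (hausdorff_outer (DIM('a) - 1))"
    and eq: "\<And>f. f \<in> borel_measurable borel \<Longrightarrow>
    (\<integral>\<^sup>+t. \<integral>\<^sup>+y. f (y + t *\<^sub>R \<xi>) \<partial>perp_measure \<xi> \<partial>lborel) = ennreal c * (\<integral>\<^sup>+x. f x \<partial>lborel)"
  shows "hausdorff_content (DIM('a) - 1) d (hyperplane_perp \<xi> \<inter> ball 0 1)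
     \<le> emeasure lborel {x. norm (x - (x \<bullet> \<xi>) *\<^sub>R \<xi>) < 1 \<and> 0 < x \<bullet> \<xi> \<and> x \<bullet> \<xi> < 1}"
proof -
  interpret mu: sigma_finite_measure "perp_measure \<xi>" by (rule sigma_finite_borel_locally_finite) (use fin in auto)
  define m where "m = DIM('a) - 1"
  have m: "DIM('a) = Suc m" by (simp add: m_def)
  define S where "S = hyperplane_perp \<xi>"
  have S[measurable]: "S \<in> sets borel" by (simp add: S_def)
  define Q where "Q = {x. norm (x - (x \<bullet> \<xi>) *\<^sub>R \<xi>) < 1 \<and> 0 < x \<bullet> \<xi> \<and> x \<bullet> \<xi> < 1}"
  have "open Q" unfolding Q_def by (intro open_Collect_conj open_Collect_less continuous_intros)
  then have Q[measurable]: "Q \<in> sets borel" by simp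
  define I where "I = {(a, r). 0 < r \<and> r \<le> d / 2 \<and> ball a r \<subseteq> Q}"
  obtain C where C: "countable C" "C \<subseteq> I"
     and disj: "pairwise (\<lambda>i j. disjnt (ball (fst i) (snd i)) (ball (fst j) (snd j))) C"
     and neg: "negligible (Q - (\<Union>i\<in>C. ball (fst i) (snd i)))"
  proof (rule Vitali_covering_theorem_balls[of Q I fst snd])
    fix x :: 'a and e :: real assume "x \<in> Q" "0 < e"
    then obtain s where s: "s > 0" "ball x s \<subseteq> Q" using \<open>open Q\<close> open_contains_ball by blast
    define r where "r = min (min s (e / 2)) (d / 2)"
    have "0 < r" "r < e" "r \<le> d / 2" "r \<le> s" using s \<open>0 < e\<close> d by (auto simp: r_def)
    then show "\<exists>i. i \<in> I \<and> x \<in> ball (fst i) (snd i) \<and> snd i < e"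
      using s subset_ball[of r s x] by (intro exI[of _ "(x, r)"]) (auto simp: I_def)
  qed blast
  have rpos: "snd i > 0" "snd i \<le> d / 2" "ball (fst i) (snd i) \<subseteq> Q" if "i \<in> C" for i using subsetD[OF C(2) that] by (auto simp: I_def)
  define N where "N = Q - (\<Union>i\<in>C. ball (fst i) (snd i))"
  have N[measurable]: "N \<in> sets borel" unfolding N_def using C(1) by (intro sets.Diff sets.countable_UN'') auto
  have "emeasure lborel N = 0"
    using neg by (simp add: N_def[symmetric] negligible_iff_null_sets null_sets_completion_iff null_sets_def)
  then have "(\<integral>\<^sup>+t. \<integral>\<^sup>+y. indicator N (y + t *\<^sub>R \<xi>) \<partial>perp_measure \<xi> \<partial>lborel) = 0"
    by (subst eq) auto
  then have "AE t in lborel. (\<integral>\<^sup>+y. indicator N (y + t *\<^sub>R \<xi>) \<partial>perp_measure \<xi>) = 0"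
    by (subst (asm) nn_integral_0_iff_AE) auto
  then have null: "AE t in lborel. hausdorff_content m d (S \<inter> {y. y + t *\<^sub>R \<xi> \<in> N}) = 0"
  proof eventually_elim
    case (elim t)
    have "{y. y + t *\<^sub>R \<xi> \<in> N} = (\<lambda>y. y + t *\<^sub>R \<xi>) -` N \<inter> space borel" by auto
    also have "\<dots> \<in> sets borel" by measurable
    finally have [measurable]: "{y. y + t *\<^sub>R \<xi> \<in> N} \<in> sets borel" .
    have "(\<integral>\<^sup>+y. indicator N (y + t *\<^sub>R \<xi>) \<partial>perp_measure \<xi>) = (\<integral>\<^sup>+y. indicator {y. y + t *\<^sub>R \<xi> \<in> N} y \<partial>perp_measure \<xi>)"
      by (intro nn_integral_cong) (simp add: indicator_def)
    with elim have "emeasure (perp_measure \<xi>) {y. y + t *\<^sub>R \<xi> \<in> N} = 0" by simp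
    then have "hausdorff_outer m (S \<inter> {y. y + t *\<^sub>R \<xi> \<in> N}) = 0"
      using meas by (simp add: emeasure_perp_measure emeasure_hausdorff_measure m_def S_def)
    then show ?case using hausdorff_content_le_outer[OF d, of m "S \<inter> {y. y + t *\<^sub>R \<xi> \<in> N}"] by simp
  qed
  define g where "g i t = indicator {- snd i..snd i} (t - fst i \<bullet> \<xi>) * ennreal (unit_ball_vol (real m) * sqrt ((snd i)\<^sup>2 - (t - fst i \<bullet> \<xi>)\<^sup>2) ^ m)" for i t
  have g[measurable]: "g i \<in> borel_measurable borel" for i unfolding g_def by measurable
  have slices: "hausdorff_content m d (S \<inter> ball 0 1) \<le> (\<integral>\<^sup>+i. g i t \<partial>count_space C)"
    if t: "0 < t" "t < 1" and t0: "hausdorff_content m d (S \<inter> {y. y + t *\<^sub>R \<xi> \<in> N}) = 0" for t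
  proof (rule hausdorff_content_le_cover[OF C(1) _ _ _ t0])
    define E where "E i = {y \<in> S. y + t *\<^sub>R \<xi> \<in> ball (fst i) (snd i)}" for i
    show "S \<inter> ball 0 1 \<subseteq> (\<Union>i\<in>C. E i) \<union> S \<inter> {y. y + t *\<^sub>R \<xi> \<in> N}"
    proof
      fix y assume y: "y \<in> S \<inter> ball 0 1"
      then have "(y + t *\<^sub>R \<xi>) \<bullet> \<xi> = t" using norm1
        by (simp add: S_def hyperplane_perp_def inner_add_left inner_add_right inner_commute norm_eq_1)
      then have "y + t *\<^sub>R \<xi> \<in> Q" using y t by (simp add: Q_def)
      then show "y \<in> (\<Union>i\<in>C. E i) \<union> S \<inter> {y. y + t *\<^sub>R \<xi> \<in> N}" using y by (auto simp: N_def E_def)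
    qed
    fix i assume i: "i \<in> C"
    let ?\<rho> = "sqrt ((snd i)\<^sup>2 - (t - fst i \<bullet> \<xi>)\<^sup>2)"
    have sub: "E i \<subseteq> cball (fst i - (fst i \<bullet> \<xi>) *\<^sub>R \<xi>) ?\<rho>" and ab: "E i \<noteq> {} \<Longrightarrow> \<bar>t - fst i \<bullet> \<xi>\<bar> \<le> snd i"
      using slice_of_ball[OF norm1] by (auto simp: E_def S_def hyperplane_perp_def)
    show "bounded (E i)" by (rule bounded_subset[OF bounded_cball sub])
    have diam: "diameter (E i) \<le> 2 * ?\<rho> \<and> 0 \<le> ?\<rho>" if "E i \<noteq> {}"
    proof -
      have "0 \<le> ?\<rho>" using ab[OF that] rpos[OF i] by (simp add: power2_le_iff_abs_le)
      moreover have "diameter (E i) \<le> diameter (cball (fst i - (fst i \<bullet> \<xi>) *\<^sub>R \<xi>) ?\<rho>)"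
        by (rule diameter_subset[OF sub bounded_cball])
      ultimately show ?thesis by (simp add: diameter_cball)
    qed
    have "?\<rho> \<le> snd i" using rpos[OF i] by (intro real_le_lsqrt) auto
    then show "diameter (E i) \<le> d" using diam rpos[OF i] d by (cases "E i = {}") auto
    show "hausdorff_gauge m (E i) \<le> g i t"
    proof (cases "E i = {}")
      case False
      have "(diameter (E i) / 2) ^ m \<le> ?\<rho> ^ m"
        using diam[OF False] diameter_ge_0[OF bounded_subset[OF bounded_cball sub]] by (intro power_mono) auto
      then show ?thesis using ab[OF False] False
        by (auto simp: hausdorff_gauge_def g_def indicator_def intro!: ennreal_leI mult_left_mono)
    qed (simp add: hausdorff_gauge_def)
  qed (use d in simp)
  have int_g: "(\<integral>\<^sup>+t. g i t \<partial>lborel) = emeasure lborel (ball (fst i) (snd i))" if "i \<in> C" for i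
  proof -
    have "(\<integral>\<^sup>+t. g i t \<partial>lborel) = (\<integral>\<^sup>+t. g i (fst i \<bullet> \<xi> + 1 * t) \<partial>lborel)"
      by (subst nn_integral_real_affine[where c = 1 and t = "fst i \<bullet> \<xi>"]) auto
    also have "\<dots> = ennreal (unit_ball_vol (real (Suc m)) * snd i ^ Suc m)"
      using nn_integral_ball_slices[OF rpos(1)[OF that], of m] by (simp add: g_def)
    finally show ?thesis using rpos[OF that] by (simp add: emeasure_ball m del: power_Suc of_nat_Suc)
  qed
  have "hausdorff_content m d (S \<inter> ball 0 1) = (\<integral>\<^sup>+t. hausdorff_content m d (S \<inter> ball 0 1) * indicator {0<..<1} (t::real) \<partial>lborel)"
    by (subst nn_integral_cmult_indicator) auto
  also have "\<dots> \<le> (\<integral>\<^sup>+t. \<integral>\<^sup>+i. g i t \<partial>count_space C \<partial>lborel)"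
    using null by (intro nn_integral_mono_AE, eventually_elim) (auto simp: indicator_def slices)
  also have "\<dots> = (\<integral>\<^sup>+i. \<integral>\<^sup>+t. g i t \<partial>lborel \<partial>count_space C)"
    using C(1) by (intro nn_integral_count_space_nn_integral) auto
  also have "\<dots> = (\<integral>\<^sup>+i. emeasure lborel (ball (fst i) (snd i)) \<partial>count_space C)"
    by (intro nn_integral_cong) (simp add: int_g)
  also have "\<dots> = emeasure lborel (\<Union>i\<in>C. ball (fst i) (snd i))"
    using disj C(1) by (intro emeasure_UN_countable[symmetric])
      (auto simp: disjoint_family_on_def pairwise_def disjnt_def)
  also have "\<dots> \<le> emeasure lborel Q"
    using rpos(3) by (intro emeasure_mono) auto
  finally show ?thesis by (simp add: Q_def S_def m_def)
qed

text \<open>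
  The constant of \<open>perp_times_line\<close> is at most 1 by comparing a cylinder of height 1 with its base.
  Finiteness on balls is assumed; otherwise all marginals of positive continuous functions
  vanish (\<open>marginal_eq_0\<close>).
\<close>

lemma (in orthonormal_basis) perp_measure_le_lebesgue:
  assumes xi: "\<xi> \<in> B" and fin: "\<And>r. emeasure (perp_measure \<xi>) (cball 0 r) < \<infinity>"
  obtains c where "0 \<le> c" "c \<le> 1"
    "perp_measure \<xi> = density (distr (PiM (B - {\<xi>}) (\<lambda>_. lborel)) borel (\<lambda>w. comb (w(\<xi> := 0)))) (\<lambda>_. ennreal c)"
proof -
  have norm1: "norm \<xi> = 1" using norm_B xi by simp
  interpret mu: sigma_finite_measure "perp_measure \<xi>" by (rule sigma_finite_borel_locally_finite) (use fin in auto)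
  interpret product_sigma_finite "\<lambda>_::'a. lborel :: real measure" by standard
  define s where "s = (\<lambda>w::'a\<Rightarrow>real. comb (w(\<xi> := 0)))"
  have s[measurable]: "s \<in> PiM (B - {\<xi>}) (\<lambda>_. lborel) \<rightarrow>\<^sub>M borel" 
    unfolding s_def using comb_upd_measurable[OF xi, of 0]
    by (rule measurable_cong_sets[THEN equalityD1, THEN subsetD, rotated 2]) (auto intro!: sets_PiM_cong)
  have comb_s: "comb (w(\<xi> := t)) = s w + t *\<^sub>R \<xi>" for w t unfolding s_def by (rule comb_upd[OF xi])
  have s_perp: "s w \<bullet> \<xi> = 0" for w unfolding s_def comb_inner[OF xi] by simp
  obtain c where c0: "0 \<le> c" and eq: "\<And>f. f \<in> borel_measurable borel \<Longrightarrow>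
    (\<integral>\<^sup>+t. \<integral>\<^sup>+y. f (y + t *\<^sub>R \<xi>) \<partial>perp_measure \<xi> \<partial>lborel) = ennreal c * (\<integral>\<^sup>+x. f x \<partial>lborel)"
    using perp_times_line[OF norm1 fin] by blast
  have perp: "(\<integral>\<^sup>+y. k y \<partial>perp_measure \<xi>) = ennreal c * (\<integral>\<^sup>+w. k (s w) \<partial>PiM (B - {\<xi>}) (\<lambda>_. lborel))"
    if k[measurable]: "k \<in> borel_measurable borel" for k
  proof -
    \<comment> \<open>A function that factorises into \<open>k\<close> on the hyperplane and the indicator of \<open>{0..1}\<close> on the line isolates the first factor.\<close>
    define K where "K x = k (x - (x \<bullet> \<xi>) *\<^sub>R \<xi>) * indicator {0..1} (x \<bullet> \<xi>)" for x
    have [measurable]: "K \<in> borel_measurable borel" unfolding K_def by measurable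
    have K: "K (y + t *\<^sub>R \<xi>) = k y * indicator {0..1} t" if "y \<bullet> \<xi> = 0" for y t
      using that norm1 by (simp add: K_def inner_add_left norm_eq_1)
    have "(\<integral>\<^sup>+y. k y \<partial>perp_measure \<xi>) = (\<integral>\<^sup>+t. \<integral>\<^sup>+y. k y * indicator {0..1::real} t \<partial>perp_measure \<xi> \<partial>lborel)"
      by (simp add: nn_integral_multc nn_integral_cmult)
    also have "\<dots> = (\<integral>\<^sup>+t. \<integral>\<^sup>+y. K (y + t *\<^sub>R \<xi>) \<partial>perp_measure \<xi> \<partial>lborel)"
    proof (rule nn_integral_cong, rule nn_integral_cong_AE)
      fix t
      show "AE y in perp_measure \<xi>. k y * indicator {0..1} t = K (y + t *\<^sub>R \<xi>)"
        using AE_perp_measure[of \<xi>] by eventually_elim (simp add: K inner_commute)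
    qed
    also have "\<dots> = ennreal c * (\<integral>\<^sup>+x. K x \<partial>lborel)" by (rule eq) simp
    also have "(\<integral>\<^sup>+x. K x \<partial>lborel) = (\<integral>\<^sup>+x. K (comb x) \<partial>PiM (insert \<xi> (B - {\<xi>})) (\<lambda>_. lborel))"
      using xi by (subst distr_comb_lborel[symmetric]) (simp add: nn_integral_distr insert_absorb)
    also have "\<dots> = (\<integral>\<^sup>+t. \<integral>\<^sup>+w. K (comb (w(\<xi> := t))) \<partial>PiM (B - {\<xi>}) (\<lambda>_. lborel) \<partial>lborel)"
      using finite_B xi by (intro product_nn_integral_insert_rev) (auto simp: insert_absorb)
    also have "\<dots> = (\<integral>\<^sup>+t. \<integral>\<^sup>+w. K (s w + t *\<^sub>R \<xi>) \<partial>PiM (B - {\<xi>}) (\<lambda>_. lborel) \<partial>lborel)"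
      by (simp only: comb_s)
    also have "\<dots> = (\<integral>\<^sup>+t. \<integral>\<^sup>+w. k (s w) * indicator {0..1::real} t \<partial>PiM (B - {\<xi>}) (\<lambda>_. lborel) \<partial>lborel)"
      by (simp add: K s_perp)
    also have "\<dots> = (\<integral>\<^sup>+w. k (s w) \<partial>PiM (B - {\<xi>}) (\<lambda>_. lborel))"
      by (simp add: nn_integral_multc nn_integral_cmult)
    finally show ?thesis .
  qed
  have "c \<le> 1"
  proof (cases "measure_space UNIV (sets (borel :: 'a measure)) (hausdorff_outer (DIM('a) - 1))")
    case meas: True
    define Q where "Q = {x. norm (x - (x \<bullet> \<xi>) *\<^sub>R \<xi>) < 1 \<and> 0 < x \<bullet> \<xi> \<and> x \<bullet> \<xi> < 1}"
    have "open Q" unfolding Q_def by (intro open_Collect_conj open_Collect_less continuous_intros)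
    then have Q[measurable]: "Q \<in> sets borel" by simp
    define S where "S = hyperplane_perp \<xi> \<inter> ball 0 1"
    have [measurable]: "S \<in> sets borel" by (simp add: S_def)
    have "emeasure (perp_measure \<xi>) (ball 0 1) = hausdorff_outer (DIM('a) - 1) S"
      using meas by (simp add: emeasure_perp_measure emeasure_hausdorff_measure S_def)
    also have "\<dots> \<le> emeasure lborel Q"
      unfolding hausdorff_outer_def S_def Q_def
      by (intro SUP_least hausdorff_content_disc_le[OF norm1 _ fin meas eq]) auto
    finally have le: "emeasure (perp_measure \<xi>) (ball 0 1) \<le> emeasure lborel Q" .
    have "ennreal c * emeasure lborel Q = (\<integral>\<^sup>+t. \<integral>\<^sup>+y. indicator Q (y + t *\<^sub>R \<xi>) \<partial>perp_measure \<xi> \<partial>lborel)"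
      by (subst eq) auto
    also have "\<dots> = (\<integral>\<^sup>+t. \<integral>\<^sup>+y. indicator (ball 0 1) y * indicator {0<..<1::real} t \<partial>perp_measure \<xi> \<partial>lborel)"
    proof (rule nn_integral_cong, rule nn_integral_cong_AE)
      fix t
      show "AE y in perp_measure \<xi>. indicator Q (y + t *\<^sub>R \<xi>) = (indicator (ball 0 1) y * indicator {0<..<1} t :: ennreal)"
        using AE_perp_measure[of \<xi>]
      proof eventually_elim
        case (elim y)
        then have "(y + t *\<^sub>R \<xi>) \<bullet> \<xi> = t" using norm1 by (simp add: inner_add_left inner_add_right inner_commute norm_eq_1)
        then show ?case by (auto simp: Q_def indicator_def)
      qed
    qed
    also have "\<dots> = (\<integral>\<^sup>+t. emeasure (perp_measure \<xi>) (ball 0 1) * indicator {0<..<1::real} t \<partial>lborel)"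
      by (rule nn_integral_cong, subst nn_integral_multc) (simp_all add: borel_measurable_indicator)
    also have "\<dots> = emeasure (perp_measure \<xi>) (ball 0 1)"
      by (subst nn_integral_cmult_indicator) simp_all
    finally have *: "ennreal c * emeasure lborel Q \<le> emeasure lborel Q" using le by simp
    have "Q \<subseteq> cball 0 2"
    proof
      fix x assume x: "x \<in> Q"
      have "norm x \<le> norm (x - (x \<bullet> \<xi>) *\<^sub>R \<xi>) + norm ((x \<bullet> \<xi>) *\<^sub>R \<xi>)"
        using norm_triangle_ineq[of "x - (x \<bullet> \<xi>) *\<^sub>R \<xi>" "(x \<bullet> \<xi>) *\<^sub>R \<xi>"] by simp
      then show "x \<in> cball 0 2" using x norm1 by (simp add: Q_def)
    qed
    then have "emeasure lborel Q \<le> emeasure lborel (cball (0::'a) 2)" by (intro emeasure_mono) auto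
    also have "\<dots> < \<infinity>" by (simp add: emeasure_cball)
    finally have Qfin: "emeasure lborel Q \<noteq> \<infinity>" by simp
    have "(1/2) *\<^sub>R \<xi> \<in> Q" using norm1 by (simp add: Q_def norm_eq_1)
    then have "\<not> negligible Q" using \<open>open Q\<close> open_not_negligible by blast
    then have Q0: "emeasure lborel Q \<noteq> 0"
      by (auto simp: negligible_iff_null_sets null_sets_completion_iff null_sets_def)
    obtain q where q: "emeasure lborel Q = ennreal q" "q > 0"
      using Qfin Q0 by (cases "emeasure lborel Q") auto
    show "c \<le> 1" using * c0 q by (simp add: ennreal_mult[symmetric] ennreal_le_iff)
  next
    case False
    then have "perp_measure \<xi> = null_measure borel"
      by (intro measure_eqI) (simp_all add: emeasure_perp_measure emeasure_hausdorff_measure)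
    then have "ennreal c * emeasure lborel (cball (0::'a) 1) = 0"
      using eq[of "indicator (cball 0 1)"] by (simp add: borel_measurable_indicator)
    moreover have "unit_ball_vol (real DIM('a)) > 0" by (rule unit_ball_vol_pos) simp
    ultimately show "c \<le> 1" using c0 by (simp add: emeasure_cball ennreal_mult[symmetric] del: unit_ball_vol_pos unit_ball_vol_nonneg)
  qed
  show thesis
  proof (rule that[OF c0 \<open>c \<le> 1\<close>])
    show "perp_measure \<xi> = density (distr (PiM (B - {\<xi>}) (\<lambda>_. lborel)) borel (\<lambda>w. comb (w(\<xi> := 0)))) (\<lambda>_. ennreal c)"
      unfolding s_def[symmetric]
    proof (rule measure_eqI)
      fix A assume "A \<in> sets (perp_measure \<xi>)"
      then have [measurable]: "A \<in> sets borel" by simp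
      have "emeasure (perp_measure \<xi>) A = (\<integral>\<^sup>+y. indicator A y \<partial>perp_measure \<xi>)" by simp
      also have "\<dots> = ennreal c * (\<integral>\<^sup>+w. indicator A (s w) \<partial>PiM (B - {\<xi>}) (\<lambda>_. lborel))" by (rule perp) simp
      also have "\<dots> = ennreal c * (\<integral>\<^sup>+x. indicator A x \<partial>distr (PiM (B - {\<xi>}) (\<lambda>_. lborel)) borel s)"
        by (subst nn_integral_distr) auto
      finally show "emeasure (perp_measure \<xi>) A = emeasure (density (distr (PiM (B - {\<xi>}) (\<lambda>_. lborel)) borel s) (\<lambda>_. ennreal c)) A"
        by (simp add: emeasure_density nn_integral_cmult_indicator)
    qed simp
  qed
qed

section \<open>Increasing transport on the line\<close>

lemma class_B_D:
  assumes "u \<in> class_B"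
  shows "continuous_on UNIV u" "\<And>x. u x > 0" "has_bochner_integral lborel u 1" "integrable lborel u"
    "u \<in> borel_measurable borel"
  using assms by (auto simp: class_B_def has_bochner_integral_iff intro: borel_measurable_continuous_onI)

lemma real_distribution_density:
  assumes "u \<in> class_B"
  shows "real_distribution (density lborel u)"
proof -
  note u = class_B_D[OF assms]
  note [measurable] = u(5)
  have "(\<integral>\<^sup>+x. ennreal (u x) \<partial>lborel) = 1"
    using u by (subst nn_integral_eq_integral) (auto simp: has_bochner_integral_iff less_imp_le)
  then have "prob_space (density lborel u)"
    by (intro prob_spaceI) (simp add: emeasure_density)
  then show ?thesis by (simp add: real_distribution_def real_distribution_axioms_def)
qed

lemma cdf_of_eq_cdf:
  assumes "u \<in> class_B"
  shows "cdf_of u x = cdf (density lborel u) x"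
proof -
  note u = class_B_D[OF assms]
  note [measurable] = u(5)
  have "cdf_of u x = (\<integral>y. indicator {..x} y \<partial>density lborel u)"
    unfolding cdf_of_def set_lebesgue_integral_def using u(2)
    by (subst integral_density) (auto simp: less_imp_le mult.commute)
  then show ?thesis by (simp add: cdf_def)
qed

lemma cdf_of_has_derivative:
  assumes "u \<in> class_B"
  shows "(cdf_of u has_real_derivative u x) (at x)"
proof -
  note u = class_B_D[OF assms]
  have set_int: "set_integrable lborel A u" if "A \<in> sets borel" for A
    using u(4) that unfolding set_integrable_def by (intro integrable_mult_indicator) auto
  have eq: "cdf_of u y = cdf_of u (x - 1) + integral {x - 1..y} u" if "y > x - 1" for y
  proof -
    have "{..y} = {..x - 1} \<union> {x - 1<..y}" using that by auto
    then have "cdf_of u y = cdf_of u (x - 1) + (LINT z:{x - 1<..y}|lborel. u z)"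
      unfolding cdf_of_def by (simp only:) (intro set_integral_Un set_int; auto)
    also have "(LINT z:{x - 1<..y}|lborel. u z) = (LINT z:{x - 1..y}|lborel. u z)"
    proof (rule set_integral_null_delta[OF u(4)])
      have "{x - 1<..y} - {x - 1..y} \<union> ({x - 1..y} - {x - 1<..y}) = {x - 1}" using that by auto
      then show "{x - 1<..y} - {x - 1..y} \<union> ({x - 1..y} - {x - 1<..y}) \<in> null_sets lborel"
        by (simp add: countable_imp_null_set_lborel)
    qed auto
    also have "\<dots> = integral {x - 1..y} u"
      by (rule set_borel_integral_eq_integral) (rule set_int, simp)
    finally show ?thesis .
  qed
  have "((\<lambda>y. integral {x - 1..y} u) has_real_derivative u x) (at x within {x - 1..x + 1})"
    by (rule integral_has_real_derivative) (auto intro: continuous_on_subset[OF u(1)])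
  then have "((\<lambda>y. cdf_of u (x - 1) + integral {x - 1..y} u) has_real_derivative u x) (at x)"
    by (auto intro!: derivative_eq_intros simp: at_within_Icc_at)
  then show ?thesis
  proof (rule DERIV_cong_ev[THEN iffD1, rotated -1])
    show "\<forall>\<^sub>F y in nhds x. cdf_of u (x - 1) + integral {x - 1..y} u = cdf_of u y"
      using eventually_nhds_in_open[of "{x - 1<..}" x] by (auto elim!: eventually_mono simp: eq)
  qed auto
qed

lemma cdf_of_strict_mono:
  assumes "u \<in> class_B"
  shows "strict_mono (cdf_of u)"
proof (rule strict_monoI)
  fix x y :: real assume "x < y"
  then show "cdf_of u x < cdf_of u y"
    using DERIV_pos_imp_increasing[of x y "cdf_of u"] cdf_of_has_derivative[OF assms] class_B_D(2)[OF assms] by blast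
qed

lemma cdf_of_range:
  assumes "u \<in> class_B"
  shows "range (cdf_of u) = {0<..<1}"
proof -
  interpret real_distribution "density lborel u" by (rule real_distribution_density[OF assms])
  have cdf: "cdf_of u = cdf (density lborel u)" using cdf_of_eq_cdf[OF assms] by auto
  have sm: "strict_mono (cdf_of u)" by (rule cdf_of_strict_mono[OF assms])
  have "0 < cdf_of u x \<and> cdf_of u x < 1" for x
  proof
    have "0 \<le> cdf_of u (x - 1)" by (simp add: cdf cdf_nonneg)
    also have "\<dots> < cdf_of u x" using sm by (simp add: strict_mono_less)
    finally show "0 < cdf_of u x" .
    have "cdf_of u x < cdf_of u (x + 1)" using sm by (simp add: strict_mono_less)
    also have "\<dots> \<le> 1" by (simp add: cdf cdf_bounded_prob)
    finally show "cdf_of u x < 1" .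
  qed
  moreover have "y \<in> range (cdf_of u)" if y: "0 < y" "y < 1" for y
  proof -
    obtain a where a: "cdf_of u a < y"
      using order_tendstoD(2)[OF cdf_lim_at_bot y(1)] unfolding cdf[symmetric]
      by (auto simp: eventually_at_bot_linorder)
    obtain b where b: "cdf_of u b > y"
      using order_tendstoD(1)[OF cdf_lim_at_top_prob y(2)] unfolding cdf[symmetric]
      by (auto simp: eventually_at_top_linorder)
    have "a < b" using a b sm by (metis less_trans strict_mono_less)
    then obtain x where "cdf_of u x = y"
      using IVT'[of "cdf_of u" a y b] a b cdf_of_has_derivative[OF assms]
      by (metis DERIV_isCont continuous_at_imp_continuous_on less_imp_le)
    then show ?thesis by blast
  qed
  ultimately show ?thesis by auto
qed

lemma cdf_of_transport:
  assumes "u \<in> class_B" "v \<in> class_B"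
  shows "cdf_of v (transport u v x) = cdf_of u x"
proof -
  have "cdf_of u x \<in> range (cdf_of v)"
    using cdf_of_range[OF assms(1)] cdf_of_range[OF assms(2)] by auto
  then show ?thesis by (simp add: transport_def f_inv_into_f)
qed

lemma transport_has_derivative:
  assumes u: "u \<in> class_B" and v: "v \<in> class_B"
  shows "(transport u v has_real_derivative u x / v (transport u v x)) (at x)"
proof -
  let ?T = "transport u v"
  have "inj (cdf_of v)" using cdf_of_strict_mono[OF v] by (rule strict_mono_imp_inj_on)
  then have "inv (cdf_of v) (cdf_of v z) = z" for z by simp
  then have "isCont (inv (cdf_of v)) (cdf_of v (?T x))"
    using DERIV_isCont[OF cdf_of_has_derivative[OF v]]
    by (rule isCont_inverse_function[OF zero_less_one])
  moreover have "0 < cdf_of u x" "cdf_of u x < 1" using cdf_of_range[OF u] by auto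
  moreover have "cdf_of v (inv (cdf_of v) y) = y" if "0 < y" "y < 1" for y
    using that cdf_of_range[OF v] by (intro f_inv_into_f) auto
  moreover have "inv (cdf_of v) (cdf_of u x) = ?T x" by (simp add: transport_def)
  ultimately have "(inv (cdf_of v) has_real_derivative inverse (v (?T x))) (at (cdf_of u x))"
    using cdf_of_has_derivative[OF v, of "?T x"] class_B_D(2)[OF v, of "?T x"]
    by (intro DERIV_inverse_function[where f = "cdf_of v" and a = 0 and b = 1])
       (auto simp: cdf_of_transport[OF u v])
  from DERIV_chain[OF this cdf_of_has_derivative[OF u]] show ?thesis
    by (simp add: transport_def divide_inverse mult.commute)
qed

lemma deriv_transport:
  assumes "u \<in> class_B" "v \<in> class_B"
  shows "deriv (transport u v) x = u x / v (transport u v x)"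
  by (rule DERIV_imp_deriv[OF transport_has_derivative[OF assms]])

lemma borel_measurable_transport:
  assumes "u \<in> class_B" "v \<in> class_B"
  shows "transport u v \<in> borel_measurable borel"
proof (rule borel_measurable_continuous_onI, rule continuous_at_imp_continuous_on, rule ballI)
  fix x show "isCont (transport u v) x" by (rule DERIV_isCont[OF transport_has_derivative[OF assms]])
qed

lemma cdf_of_scale: "cdf_of (\<lambda>x. c * u x) x = c * cdf_of u x"
  by (simp add: cdf_of_def)

text \<open>
  A common factor cancels between the two distribution functions. This is where an undetermined
  normalisation of the Hausdorff measure disappears from the transport map.
\<close>

lemma transport_scale:
  assumes "c \<noteq> 0"
  shows "transport (\<lambda>x. c * u x) (\<lambda>x. c * v x) = transport u v"
  using assms by (simp add: transport_def fun_eq_iff cdf_of_scale inv_into_def)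

lemma dist1_scale:
  assumes c: "0 < c" and u: "u \<in> class_B" and v: "v \<in> class_B"
  shows "dist1 (\<lambda>x. c * u x) (\<lambda>x. c * v x) = c * dist1 u v"
proof -
  note [measurable] = class_B_D(5)[OF u]
  let ?h = "\<lambda>x. \<bar>1 - deriv (transport u v) x\<bar> / max 1 (deriv (transport u v) x)"
  note [measurable] = borel_measurable_transport[OF u v] class_B_D(5)[OF v]
  have [measurable]: "?h \<in> borel_measurable borel" unfolding deriv_transport[OF u v] by measurable
  have pos: "0 \<le> u x" for x using class_B_D(2)[OF u, of x] by simp
  have "dist1 (\<lambda>x. c * u x) (\<lambda>x. c * v x) = (LINT x|lborel. c * (u x * ?h x))"
    unfolding dist1_def transport_scale[OF less_imp_neq[OF c, symmetric]]
    using c pos by (subst integral_density) (auto intro!: Bochner_Integration.integral_cong)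
  also have "\<dots> = c * (LINT x|lborel. u x * ?h x)" by (rule integral_mult_right_zero)
  also have "\<dots> = c * dist1 u v"
    unfolding dist1_def using pos by (subst integral_density) auto
  finally show ?thesis .
qed

text \<open>
  Equality holds at \<open>x = 1\<close>, and the difference of the two sides is monotone on either side of 1.
\<close>

lemma sq_le_log_gap:
  fixes x :: real
  assumes "x > 0"
  shows "(\<bar>1 - x\<bar> / max 1 x)\<^sup>2 \<le> 2 * (x - 1 - ln x)"
proof (cases "x \<ge> 1")
  case True
  define h where "h y = 2 * (y - 1 - ln y) - (1 - 1 / y)\<^sup>2" for y :: real
  have "h 1 \<le> h x"
  proof (rule DERIV_nonneg_imp_nondecreasing[where f = h, OF True])
    fix y :: real assume y: "1 \<le> y" "y \<le> x"
    have "(h has_real_derivative 2 * (1 - 1 / y) - 2 * (1 - 1 / y) * (1 / y\<^sup>2)) (at y)"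
      unfolding h_def using y by (auto intro!: derivative_eq_intros simp: power2_eq_square)
    moreover have "2 * (1 - p) - 2 * (1 - p) * q = 2 * ((1 - p) * (1 - q))" for p q :: real
      by (simp add: algebra_simps)
    moreover have "0 \<le> (1 - 1 / y) * (1 - 1 / y\<^sup>2)"
      using y by (intro mult_nonneg_nonneg) (auto simp: divide_le_eq_1 one_le_power)
    ultimately show "\<exists>z. (h has_real_derivative z) (at y) \<and> 0 \<le> z"
      by (metis mult_nonneg_nonneg zero_le_numeral)
  qed
  moreover have "\<bar>1 - x\<bar> / max 1 x = 1 - 1 / x" using True by (simp add: field_simps max_def)
  ultimately show ?thesis by (simp add: h_def)
next
  case False
  define h where "h y = 2 * (y - 1 - ln y) - (1 - y)\<^sup>2" for y :: real
  have "h 1 \<le> h x"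
  proof (rule DERIV_nonpos_imp_nonincreasing[where f = h])
    show "x \<le> 1" using False by simp
    fix y :: real assume y: "x \<le> y" "y \<le> 1"
    have "(h has_real_derivative 2 * (1 - 1 / y) + 2 * (1 - y)) (at y)"
      unfolding h_def using y assms by (auto intro!: derivative_eq_intros simp: power2_eq_square)
    moreover have "2 * (1 - 1 / y) + 2 * (1 - y) = - (2 * (1 - y)\<^sup>2 / y)"
      using y assms by (simp add: field_simps power2_eq_square)
    moreover have "0 \<le> 2 * (1 - y)\<^sup>2 / y" using y assms by simp
    ultimately show "\<exists>z. (h has_real_derivative z) (at y) \<and> z \<le> 0" by fastforce
  qed
  then show ?thesis using False by (simp add: h_def max_def)
qed

text \<open>
  Jensen's inequality for the square, followed by \<open>sq_le_log_gap\<close> at \<open>x = T'\<close>.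
\<close>

lemma dist1_sq_le:
  assumes u: "u \<in> class_B" and v: "v \<in> class_B"
  defines "T' \<equiv> \<lambda>x. u x / v (transport u v x)"
  shows "0 \<le> dist1 u v"
    "ennreal ((dist1 u v)\<^sup>2) \<le> 2 * (\<integral>\<^sup>+x. ennreal (u x * (T' x - 1 - ln (T' x))) \<partial>lborel)"
proof -
  interpret real_distribution "density lborel u" by (rule real_distribution_density[OF u])
  note [measurable] = class_B_D(5)[OF u]
  note [measurable] = borel_measurable_transport[OF u v] class_B_D(5)[OF v]
  have T'[measurable]: "T' \<in> borel_measurable borel" unfolding T'_def by measurable
  have T'pos: "T' x > 0" for x using class_B_D(2)[OF u] class_B_D(2)[OF v] by (simp add: T'_def)
  define h where "h x = \<bar>1 - T' x\<bar> / max 1 (T' x)" for x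
  have h[measurable]: "h \<in> borel_measurable borel" unfolding h_def by measurable
  have h01: "0 \<le> h x" "h x \<le> 1" for x using T'pos[of x] by (auto simp: h_def max_def)
  have d: "dist1 u v = expectation h" unfolding dist1_def h_def T'_def deriv_transport[OF u v] ..
  have int: "integrable (density lborel u) h" "integrable (density lborel u) (\<lambda>x. (h x)\<^sup>2)"
    using h01 by (auto intro!: integrable_const_bound[where B = 1] simp: abs_square_le_1)
  show "0 \<le> dist1 u v" unfolding d using h01 by (intro integral_nonneg_AE) auto
  have "(expectation h)\<^sup>2 \<le> expectation (\<lambda>x. (h x)\<^sup>2)"
    using variance_positive[of h] variance_eq[OF int] by simp
  then have "ennreal ((dist1 u v)\<^sup>2) \<le> ennreal (expectation (\<lambda>x. (h x)\<^sup>2))" unfolding d by (rule ennreal_leI)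
  also have "\<dots> = (\<integral>\<^sup>+x. ennreal ((h x)\<^sup>2) \<partial>density lborel u)"
    using int by (intro nn_integral_eq_integral[symmetric]) auto
  also have "\<dots> = (\<integral>\<^sup>+x. ennreal (u x) * ennreal ((h x)\<^sup>2) \<partial>lborel)"
    by (subst nn_integral_density) auto
  also have "\<dots> \<le> (\<integral>\<^sup>+x. 2 * ennreal (u x * (T' x - 1 - ln (T' x))) \<partial>lborel)"
  proof (rule nn_integral_mono)
    fix x
    have "(h x)\<^sup>2 \<le> 2 * (T' x - 1 - ln (T' x))"
      unfolding h_def by (rule sq_le_log_gap[OF T'pos])
    then have "u x * (h x)\<^sup>2 \<le> u x * (2 * (T' x - 1 - ln (T' x)))"
      using class_B_D(2)[OF u, of x] by (intro mult_left_mono) auto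
    then have "ennreal (u x * (h x)\<^sup>2) \<le> ennreal (2 * (u x * (T' x - 1 - ln (T' x))))"
      by (intro ennreal_leI) (simp only: mult.left_commute)
    also have "\<dots> = 2 * ennreal (u x * (T' x - 1 - ln (T' x)))"
      by (subst ennreal_mult') simp_all
    finally show "ennreal (u x) * ennreal ((h x)\<^sup>2) \<le> 2 * ennreal (u x * (T' x - 1 - ln (T' x)))"
      by (subst ennreal_mult''[symmetric]) simp_all
  qed
  also have "\<dots> = 2 * (\<integral>\<^sup>+x. ennreal (u x * (T' x - 1 - ln (T' x))) \<partial>lborel)"
    by (rule nn_integral_cmult) measurable
  finally show "ennreal ((dist1 u v)\<^sup>2) \<le> 2 * (\<integral>\<^sup>+x. ennreal (u x * (T' x - 1 - ln (T' x))) \<partial>lborel)" .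
qed

section \<open>Functions fibred over the Gaussian line\<close>

text \<open>
  The Bregman divergence of \<open>x ln x\<close>. Being nonnegative, it can be integrated without any
  integrability assumption; if \<open>f\<close> has mean \<open>m\<close>, the integral of \<open>rel_ent f m\<close> is the entropy of \<open>f\<close>.
\<close>

definition rel_ent :: "real \<Rightarrow> real \<Rightarrow> real" where
  "rel_ent x y = x * ln (x / y) - x + y"

lemma rel_ent_nonneg:
  assumes "0 < x" "0 < y"
  shows "0 \<le> rel_ent x y"
proof -
  have "ln (y / x) \<le> y / x - 1" using assms by (intro ln_le_minus_one) simp
  then have "x * ln (y / x) \<le> y - x" using assms by (simp add: field_simps)
  then show ?thesis using assms by (simp add: rel_ent_def ln_div algebra_simps)
qed

lemma rel_ent_measurable[measurable]:
  assumes [measurable]: "f \<in> borel_measurable M" "g \<in> borel_measurable M"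
  shows "(\<lambda>x. rel_ent (f x) (g x)) \<in> borel_measurable M"
  unfolding rel_ent_def by measurable

abbreviation gauss1 :: "real measure" where
  "gauss1 \<equiv> density lborel std_normal_density"

lemma std_normal_density_class_B: "std_normal_density \<in> class_B"
proof -
  have "continuous_on UNIV std_normal_density"
    unfolding normal_density_def by (intro continuous_intros) auto
  then show ?thesis unfolding class_B_def
    using integral_normal_density[of 1 0] integrable_normal_density[of 1 0]
    by (auto simp: has_bochner_integral_iff normal_density_pos)
qed

lemma std_normal_density_has_derivative:
  "(std_normal_density has_real_derivative - x * std_normal_density x) (at x)"
proof -
  have "((\<lambda>x. 1 / sqrt (2 * pi) * exp (- x\<^sup>2 / 2)) has_real_derivative
      1 / sqrt (2 * pi) * (exp (- x\<^sup>2 / 2) * - x)) (at x)"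
    by (intro DERIV_cmult) (auto intro!: derivative_eq_intros)
  then show ?thesis by (simp add: std_normal_density_def[abs_def] mult.commute)
qed

lemma std_normal_density_ge:
  assumes "\<bar>x\<bar> \<le> M" shows "std_normal_density M \<le> std_normal_density x"
proof -
  have "x\<^sup>2 \<le> M\<^sup>2" using assms by (simp add: power2_le_iff_abs_le)
  then show ?thesis by (simp add: std_normal_density_def divide_right_mono)
qed

lemma C1_increment_le:
  fixes f f' :: "real \<Rightarrow> real"
  assumes der: "\<And>t. (f has_real_derivative f' t) (at t)" and cont: "continuous_on UNIV f'"
    and st: "\<bar>s\<bar> \<le> M" "\<bar>t\<bar> \<le> M"
  shows "ennreal (f t) \<le> ennreal (f s) + (\<integral>\<^sup>+r. ennreal \<bar>f' r\<bar> * indicator {-M..M} r \<partial>lborel)"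
proof -
  define a b where "a = min s t" and "b = max s t"
  have ab: "a \<le> b" "-M \<le> a" "b \<le> M" using st by (auto simp: a_def b_def)
  have [measurable]: "f' \<in> borel_measurable borel" using cont by (rule borel_measurable_continuous_onI)
  have i: "has_bochner_integral lborel (\<lambda>x. f' x * indicator {a..b} x) (f b - f a)"
    by (rule has_bochner_integral_FTC_Icc_real[OF ab(1)])
       (use der cont in \<open>auto simp: continuous_on_eq_continuous_at\<close>)
  have "f t - f s \<le> \<bar>f b - f a\<bar>" by (auto simp: a_def b_def min_def max_def)
  also have "\<dots> = \<bar>LINT x|lborel. f' x * indicator {a..b} x\<bar>"
    using i by (simp add: has_bochner_integral_integral_eq)
  finally have "ennreal (f t) \<le> ennreal (f s + \<bar>LINT x|lborel. f' x * indicator {a..b} x\<bar>)"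
    by (intro ennreal_leI) simp
  also have "\<dots> \<le> ennreal (f s) + ennreal \<bar>LINT x|lborel. f' x * indicator {a..b} x\<bar>"
  proof (cases "0 \<le> f s")
    case False
    then show ?thesis by (simp add: ennreal_neg ennreal_leI)
  qed simp
  also have "ennreal \<bar>LINT x|lborel. f' x * indicator {a..b} x\<bar> \<le> (\<integral>\<^sup>+x. ennreal (norm (f' x * indicator {a..b} x)) \<partial>lborel)"
    using integral_norm_bound_ennreal[OF integrable.intros[OF i]] by simp
  also have "\<dots> \<le> (\<integral>\<^sup>+r. ennreal \<bar>f' r\<bar> * indicator {-M..M} r \<partial>lborel)"
    using ab by (intro nn_integral_mono) (auto simp: indicator_def)
  finally show ?thesis by (simp add: add_left_mono)
qed

text \<open>
  One variable \<open>t\<close> on the Gaussian line is singled out, and the others are collected in a probability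
  space \<open>P\<close>. Smoothness is required in \<open>t\<close> only, for each point of the fibre separately. The function
  \<open>G\<close> is the derivative of \<open>F\<close> in \<open>t\<close>.
\<close>

locale gaussian_fibration = prob_space P for P :: "'b measure" +
  fixes F G :: "real \<Rightarrow> 'b \<Rightarrow> real"
  assumes F_measurable: "(\<lambda>(t, w). F t w) \<in> borel_measurable (borel \<Otimes>\<^sub>M P)"
    and G_measurable: "(\<lambda>(t, w). G t w) \<in> borel_measurable (borel \<Otimes>\<^sub>M P)"
    and F_pos: "\<And>t w. w \<in> space P \<Longrightarrow> 0 < F t w"
    and F_der: "\<And>t w. w \<in> space P \<Longrightarrow> ((\<lambda>t. F t w) has_real_derivative G t w) (at t)"
    and G_cont: "\<And>w. w \<in> space P \<Longrightarrow> continuous_on UNIV (\<lambda>t. G t w)"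
    and mass: "(\<integral>\<^sup>+t. \<integral>\<^sup>+w. ennreal (F t w) \<partial>P \<partial>gauss1) = 1"
    and fisher: "(\<integral>\<^sup>+t. \<integral>\<^sup>+w. ennreal ((G t w)\<^sup>2 / F t w) \<partial>P \<partial>gauss1) < \<infinity>"
begin

abbreviation (input) "\<phi> \<equiv> std_normal_density"

sublocale LP: pair_sigma_finite "lborel :: real measure" P by standard

lemma F_comp_measurable[measurable (raw)]:
  "f \<in> M \<rightarrow>\<^sub>M borel \<Longrightarrow> g \<in> M \<rightarrow>\<^sub>M P \<Longrightarrow> (\<lambda>x. F (f x) (g x)) \<in> borel_measurable M"
  using measurable_compose[OF measurable_Pair F_measurable] by simp

lemma G_comp_measurable[measurable (raw)]:
  "f \<in> M \<rightarrow>\<^sub>M borel \<Longrightarrow> g \<in> M \<rightarrow>\<^sub>M P \<Longrightarrow> (\<lambda>x. G (f x) (g x)) \<in> borel_measurable M"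
  using measurable_compose[OF measurable_Pair G_measurable] by simp

lemma nn_gauss1:
  assumes [measurable]: "f \<in> borel_measurable borel"
  shows "(\<integral>\<^sup>+t. f t \<partial>gauss1) = (\<integral>\<^sup>+t. ennreal (\<phi> t) * f t \<partial>lborel)"
  by (subst nn_integral_density) auto

text \<open>
  On a bounded interval the Gaussian density is bounded below, so Gaussian integrability gives local
  integrability with respect to Lebesgue measure.
\<close>

lemma local_abs_bound:
  assumes h[measurable]: "(\<lambda>(t, w). h t w) \<in> borel_measurable (borel \<Otimes>\<^sub>M P)"
    and fin: "(\<integral>\<^sup>+t. \<integral>\<^sup>+w. ennreal \<bar>h t w\<bar> \<partial>P \<partial>gauss1) < \<infinity>"
  shows "(\<integral>\<^sup>+t. \<integral>\<^sup>+w. ennreal \<bar>h t w\<bar> * indicator {-M..M} t \<partial>P \<partial>lborel) < \<infinity>"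
proof -
  have pos: "0 < \<phi> M" by (simp add: normal_density_pos)
  have "(\<integral>\<^sup>+t. \<integral>\<^sup>+w. ennreal \<bar>h t w\<bar> * indicator {-M..M} t \<partial>P \<partial>lborel)
     \<le> (\<integral>\<^sup>+t. ennreal (1 / \<phi> M) * (ennreal (\<phi> t) * (\<integral>\<^sup>+w. ennreal \<bar>h t w\<bar> \<partial>P)) \<partial>lborel)"
  proof (rule nn_integral_mono)
    fix t :: real
    have "(\<integral>\<^sup>+w. ennreal \<bar>h t w\<bar> * indicator {-M..M} t \<partial>P) = (\<integral>\<^sup>+w. ennreal \<bar>h t w\<bar> \<partial>P) * indicator {-M..M} t"
      by (rule nn_integral_multc) measurable
    also have "\<dots> \<le> (\<integral>\<^sup>+w. ennreal \<bar>h t w\<bar> \<partial>P) * (ennreal (1 / \<phi> M) * ennreal (\<phi> t))"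
    proof (rule mult_left_mono)
      show "indicator {-M..M} t \<le> ennreal (1 / \<phi> M) * ennreal (\<phi> t)"
        using std_normal_density_ge[of t M] pos
        by (auto simp: indicator_def ennreal_mult'[symmetric] abs_le_iff)
    qed simp
    finally show "(\<integral>\<^sup>+w. ennreal \<bar>h t w\<bar> * indicator {-M..M} t \<partial>P) \<le> ennreal (1 / \<phi> M) * (ennreal (\<phi> t) * (\<integral>\<^sup>+w. ennreal \<bar>h t w\<bar> \<partial>P))"
      by (simp add: mult_ac)
  qed
  also have "\<dots> = ennreal (1 / \<phi> M) * (\<integral>\<^sup>+t. \<integral>\<^sup>+w. ennreal \<bar>h t w\<bar> \<partial>P \<partial>gauss1)"
    by (subst nn_integral_cmult) (simp_all add: nn_gauss1)
  also have "\<dots> < \<infinity>" using fin by (simp add: ennreal_mult_less_top)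
  finally show ?thesis .
qed

lemma fin_F: "(\<integral>\<^sup>+t. \<integral>\<^sup>+w. ennreal \<bar>F t w\<bar> \<partial>P \<partial>gauss1) < \<infinity>"
proof -
  have "(\<integral>\<^sup>+t. \<integral>\<^sup>+w. ennreal \<bar>F t w\<bar> \<partial>P \<partial>gauss1) = (\<integral>\<^sup>+t. \<integral>\<^sup>+w. ennreal (F t w) \<partial>P \<partial>gauss1)"
    using F_pos by (intro nn_integral_cong) (simp add: less_imp_le)
  then show ?thesis by (simp add: mass)
qed

lemma fin_G: "(\<integral>\<^sup>+t. \<integral>\<^sup>+w. ennreal \<bar>G t w\<bar> \<partial>P \<partial>gauss1) < \<infinity>"
proof -
  have "(\<integral>\<^sup>+t. \<integral>\<^sup>+w. ennreal \<bar>G t w\<bar> \<partial>P \<partial>gauss1)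
     \<le> (\<integral>\<^sup>+t. \<integral>\<^sup>+w. ennreal ((G t w)\<^sup>2 / F t w) + ennreal \<bar>F t w\<bar> \<partial>P \<partial>gauss1)"
  proof (intro nn_integral_mono)
    fix t w assume w: "w \<in> space P"
    have F: "F t w > 0" by (rule F_pos[OF w])
    have "0 \<le> (\<bar>G t w\<bar> - F t w)\<^sup>2" by simp
    then have "2 * (\<bar>G t w\<bar> * F t w) \<le> (G t w)\<^sup>2 + (F t w)\<^sup>2"
      by (simp add: power2_eq_square algebra_simps)
    moreover have "0 \<le> \<bar>G t w\<bar> * F t w" using F by simp
    ultimately have "\<bar>G t w\<bar> * F t w \<le> (G t w)\<^sup>2 + (F t w)\<^sup>2" by linarith
    then have "\<bar>G t w\<bar> \<le> (G t w)\<^sup>2 / F t w + F t w"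
      using F by (simp add: field_simps power2_eq_square)
    then show "ennreal \<bar>G t w\<bar> \<le> ennreal ((G t w)\<^sup>2 / F t w) + ennreal \<bar>F t w\<bar>"
      using F by (simp add: ennreal_plus[symmetric] ennreal_leI del: ennreal_plus)
  qed
  also have "\<dots> = (\<integral>\<^sup>+t. (\<integral>\<^sup>+w. ennreal ((G t w)\<^sup>2 / F t w) \<partial>P) + (\<integral>\<^sup>+w. ennreal \<bar>F t w\<bar> \<partial>P) \<partial>gauss1)"
    by (intro nn_integral_cong nn_integral_add) measurable
  also have "\<dots> = (\<integral>\<^sup>+t. \<integral>\<^sup>+w. ennreal ((G t w)\<^sup>2 / F t w) \<partial>P \<partial>gauss1) + (\<integral>\<^sup>+t. \<integral>\<^sup>+w. ennreal \<bar>F t w\<bar> \<partial>P \<partial>gauss1)"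
    by (intro nn_integral_add) measurable
  also have "\<dots> < \<infinity>" using fisher fin_F by simp
  finally show ?thesis .
qed

definition marg :: "real \<Rightarrow> real" where "marg t = (\<integral>w. F t w \<partial>P)"

text \<open>
  By the fundamental theorem of calculus this dominates \<open>F t w\<close> for all \<open>\<bar>t\<bar> \<le> M\<close> at once. Being
  integrable in \<open>w\<close> for a suitable \<open>s\<close>, it shows that the average over the fibre is finite at every \<open>t\<close> and
  continuous.
\<close>

definition env :: "real \<Rightarrow> real \<Rightarrow> 'b \<Rightarrow> ennreal" where
  "env s M w = ennreal (F s w) + (\<integral>\<^sup>+r. ennreal \<bar>G r w\<bar> * indicator {-M..M} r \<partial>lborel)"

lemma env_measurable[measurable]: "env s M \<in> borel_measurable P"
  unfolding env_def[abs_def] by measurable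

lemma F_le_env:
  assumes "w \<in> space P" "\<bar>s\<bar> \<le> M" "\<bar>t\<bar> \<le> M"
  shows "ennreal (F t w) \<le> env s M w"
  unfolding env_def
  by (rule C1_increment_le[where f = "\<lambda>t. F t w" and f' = "\<lambda>t. G t w"])
     (use assms in \<open>simp_all add: F_der G_cont\<close>)

text \<open>
  Some \<open>s\<close> has a finite fibre average because the total mass is finite; the other term of the envelope
  is controlled by the Fisher information through \<open>fin_G\<close>.
\<close>

lemma ex_env_finite: "\<exists>s. \<forall>M. (\<integral>\<^sup>+w. env s M w \<partial>P) < \<infinity>"
proof -
  have "\<exists>s. (\<integral>\<^sup>+w. ennreal (F s w) \<partial>P) < \<infinity>"
  proof (rule ccontr)
    assume "\<not> ?thesis"
    then have "(\<integral>\<^sup>+w. ennreal (F s w) \<partial>P) = \<infinity>" for s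
      using less_top infinity_ennreal_def by metis
    then have "(\<integral>\<^sup>+t. (\<infinity>::ennreal) \<partial>gauss1) = 1" using mass by simp
    moreover have "emeasure gauss1 (space gauss1) = 1"
      by (rule prob_space.emeasure_space_1[OF prob_space_normal_density]) simp
    ultimately show False by (simp add: nn_integral_const del: space_density)
  qed
  then obtain s where s: "(\<integral>\<^sup>+w. ennreal (F s w) \<partial>P) < \<infinity>" ..
  have "(\<integral>\<^sup>+w. env s M w \<partial>P) < \<infinity>" for M
  proof -
    have "(\<integral>\<^sup>+w. env s M w \<partial>P) = (\<integral>\<^sup>+w. ennreal (F s w) \<partial>P) + (\<integral>\<^sup>+w. \<integral>\<^sup>+r. ennreal \<bar>G r w\<bar> * indicator {-M..M} r \<partial>lborel \<partial>P)"
      unfolding env_def by (intro nn_integral_add) measurable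
    also have "(\<integral>\<^sup>+w. \<integral>\<^sup>+r. ennreal \<bar>G r w\<bar> * indicator {-M..M} r \<partial>lborel \<partial>P) = (\<integral>\<^sup>+r. \<integral>\<^sup>+w. ennreal \<bar>G r w\<bar> * indicator {-M..M} r \<partial>P \<partial>lborel)"
      by (rule LP.Fubini') measurable
    finally show ?thesis using s local_abs_bound[OF G_measurable fin_G, of M] by simp
  qed
  then show ?thesis by blast
qed

lemma env_integrable:
  assumes "(\<integral>\<^sup>+w. env s M w \<partial>P) < \<infinity>"
  shows "integrable P (\<lambda>w. enn2real (env s M w))" "AE w in P. env s M w < \<infinity>"
proof -
  show ae: "AE w in P. env s M w < \<infinity>"
    using nn_integral_PInf_AE[of "env s M" P] assms by (auto simp: less_top)
  show "integrable P (\<lambda>w. enn2real (env s M w))"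
  proof (rule integrableI_bounded)
    have "(\<integral>\<^sup>+w. ennreal (norm (enn2real (env s M w))) \<partial>P) = (\<integral>\<^sup>+w. env s M w \<partial>P)"
      using ae by (intro nn_integral_cong_AE) (auto elim!: eventually_mono simp: less_top)
    then show "(\<integral>\<^sup>+w. ennreal (norm (enn2real (env s M w))) \<partial>P) < \<infinity>" using assms by simp
  qed measurable
qed

lemma F_bound:
  assumes "(\<integral>\<^sup>+w. env s M w \<partial>P) < \<infinity>" "\<bar>s\<bar> \<le> M"
  shows "AE w in P. \<forall>t. \<bar>t\<bar> \<le> M \<longrightarrow> norm (F t w) \<le> enn2real (env s M w)"
  using env_integrable(2)[OF assms(1)] AE_space
proof eventually_elim
  case (elim w)
  show ?case
  proof (intro allI impI)
    fix t assume "\<bar>t\<bar> \<le> M"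
    then have "ennreal (F t w) \<le> env s M w" using elim assms(2) by (intro F_le_env) auto
    then have "enn2real (ennreal (F t w)) \<le> enn2real (env s M w)" using elim by (intro enn2real_mono) auto
    then show "norm (F t w) \<le> enn2real (env s M w)" using F_pos[of w t] elim by simp
  qed
qed

lemma F_integrable: "integrable P (F t)"
proof -
  obtain s where s: "\<And>M. (\<integral>\<^sup>+w. env s M w \<partial>P) < \<infinity>" using ex_env_finite by blast
  define M where "M = max \<bar>s\<bar> \<bar>t\<bar>"
  show ?thesis
  proof (rule Bochner_Integration.integrable_bound[OF env_integrable(1)[OF s[of M]]])
    show "AE w in P. norm (F t w) \<le> norm (enn2real (env s M w))"
      using F_bound[OF s[of M]] by (auto simp: M_def elim!: eventually_mono)
  qed measurable
qed

lemma marg_pos: "0 < marg t"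
proof -
  have "(\<integral>w. 0 \<partial>P) < (\<integral>w. F t w \<partial>P)"
    by (rule integral_less_AE_space) (auto simp: F_integrable F_pos emeasure_space_1)
  then show ?thesis by (simp add: marg_def)
qed

lemma nn_integral_F: "(\<integral>\<^sup>+w. ennreal (F t w) \<partial>P) = ennreal (marg t)"
  unfolding marg_def by (rule nn_integral_eq_integral[OF F_integrable]) (use F_pos in \<open>auto simp: less_imp_le\<close>)

text \<open>
  Dominated convergence with the envelope \<open>env\<close>.
\<close>

lemma marg_continuous: "continuous_on UNIV marg"
proof (rule continuous_at_imp_continuous_on, rule ballI)
  fix t0 :: real
  obtain s where s: "\<And>M. (\<integral>\<^sup>+w. env s M w \<partial>P) < \<infinity>" using ex_env_finite by blast
  define M where "M = max \<bar>s\<bar> (\<bar>t0\<bar> + 1)"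
  have "continuous_on {-M..M} marg"
  proof (rule continuous_on_sequentiallyI)
    fix x t assume x: "\<forall>n. x n \<in> {-M..M}" and t: "t \<in> {-M..M}" and lim: "x \<longlonglongrightarrow> t"
    show "(\<lambda>n. marg (x n)) \<longlonglongrightarrow> marg t" unfolding marg_def
    proof (rule integral_dominated_convergence[where w = "\<lambda>w. enn2real (env s M w)"])
      show "integrable P (\<lambda>w. enn2real (env s M w))" by (rule env_integrable(1)[OF s])
      show "AE w in P. (\<lambda>n. F (x n) w) \<longlonglongrightarrow> F t w"
      proof (rule AE_I2)
        fix w assume "w \<in> space P"
        then have "isCont (\<lambda>t. F t w) t" by (rule DERIV_isCont[OF F_der])
        then show "(\<lambda>n. F (x n) w) \<longlonglongrightarrow> F t w" using lim by (rule isCont_tendsto_compose)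
      qed
      show "AE w in P. norm (F (x n) w) \<le> enn2real (env s M w)" for n
      proof -
        have "\<bar>x n\<bar> \<le> M" "\<bar>s\<bar> \<le> M" using x[rule_format, of n] by (auto simp: abs_le_iff M_def)
        then show ?thesis using F_bound[OF s[of M]] by (auto elim!: eventually_mono)
      qed
    qed measurable
  qed
  moreover have "t0 \<in> interior {-M..M}" by (auto simp: M_def)
  ultimately show "isCont marg t0" by (rule continuous_on_interior)
qed

definition u :: "real \<Rightarrow> real" where "u t = marg t * \<phi> t"

lemma marg_measurable[measurable]: "marg \<in> borel_measurable borel"
  by (rule borel_measurable_continuous_onI[OF marg_continuous])

lemma u_class_B: "u \<in> class_B"
proof -
  have "continuous_on UNIV u" unfolding u_def[abs_def]
    using marg_continuous class_B_D(1)[OF std_normal_density_class_B] by (intro continuous_intros)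
  moreover have u0: "0 < u t" for t by (simp add: u_def marg_pos normal_density_pos)
  moreover have "has_bochner_integral lborel u 1"
  proof (rule has_bochner_integral_nn_integral)
    have "(\<integral>\<^sup>+t. ennreal (u t) \<partial>lborel) = (\<integral>\<^sup>+t. ennreal (\<phi> t) * (\<integral>\<^sup>+w. ennreal (F t w) \<partial>P) \<partial>lborel)"
      by (intro nn_integral_cong) (simp add: nn_integral_F u_def ennreal_mult'[symmetric] mult.commute)
    also have "\<dots> = 1" using mass by (simp add: nn_gauss1)
    finally show "(\<integral>\<^sup>+t. ennreal (u t) \<partial>lborel) = ennreal 1" by simp
    show "u \<in> borel_measurable lborel" unfolding u_def[abs_def] by measurable
    show "AE t in lborel. 0 \<le> u t" using u0 by (simp add: less_imp_le)
  qed simp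
  ultimately show ?thesis by (simp add: class_B_def)
qed

abbreviation (input) "T \<equiv> transport u \<phi>"

definition T' :: "real \<Rightarrow> real" where "T' t = u t / \<phi> (T t)"

lemma T_der: "(T has_real_derivative T' t) (at t)"
  unfolding T'_def by (rule transport_has_derivative[OF u_class_B std_normal_density_class_B])

lemma u_pos: "0 < u t" by (rule class_B_D(2)[OF u_class_B])

lemma T'_pos: "0 < T' t" by (simp add: T'_def u_pos normal_density_pos)

lemma T_continuous: "continuous_on A T"
  by (rule continuous_at_imp_continuous_on, rule ballI, rule DERIV_isCont[OF T_der])

lemma phi_continuous: "continuous_on A f \<Longrightarrow> continuous_on A (\<lambda>x. \<phi> (f x))"
  by (rule continuous_on_compose2[OF class_B_D(1)[OF std_normal_density_class_B]]) auto

lemma T'_continuous: "continuous_on A T'"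
  unfolding T'_def[abs_def]
  by (intro continuous_on_divide phi_continuous T_continuous continuous_on_subset[OF class_B_D(1)[OF u_class_B]])
     (auto simp: normal_density_pos less_imp_neq[symmetric])

lemma ln_std_normal_density: "ln (\<phi> x) = - ln (sqrt (2 * pi)) - x\<^sup>2 / 2"
  by (simp add: std_normal_density_def ln_div)

lemma ln_marg: "ln (marg t) = t\<^sup>2 / 2 - (T t)\<^sup>2 / 2 + ln (T' t)"
proof -
  have "marg t * \<phi> t = \<phi> (T t) * T' t"
    using normal_density_pos[of 1 0 "T t"] by (simp add: T'_def u_def)
  then have "ln (marg t) + ln (\<phi> t) = ln (\<phi> (T t)) + ln (T' t)"
    using marg_pos[of t] T'_pos[of t] normal_density_pos[of 1 0] by (simp add: ln_mult_pos[symmetric])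
  then show ?thesis by (simp add: ln_std_normal_density)
qed

text \<open>
  The identity \<open>u = \<phi>(T) T'\<close> makes \<open>- u T\<close> the derivative of a bounded function; this is the only
  information about the tails of \<open>u\<close> that the boundary terms require.
\<close>

lemma phi_T_der: "((\<lambda>t. \<phi> (T t)) has_real_derivative - (u t * T t)) (at t)"
  using DERIV_chain2[OF std_normal_density_has_derivative T_der, of t] normal_density_pos[of 1 0 "T t"]
  by (simp add: T'_def mult.commute)

lemma phi_le_1: "\<phi> x \<le> 1"
proof -
  have "1 \<le> sqrt (2 * pi)" using pi_ge_two by simp
  moreover have "exp (- x\<^sup>2 / 2) \<le> exp 0" by (subst exp_le_cancel_iff) simp
  ultimately have "exp (- x\<^sup>2 / 2) \<le> sqrt (2 * pi)" unfolding exp_zero by (rule order_trans[rotated])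
  then show ?thesis unfolding std_normal_density_def by (simp add: divide_le_eq)
qed

text \<open>
  If \<open>u T\<close> stayed above \<open>e\<close> on a half-line, then \<open>\<phi> \<circ> T\<close> would decrease there with slope at least \<open>e\<close>
  and leave the interval from 0 to 1.
\<close>

lemma boundary_right:
  assumes e: "0 < e" shows "\<exists>b\<ge>N. u b * T b \<le> e"
proof (rule ccontr)
  assume "\<not> ?thesis"
  then have *: "e < u b * T b" if "N \<le> b" for b using that by (meson not_le)
  \<comment> \<open>The drop over an interval of length \<open>2 / e\<close> would be at least 2, more than \<open>\<phi>\<close> can lose.\<close>
  define b where "b = N + 2 / e"
  have "\<phi> (T b) + e * b \<le> \<phi> (T N) + e * N"
  proof (rule DERIV_nonpos_imp_nonincreasing[where f = "\<lambda>t. \<phi> (T t) + e * t"])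
    show "N \<le> b" using e by (simp add: b_def)
    fix t assume "N \<le> t"
    then show "\<exists>y. ((\<lambda>t. \<phi> (T t) + e * t) has_real_derivative y) (at t) \<and> y \<le> 0"
      using * by (intro exI[of _ "- (u t * T t) + e * 1"] conjI DERIV_add phi_T_der DERIV_cmult DERIV_ident) (simp add: less_imp_le)
  qed
  moreover have "e * b = e * N + 2" using e by (simp add: b_def field_simps)
  ultimately show False using phi_le_1[of "T N"] normal_density_pos[of 1 0 "T b"] by simp
qed

lemma boundary_left:
  assumes e: "0 < e" shows "\<exists>a\<le>N. - (u a * T a) \<le> e"
proof (rule ccontr)
  assume "\<not> ?thesis"
  then have *: "e < - (u a * T a)" if "a \<le> N" for a using that by (meson not_le)
  define a where "a = N - 2 / e"
  have "\<phi> (T a) - e * a \<le> \<phi> (T N) - e * N"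
  proof (rule DERIV_nonneg_imp_nondecreasing[where f = "\<lambda>t. \<phi> (T t) - e * t"])
    show "a \<le> N" using e by (simp add: a_def)
    fix t assume "t \<le> N"
    then show "\<exists>y. ((\<lambda>t. \<phi> (T t) - e * t) has_real_derivative y) (at t) \<and> 0 \<le> y"
      using * by (intro exI[of _ "- (u t * T t) - e * 1"] conjI DERIV_diff phi_T_der DERIV_cmult DERIV_ident) (simp add: less_imp_le)
  qed
  moreover have "e * a = e * N - 2" using e by (simp add: a_def field_simps)
  ultimately show False using phi_le_1[of "T N"] normal_density_pos[of 1 0 "T a"] by simp
qed

text \<open>
  The test function of the integration by parts: the displacement of the transport map, weighted by
  the Gaussian density.
\<close>

definition W :: "real \<Rightarrow> real" where "W t = \<phi> t * (T t - t)"
definition W' :: "real \<Rightarrow> real" where "W' t = \<phi> t * (T' t - 1 - t * (T t - t))"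

lemma W_der: "(W has_real_derivative W' t) (at t)"
  unfolding W_def[abs_def] W'_def
  by (rule DERIV_cong[OF DERIV_mult[OF std_normal_density_has_derivative DERIV_diff[OF T_der DERIV_ident]]])
     (simp add: algebra_simps)

lemma W_continuous: "continuous_on A W" "continuous_on A W'"
  unfolding W_def[abs_def] W'_def[abs_def]
  by (intro continuous_intros phi_continuous T_continuous T'_continuous)+

definition gap :: "real \<Rightarrow> real" where "gap t = T' t - 1 - ln (T' t)"

lemma gap_nonneg: "0 \<le> gap t"
  using ln_le_minus_one[OF T'_pos[of t]] by (simp add: gap_def)

text \<open>
  This contains the whole transport argument. By \<open>ln_marg\<close> the left side equals
  \<open>F W' - \<phi> F (T - t)\<^sup>2 / 2\<close>, and the difference of the two sides is
  \<open>\<phi> (G + F (T - t))\<^sup>2 / (2 F) \<ge> 0\<close>. The first two terms on the right are the derivative of \<open>F W\<close> along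
  the line, so that integration by parts becomes the fundamental theorem of calculus.
\<close>

lemma pointwise_bound:
  assumes w: "w \<in> space P"
  shows "\<phi> t * (ln (marg t) + gap t) * F t w
    \<le> W' t * F t w + W t * G t w + \<phi> t * ((G t w)\<^sup>2 / (2 * F t w))"
proof -
  let ?F = "F t w" and ?G = "G t w" and ?d = "T t - t"
  have F: "0 < ?F" by (rule F_pos[OF w])
  have "0 \<le> (?G + ?F * ?d)\<^sup>2 / (2 * ?F)" using F by simp
  also have "\<dots> = ?G\<^sup>2 / (2 * ?F) + ?G * ?d + ?F * ?d\<^sup>2 / 2"
    using F by (simp add: field_simps power2_eq_square)
  finally have "\<phi> t * 0 \<le> \<phi> t * (?G\<^sup>2 / (2 * ?F) + ?G * ?d + ?F * ?d\<^sup>2 / 2)"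
    by (intro mult_left_mono) auto
  moreover have "\<phi> t * (ln (marg t) + gap t) * ?F = W' t * ?F - \<phi> t * (?F * ?d\<^sup>2 / 2)"
    unfolding ln_marg gap_def W'_def by (simp add: field_simps power2_eq_square)
  ultimately show ?thesis by (simp add: W_def algebra_simps)
qed

lemma local_integrable:
  assumes h[measurable]: "(\<lambda>(t, w). h t w) \<in> borel_measurable (borel \<Otimes>\<^sub>M P)"
    and fin: "(\<integral>\<^sup>+t. \<integral>\<^sup>+w. ennreal \<bar>h t w\<bar> \<partial>P \<partial>gauss1) < \<infinity>"
    and c: "continuous_on UNIV c"
  shows "integrable (lborel \<Otimes>\<^sub>M P) (\<lambda>(t, w). indicator {a..b} t * (c t * h t w))"
proof -
  have [measurable]: "c \<in> borel_measurable borel" using c by (rule borel_measurable_continuous_onI)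
  define M where "M = max \<bar>a\<bar> \<bar>b\<bar>"
  have "integrable (lborel \<Otimes>\<^sub>M P) (\<lambda>(t, w). indicator {-M..M} t * h t w)"
  proof (rule integrableI_bounded)
    have "(\<integral>\<^sup>+x. ennreal (norm (case x of (t, w) \<Rightarrow> indicator {-M..M} t * h t w)) \<partial>(lborel \<Otimes>\<^sub>M P))
       = (\<integral>\<^sup>+t. \<integral>\<^sup>+w. ennreal \<bar>h t w\<bar> * indicator {-M..M} t \<partial>P \<partial>lborel)"
      by (subst nn_integral_fst[symmetric])
         (auto intro!: nn_integral_cong simp: indicator_def)
    then show "(\<integral>\<^sup>+x. ennreal (norm (case x of (t, w) \<Rightarrow> indicator {-M..M} t * h t w)) \<partial>(lborel \<Otimes>\<^sub>M P)) < \<infinity>"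
      using local_abs_bound[OF h fin, of M] by simp
  qed measurable
  moreover have "bounded (c ` {a..b})"
    by (intro compact_imp_bounded compact_continuous_image continuous_on_subset[OF c]) auto
  then obtain B where B: "\<And>t. t \<in> {a..b} \<Longrightarrow> norm (c t) \<le> B"
    unfolding bounded_iff by blast
  ultimately have "integrable (lborel \<Otimes>\<^sub>M P) (\<lambda>x. B * (case x of (t, w) \<Rightarrow> indicator {-M..M} t * h t w))"
    by (intro integrable_mult_right)
  then show ?thesis
  proof (rule Bochner_Integration.integrable_bound)
    show "AE x in lborel \<Otimes>\<^sub>M P. norm (case x of (t, w) \<Rightarrow> indicator {a..b} t * (c t * h t w))
       \<le> norm (B * (case x of (t, w) \<Rightarrow> indicator {-M..M} t * h t w))"
    proof (rule AE_I2, clarify)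
      fix t w
      show "norm (indicator {a..b} t * (c t * h t w)) \<le> norm (B * (indicator {-M..M} t * h t w))"
      proof (cases "t \<in> {a..b}")
        case True
        then have "t \<in> {-M..M}" by (auto simp: M_def)
        moreover have "\<bar>c t\<bar> \<le> \<bar>B\<bar>" using B[OF True] by simp
        ultimately show ?thesis using True by (simp add: abs_mult mult_right_mono)
      qed simp
    qed
  qed measurable
qed

text \<open>
  Integrating \<open>pointwise_bound\<close> over \<open>{a..b}\<close> and the fibre. The order of integration on the left is
  fibre first, which produces the marginal; for the total derivative it is line first.
\<close>

lemma interval_bound:
  assumes ab: "a \<le> b"
  defines "I \<equiv> \<integral>\<^sup>+t. \<integral>\<^sup>+w. ennreal ((G t w)\<^sup>2 / F t w) \<partial>P \<partial>gauss1"
  shows "(LINT t|lborel. indicator {a..b} t * (u t * (ln (marg t) + gap t)))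
    \<le> marg b * W b - marg a * W a + enn2real I / 2"
proof -
  define c where "c t = \<phi> t * (ln (marg t) + gap t)" for t
  have c: "continuous_on UNIV c" unfolding c_def[abs_def] gap_def[abs_def]
    using marg_pos T'_pos
    by (intro continuous_intros phi_continuous marg_continuous T'_continuous) (auto simp: less_imp_neq[symmetric])
  define H where "H = (\<lambda>(t, w). indicator {a..b} t * (c t * F t w))"
  define K1 where "K1 = (\<lambda>(t, w). indicator {a..b} t * (W' t * F t w))"
  define K2 where "K2 = (\<lambda>(t, w). indicator {a..b} t * (W t * G t w))"
  define K3 where "K3 = (\<lambda>(t, w). \<phi> t * ((G t w)\<^sup>2 / (2 * F t w)))"
  have H: "integrable (lborel \<Otimes>\<^sub>M P) H" and K1: "integrable (lborel \<Otimes>\<^sub>M P) K1"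
    and K2: "integrable (lborel \<Otimes>\<^sub>M P) K2"
    unfolding H_def K1_def K2_def
    by (intro local_integrable F_measurable G_measurable fin_F fin_G c W_continuous)+
  have K3_nn: "(\<integral>\<^sup>+x. ennreal (K3 x) \<partial>(lborel \<Otimes>\<^sub>M P)) = I / 2"
  proof -
    have "(\<integral>\<^sup>+x. ennreal (K3 x) \<partial>(lborel \<Otimes>\<^sub>M P)) = (\<integral>\<^sup>+t. \<integral>\<^sup>+w. ennreal (\<phi> t) * (ennreal (1 / 2) * ennreal ((G t w)\<^sup>2 / F t w)) \<partial>P \<partial>lborel)"
    proof (subst nn_integral_fst[symmetric])
      have half: "ennreal (\<phi> t * ((G t w)\<^sup>2 / (2 * F t w))) = ennreal (\<phi> t) * (ennreal (1 / 2) * ennreal ((G t w)\<^sup>2 / F t w))"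
        if "w \<in> space P" for t :: real and w
      proof -
        have "\<phi> t * ((G t w)\<^sup>2 / (2 * F t w)) = \<phi> t * (1 / 2 * ((G t w)\<^sup>2 / F t w))" by simp
        also have "ennreal \<dots> = ennreal (\<phi> t) * ennreal (1 / 2 * ((G t w)\<^sup>2 / F t w))" by (rule ennreal_mult') simp
        also have "ennreal (1 / 2 * ((G t w)\<^sup>2 / F t w)) = ennreal (1 / 2) * ennreal ((G t w)\<^sup>2 / F t w)" by (rule ennreal_mult') simp
        finally show ?thesis .
      qed
      show "(\<integral>\<^sup>+t. \<integral>\<^sup>+w. ennreal (K3 (t, w)) \<partial>P \<partial>lborel) = (\<integral>\<^sup>+t. \<integral>\<^sup>+w. ennreal (\<phi> t) * (ennreal (1 / 2) * ennreal ((G t w)\<^sup>2 / F t w)) \<partial>P \<partial>lborel)"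
        unfolding K3_def prod.case by (intro nn_integral_cong half)
    qed (simp add: K3_def)
    also have "\<dots> = (\<integral>\<^sup>+t. ennreal (\<phi> t) * (ennreal (1 / 2) * (\<integral>\<^sup>+w. ennreal ((G t w)\<^sup>2 / F t w) \<partial>P)) \<partial>lborel)"
      by (simp add: nn_integral_cmult)
    also have "\<dots> = ennreal (1 / 2) * I"
      unfolding I_def by (subst nn_gauss1) (simp_all add: nn_integral_cmult[symmetric] mult.left_commute)
    also have "\<dots> = I / 2" by (simp add: divide_ennreal_def mult.commute ennreal_divide_numeral inverse_ennreal[symmetric])
    finally show ?thesis .
  qed
  have I: "I < \<infinity>" unfolding I_def by (rule fisher)
  have K3: "has_bochner_integral (lborel \<Otimes>\<^sub>M P) K3 (enn2real I / 2)"
  proof (rule has_bochner_integral_nn_integral)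
    show "K3 \<in> borel_measurable (lborel \<Otimes>\<^sub>M P)" unfolding K3_def by measurable
    show "AE x in lborel \<Otimes>\<^sub>M P. 0 \<le> K3 x"
      by (rule AE_I2) (auto simp: K3_def space_pair_measure F_pos less_imp_le)
    show "(\<integral>\<^sup>+x. ennreal (K3 x) \<partial>(lborel \<Otimes>\<^sub>M P)) = ennreal (enn2real I / 2)"
      unfolding K3_nn using I by (cases I) (auto simp: divide_ennreal[symmetric])
  qed simp
  have "(LINT x|(lborel \<Otimes>\<^sub>M P). H x) \<le> (LINT x|(lborel \<Otimes>\<^sub>M P). K1 x + K2 x + K3 x)"
  proof (rule integral_mono)
    show "integrable (lborel \<Otimes>\<^sub>M P) (\<lambda>x. K1 x + K2 x + K3 x)"
      using K1 K2 has_bochner_integral_iff[THEN iffD1, OF K3] by auto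
    fix x :: "real \<times> 'b" assume "x \<in> space (lborel \<Otimes>\<^sub>M P)"
    then obtain t w where x: "x = (t, w)" and w: "w \<in> space P" by (auto simp: space_pair_measure)
    have "0 \<le> \<phi> t * ((G t w)\<^sup>2 / (2 * F t w))" using F_pos[OF w, of t] by simp
    then show "H x \<le> K1 x + K2 x + K3 x"
      using pointwise_bound[OF w, of t] by (auto simp: x H_def K1_def K2_def K3_def c_def indicator_def)
  qed (rule H)
  also have "\<dots> = (LINT x|(lborel \<Otimes>\<^sub>M P). K1 x + K2 x) + enn2real I / 2"
    using K1 K2 K3 by (simp add: has_bochner_integral_iff)
  also have "(LINT x|(lborel \<Otimes>\<^sub>M P). K1 x + K2 x) = (LINT w|P. LINT t|lborel. (W' t * F t w + W t * G t w) * indicator {a..b} t)"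
  proof (subst LP.integral_snd)
    have eq: "(\<lambda>(t, w). (W' t * F t w + W t * G t w) * indicator {a..b} t) = (\<lambda>x. K1 x + K2 x)"
      by (auto simp: K1_def K2_def fun_eq_iff algebra_simps)
    show "integrable (lborel \<Otimes>\<^sub>M P) (\<lambda>(t, w). (W' t * F t w + W t * G t w) * indicator {a..b} t)"
      unfolding eq using K1 K2 by auto
    show "(LINT x|(lborel \<Otimes>\<^sub>M P). K1 x + K2 x) = (LINT x|(lborel \<Otimes>\<^sub>M P). (case x of (t, w) \<Rightarrow> (W' t * F t w + W t * G t w) * indicator {a..b} t))"
      unfolding eq ..
  qed
  also have "\<dots> = (LINT w|P. W b * F b w - W a * F a w)"
  proof (rule Bochner_Integration.integral_cong[OF refl])
    fix w assume w: "w \<in> space P"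
    show "(LINT t|lborel. (W' t * F t w + W t * G t w) * indicator {a..b} t) = W b * F b w - W a * F a w"
    proof (rule integral_FTC_Icc_real[OF ab])
      fix t
      show "((\<lambda>t. W t * F t w) has_real_derivative W' t * F t w + W t * G t w) (at t)"
        using DERIV_mult[OF W_der[of t] F_der[OF w, of t]] by (simp add: algebra_simps)
      have "isCont W t" "isCont W' t" "isCont (\<lambda>t. F t w) t" "isCont (\<lambda>t. G t w) t"
        using W_continuous[of UNIV] G_cont[OF w] DERIV_isCont[OF F_der[OF w]] by (auto simp: continuous_on_eq_continuous_at)
      then show "isCont (\<lambda>t. W' t * F t w + W t * G t w) t" by (intro continuous_intros)
    qed
  qed
  also have "\<dots> = marg b * W b - marg a * W a"
    using F_integrable by (simp add: marg_def mult.commute)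
  finally have "(LINT x|(lborel \<Otimes>\<^sub>M P). H x) \<le> marg b * W b - marg a * W a + enn2real I / 2" by simp
  moreover have "(LINT x|(lborel \<Otimes>\<^sub>M P). H x) = (LINT t|lborel. LINT w|P. indicator {a..b} t * (c t * F t w))"
    using H unfolding H_def by (rule LP.integral_fst[symmetric])
  moreover have "\<dots> = (LINT t|lborel. indicator {a..b} t * (u t * (ln (marg t) + gap t)))"
    by (simp add: marg_def[symmetric] u_def c_def mult_ac)
  ultimately show ?thesis by simp
qed

text \<open>
  The interval is exhausted along endpoints at which the boundary terms are small. Adding \<open>\<phi> - u\<close>,
  whose integral vanishes in the limit, turns \<open>u (ln marg + gap)\<close> into a nonnegative integrand, and
  Fatou's lemma applies.
\<close>

lemma marginal_deficit:
  "(\<integral>\<^sup>+t. ennreal (\<phi> t * rel_ent (marg t) 1 + u t * gap t) \<partial>lborel)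
    \<le> (\<integral>\<^sup>+t. \<integral>\<^sup>+w. ennreal ((G t w)\<^sup>2 / F t w) \<partial>P \<partial>gauss1) / 2"
proof -
  define I where "I = (\<integral>\<^sup>+t. \<integral>\<^sup>+w. ennreal ((G t w)\<^sup>2 / F t w) \<partial>P \<partial>gauss1)"
  define K where "K t = \<phi> t * rel_ent (marg t) 1 + u t * gap t" for t
  have K_eq: "K t = u t * (ln (marg t) + gap t) - u t + \<phi> t" for t
    by (simp add: K_def rel_ent_def u_def algebra_simps)
  have K0: "0 \<le> K t" for t
    unfolding K_def using rel_ent_nonneg[OF marg_pos[of t], of 1] gap_nonneg[of t] u_pos[of t] by simp
  have cont: "continuous_on UNIV (\<lambda>t. u t * (ln (marg t) + gap t))" unfolding gap_def[abs_def]
    using marg_pos T'_pos class_B_D(1)[OF u_class_B]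
    by (intro continuous_intros marg_continuous T'_continuous) (auto simp: less_imp_neq[symmetric])
  have [measurable]: "u \<in> borel_measurable borel" by (rule class_B_D(5)[OF u_class_B])
  have [measurable]: "T' \<in> borel_measurable borel" by (rule borel_measurable_continuous_onI[OF T'_continuous])
  have [measurable]: "K \<in> borel_measurable borel" unfolding K_def[abs_def] gap_def[abs_def] by measurable
  \<comment> \<open>Endpoints tending to infinity with boundary terms at most \<open>e n\<close>.\<close>
  define e where "e n = 1 / (real n + 1)" for n
  have e: "0 < e n" for n by (simp add: e_def)
  have "\<exists>b\<ge>real n + 1. u b * T b \<le> e n" for n by (rule boundary_right[OF e])
  then obtain b where b: "\<And>n. real n + 1 \<le> b n" "\<And>n. u (b n) * T (b n) \<le> e n" by metis
  have "\<exists>a\<le>- real n - 1. - (u a * T a) \<le> e n" for n by (rule boundary_left[OF e])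
  then obtain a where a: "\<And>n. a n \<le> - real n - 1" "\<And>n. - (u (a n) * T (a n)) \<le> e n" by metis
  have ab: "a n \<le> b n" for n using a(1)[of n] b(1)[of n] by linarith
  define r where "r n = enn2real I / 2 + 2 * e n + 1 - (LINT t|lborel. indicator {a n..b n} t * u t)" for n
  have bound: "(\<integral>\<^sup>+t. ennreal (K t) * indicator {a n..b n} t \<partial>lborel) \<le> ennreal (r n)" for n
  proof -
    have cint: "integrable lborel (\<lambda>t. indicator {a n..b n} t * f t)" if "continuous_on UNIV f" for f :: "real \<Rightarrow> real"
      using borel_integrable_compact[of "{a n..b n}" f] continuous_on_subset[OF that] by simp
    have i1: "integrable lborel (\<lambda>t. indicator {a n..b n} t * (u t * (ln (marg t) + gap t)))" by (rule cint[OF cont])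
    have i2: "integrable lborel (\<lambda>t. indicator {a n..b n} t * u t)" by (rule cint[OF class_B_D(1)[OF u_class_B]])
    have i3: "integrable lborel (\<lambda>t. indicator {a n..b n} t * \<phi> t)" by (rule cint[OF class_B_D(1)[OF std_normal_density_class_B]])
    have K: "indicator {a n..b n} t * K t = indicator {a n..b n} t * (u t * (ln (marg t) + gap t)) - indicator {a n..b n} t * u t + indicator {a n..b n} t * \<phi> t" for t
      by (simp add: K_eq algebra_simps)
    have iK: "integrable lborel (\<lambda>t. indicator {a n..b n} t * K t)" unfolding K using i1 i2 i3 by auto
    have "marg (b n) * W (b n) \<le> e n"
    proof -
      have "marg (b n) * W (b n) = u (b n) * T (b n) - u (b n) * b n" by (simp add: W_def u_def algebra_simps)
      moreover have "0 \<le> u (b n) * b n" using u_pos[of "b n"] b(1)[of n] by simp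
      ultimately show ?thesis using b(2)[of n] by simp
    qed
    moreover have "- (marg (a n) * W (a n)) \<le> e n"
    proof -
      have "- (marg (a n) * W (a n)) = - (u (a n) * T (a n)) + u (a n) * a n" by (simp add: W_def u_def algebra_simps)
      moreover have "u (a n) * a n \<le> 0" using u_pos[of "a n"] a(1)[of n] by (simp add: mult_le_0_iff)
      ultimately show ?thesis using a(2)[of n] by simp
    qed
    moreover have "(LINT t|lborel. indicator {a n..b n} t * \<phi> t) \<le> 1"
    proof -
      have "(LINT t|lborel. indicator {a n..b n} t * \<phi> t) \<le> (LINT t|lborel. \<phi> t)"
        using i3 class_B_D(4)[OF std_normal_density_class_B] by (rule integral_mono) (simp add: indicator_def)
      then show ?thesis by simp
    qed
    moreover have "(LINT t|lborel. indicator {a n..b n} t * K t) = (LINT t|lborel. indicator {a n..b n} t * (u t * (ln (marg t) + gap t)))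
       - (LINT t|lborel. indicator {a n..b n} t * u t) + (LINT t|lborel. indicator {a n..b n} t * \<phi> t)"
      unfolding K using i1 i2 i3 by simp
    ultimately have le: "(LINT t|lborel. indicator {a n..b n} t * K t) \<le> r n"
      using interval_bound[OF ab[of n]] by (simp add: r_def I_def)
    have "(\<integral>\<^sup>+t. ennreal (K t) * indicator {a n..b n} t \<partial>lborel) = (\<integral>\<^sup>+t. ennreal (indicator {a n..b n} t * K t) \<partial>lborel)"
      by (intro nn_integral_cong) (simp add: indicator_def)
    also have "\<dots> = ennreal (LINT t|lborel. indicator {a n..b n} t * K t)"
      by (rule nn_integral_eq_integral[OF iK]) (simp add: K0)
    also have "\<dots> \<le> ennreal (r n)" using le by (rule ennreal_leI)
    finally show ?thesis .
  qed
  have in_ab: "eventually (\<lambda>n. t \<in> {a n..b n}) sequentially" for t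
  proof -
    have "eventually (\<lambda>n. \<bar>t\<bar> \<le> real n) sequentially"
      using eventually_ge_at_top[of "nat \<lceil>\<bar>t\<bar>\<rceil>"] by eventually_elim linarith
    then show ?thesis
    proof eventually_elim
      case (elim n)
      then show ?case using a(1)[of n] b(1)[of n] by auto
    qed
  qed
  have "(\<lambda>n. LINT t|lborel. indicator {a n..b n} t * u t) \<longlonglongrightarrow> (LINT t|lborel. u t)"
  proof (rule integral_dominated_convergence[where w = u])
    show "AE t in lborel. (\<lambda>n. indicator {a n..b n} t * u t) \<longlonglongrightarrow> u t"
    proof (rule AE_I2)
      fix t
      show "(\<lambda>n. indicator {a n..b n} t * u t) \<longlonglongrightarrow> u t"
        by (rule tendsto_eventually, rule eventually_mono[OF in_ab[of t]]) (simp add: indicator_def)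
    qed
    show "AE t in lborel. norm (indicator {a n..b n} t * u t) \<le> u t" for n
      using u_pos by (auto simp: indicator_def less_imp_le abs_of_pos)
  qed (use class_B_D(4)[OF u_class_B] in auto)
  moreover have "(LINT t|lborel. u t) = 1"
    using class_B_D(3)[OF u_class_B] by (rule has_bochner_integral_integral_eq)
  moreover have "e \<longlonglongrightarrow> 0" unfolding e_def[abs_def]
    using LIMSEQ_inverse_real_of_nat by (simp add: inverse_eq_divide add.commute)
  ultimately have "r \<longlonglongrightarrow> enn2real I / 2 + 2 * 0 + 1 - 1"
    unfolding r_def[abs_def] by (intro tendsto_intros) auto
  then have r: "(\<lambda>n. ennreal (r n)) \<longlonglongrightarrow> ennreal (enn2real I / 2)" by (intro tendsto_ennrealI) simp
  have "(\<integral>\<^sup>+t. ennreal (K t) \<partial>lborel) = (\<integral>\<^sup>+t. liminf (\<lambda>n. ennreal (K t) * indicator {a n..b n} t) \<partial>lborel)"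
  proof (intro nn_integral_cong lim_imp_Liminf[symmetric])
    fix t
    show "(\<lambda>n. ennreal (K t) * indicator {a n..b n} t) \<longlonglongrightarrow> ennreal (K t)"
      by (rule tendsto_eventually, rule eventually_mono[OF in_ab[of t]]) (simp add: indicator_def)
  qed simp
  also have "\<dots> \<le> liminf (\<lambda>n. \<integral>\<^sup>+t. ennreal (K t) * indicator {a n..b n} t \<partial>lborel)"
    by (rule nn_integral_liminf) measurable
  also have "\<dots> \<le> liminf (\<lambda>n. ennreal (r n))"
    by (rule Liminf_mono) (simp add: bound)
  also have "\<dots> = ennreal (enn2real I / 2)" by (rule lim_imp_Liminf[OF _ r]) simp
  also have "\<dots> = I / 2"
    using fisher unfolding I_def[symmetric] by (cases I) (auto simp: divide_ennreal[symmetric])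
  finally show ?thesis by (simp add: K_def I_def)
qed

text \<open>
  The difference of the integrands is \<open>F ln marg - marg + 1\<close>, which is affine in \<open>F\<close> and has integral
  \<open>rel_ent marg 1\<close>. It is signed, so the case of an infinite entropy of the fibre is treated apart.
\<close>

lemma entropy_chain_rule:
  "(\<integral>\<^sup>+w. ennreal (rel_ent (F t w) 1) \<partial>P)
    \<le> (\<integral>\<^sup>+w. ennreal (rel_ent (F t w) (marg t)) \<partial>P) + ennreal (rel_ent (marg t) 1)"
proof (cases "(\<integral>\<^sup>+w. ennreal (rel_ent (F t w) (marg t)) \<partial>P) < \<infinity>")
  case fin: True
  have nn: "0 \<le> rel_ent (F t w) (marg t)" "0 \<le> rel_ent (F t w) 1" if "w \<in> space P" for w
    using rel_ent_nonneg F_pos[OF that] marg_pos by auto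
  have int: "integrable P (\<lambda>w. rel_ent (F t w) (marg t))"
  proof (rule integrableI_nonneg)
    show "AE w in P. 0 \<le> rel_ent (F t w) (marg t)" by (rule AE_I2) (rule nn)
  qed (use fin in auto)
  have eq: "rel_ent (F t w) 1 = rel_ent (F t w) (marg t) + (F t w * ln (marg t) - marg t + 1)" if "w \<in> space P" for w
    using F_pos[OF that, of t] marg_pos[of t] by (simp add: rel_ent_def ln_div algebra_simps)
  have int1: "integrable P (\<lambda>w. rel_ent (F t w) (marg t) + (F t w * ln (marg t) - marg t + 1))"
    using int F_integrable[of t] by auto
  have "(\<integral>\<^sup>+w. ennreal (rel_ent (F t w) 1) \<partial>P) = (\<integral>\<^sup>+w. ennreal (rel_ent (F t w) (marg t) + (F t w * ln (marg t) - marg t + 1)) \<partial>P)"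
    by (intro nn_integral_cong) (simp add: eq)
  also have "\<dots> = ennreal (LINT w|P. rel_ent (F t w) (marg t) + (F t w * ln (marg t) - marg t + 1))"
  proof (rule nn_integral_eq_integral[OF int1])
    show "AE w in P. 0 \<le> rel_ent (F t w) (marg t) + (F t w * ln (marg t) - marg t + 1)"
      by (rule AE_I2) (use nn eq in auto)
  qed
  also have "(LINT w|P. rel_ent (F t w) (marg t) + (F t w * ln (marg t) - marg t + 1))
     = (LINT w|P. rel_ent (F t w) (marg t)) + rel_ent (marg t) 1"
    using F_integrable[of t] by (subst Bochner_Integration.integral_add[OF int])
      (auto simp: marg_def[symmetric] rel_ent_def prob_space)
  also have "ennreal \<dots> = ennreal (LINT w|P. rel_ent (F t w) (marg t)) + ennreal (rel_ent (marg t) 1)"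
    using nn rel_ent_nonneg[OF marg_pos[of t]] by (intro ennreal_plus integral_nonneg_AE) auto
  also have "ennreal (LINT w|P. rel_ent (F t w) (marg t)) = (\<integral>\<^sup>+w. ennreal (rel_ent (F t w) (marg t)) \<partial>P)"
    by (rule nn_integral_eq_integral[OF int, symmetric]) (use nn in auto)
  finally show ?thesis by simp
next
  case False
  then have "(\<integral>\<^sup>+w. ennreal (rel_ent (F t w) (marg t)) \<partial>P) = \<infinity>" by (simp add: less_top[symmetric])
  then show ?thesis by simp
qed

text \<open>
  Here \<open>J\<close> stands for the bound that the log-Sobolev inequality in the fibre variables provides.
\<close>

lemma log_sobolev_step:
  assumes J[measurable]: "J \<in> borel_measurable borel"
    and fibre: "\<And>t. (\<integral>\<^sup>+w. ennreal (rel_ent (F t w) (marg t)) \<partial>P) \<le> J t"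
  shows "(\<integral>\<^sup>+t. \<integral>\<^sup>+w. ennreal (rel_ent (F t w) 1) \<partial>P \<partial>gauss1) + (\<integral>\<^sup>+t. ennreal (u t * gap t) \<partial>lborel)
    \<le> (\<integral>\<^sup>+t. J t \<partial>gauss1) + (\<integral>\<^sup>+t. \<integral>\<^sup>+w. ennreal ((G t w)\<^sup>2 / F t w) \<partial>P \<partial>gauss1) / 2"
proof -
  have [measurable]: "u \<in> borel_measurable borel" by (rule class_B_D(5)[OF u_class_B])
  have [measurable]: "T' \<in> borel_measurable borel" by (rule borel_measurable_continuous_onI[OF T'_continuous])
  have [measurable]: "gap \<in> borel_measurable borel" unfolding gap_def[abs_def] by measurable
  have "(\<integral>\<^sup>+t. \<integral>\<^sup>+w. ennreal (rel_ent (F t w) 1) \<partial>P \<partial>gauss1) + (\<integral>\<^sup>+t. ennreal (u t * gap t) \<partial>lborel)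
    \<le> (\<integral>\<^sup>+t. J t + ennreal (rel_ent (marg t) 1) \<partial>gauss1) + (\<integral>\<^sup>+t. ennreal (u t * gap t) \<partial>lborel)"
    by (intro add_right_mono nn_integral_mono order_trans[OF entropy_chain_rule] fibre)
  also have "\<dots> = (\<integral>\<^sup>+t. J t \<partial>gauss1) + ((\<integral>\<^sup>+t. ennreal (rel_ent (marg t) 1) \<partial>gauss1) + (\<integral>\<^sup>+t. ennreal (u t * gap t) \<partial>lborel))"
    by (subst nn_integral_add) (auto simp: add.assoc)
  also have "(\<integral>\<^sup>+t. ennreal (rel_ent (marg t) 1) \<partial>gauss1) + (\<integral>\<^sup>+t. ennreal (u t * gap t) \<partial>lborel)
    = (\<integral>\<^sup>+t. ennreal (\<phi> t * rel_ent (marg t) 1 + u t * gap t) \<partial>lborel)"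
  proof -
    have "ennreal (\<phi> t * rel_ent (marg t) 1 + u t * gap t) = ennreal (\<phi> t) * ennreal (rel_ent (marg t) 1) + ennreal (u t * gap t)" for t
      using rel_ent_nonneg[OF marg_pos[of t], of 1] gap_nonneg[of t] u_pos[of t] by (simp add: ennreal_mult')
    then show ?thesis by (simp add: nn_gauss1 nn_integral_add)
  qed
  also have "\<dots> \<le> (\<integral>\<^sup>+t. \<integral>\<^sup>+w. ennreal ((G t w)\<^sup>2 / F t w) \<partial>P \<partial>gauss1) / 2" by (rule marginal_deficit)
  finally show ?thesis by (simp add: add_left_mono)
qed

lemma dist1_marginal_le:
  "ennreal ((dist1 u \<phi>)\<^sup>2) / 2 \<le> (\<integral>\<^sup>+t. ennreal (u t * gap t) \<partial>lborel)"
proof -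
  have "ennreal ((dist1 u \<phi>)\<^sup>2) \<le> 2 * (\<integral>\<^sup>+t. ennreal (u t * gap t) \<partial>lborel)"
    using dist1_sq_le(2)[OF u_class_B std_normal_density_class_B] by (simp add: gap_def T'_def)
  then have "ennreal ((dist1 u \<phi>)\<^sup>2) / 2 \<le> 2 * (\<integral>\<^sup>+t. ennreal (u t * gap t) \<partial>lborel) / 2"
    by (rule divide_right_mono_ennreal)
  also have "\<dots> = (\<integral>\<^sup>+t. ennreal (u t * gap t) \<partial>lborel)"
    by (subst mult.commute) (simp add: ennreal_mult_divide_eq)
  finally show ?thesis .
qed

end

section \<open>The log-Sobolev inequality on Gaussian product spaces\<close>

text \<open>
  Differentiability along each coordinate line, with a derivative that is continuous along that line.
  Unlike differentiability of averages, this passes to slices without any estimate.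
\<close>

definition coordinatewise_C1 :: "'i set \<Rightarrow> (('i \<Rightarrow> real) \<Rightarrow> real) \<Rightarrow> ('i \<Rightarrow> ('i \<Rightarrow> real) \<Rightarrow> real) \<Rightarrow> bool" where
  "coordinatewise_C1 I F D \<longleftrightarrow>
     F \<in> borel_measurable (PiM I (\<lambda>_. borel)) \<and>
     (\<forall>i\<in>I. D i \<in> borel_measurable (PiM I (\<lambda>_. borel))) \<and>
     (\<forall>x\<in>space (PiM I (\<lambda>_. borel :: real measure)). 0 < F x \<and>
       (\<forall>i\<in>I. (\<forall>t. ((\<lambda>s. F (x(i := s))) has_real_derivative D i (x(i := t))) (at t)) \<and>
         continuous_on UNIV (\<lambda>s. D i (x(i := s)))))"

definition fisher_info :: "'i set \<Rightarrow> (('i \<Rightarrow> real) \<Rightarrow> real) \<Rightarrow> ('i \<Rightarrow> ('i \<Rightarrow> real) \<Rightarrow> real) \<Rightarrow> 'i \<Rightarrow> ennreal" where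
  "fisher_info I F D i = (\<integral>\<^sup>+x. ennreal ((D i x)\<^sup>2 / F x) \<partial>PiM I (\<lambda>_. gauss1))"

lemma prob_space_gauss1: "prob_space gauss1"
  by (rule prob_space_normal_density) simp

interpretation gauss_product: product_sigma_finite "\<lambda>_. gauss1"
  using prob_space_gauss1 by (simp add: product_sigma_finite_def prob_space_imp_sigma_finite)

lemma sets_PiM_gauss1[measurable_cong, simp]: "sets (PiM I (\<lambda>_. gauss1)) = sets (PiM I (\<lambda>_. borel))"
  by (rule sets_PiM_cong) auto

lemma space_PiM_gauss1: "space (PiM I (\<lambda>_. gauss1)) = space (PiM I (\<lambda>_. borel :: real measure))"
  by (rule sets_eq_imp_space_eq) simp

lemma prob_space_PiM_gauss1: "prob_space (PiM I (\<lambda>_. gauss1))"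
  by (rule prob_space_PiM) (rule prob_space_gauss1)

lemma fun_upd_in_space_PiM:
  "w \<in> space (PiM I (\<lambda>_. borel :: real measure)) \<Longrightarrow> w(k := t) \<in> space (PiM (insert k I) (\<lambda>_. borel :: real measure))"
  by (auto simp: space_PiM PiE_iff extensional_def)

lemma coordinatewise_C1_slice:
  assumes C1: "coordinatewise_C1 (insert k I) F D" and k: "k \<notin> I"
  shows "coordinatewise_C1 I (\<lambda>w. F (w(k := t))) (\<lambda>i w. D i (w(k := t)))"
proof -
  have upd: "(\<lambda>w. w(k := t)) \<in> PiM I (\<lambda>_. borel) \<rightarrow>\<^sub>M PiM (insert k I) (\<lambda>_. borel :: real measure)"
    by (rule measurable_fun_upd[where J = I]) auto
  have "(w(i := s))(k := t) = (w(k := t))(i := s)" if "i \<in> I" for w :: "'a \<Rightarrow> real" and i s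
    using that k by (auto simp: fun_upd_twist)
  then show ?thesis
    using C1 measurable_compose[OF upd, of F borel] measurable_compose[OF upd, of "D _" borel]
    unfolding coordinatewise_C1_def by (auto simp: fun_upd_in_space_PiM)
qed

lemma coordinatewise_C1_scale:
  assumes C1: "coordinatewise_C1 I F D" and c: "0 < (c::real)"
  shows "coordinatewise_C1 I (\<lambda>x. c * F x) (\<lambda>i x. c * D i x)"
  using assms unfolding coordinatewise_C1_def
  by (auto intro!: DERIV_cmult continuous_intros)

lemma rel_ent_scale:
  assumes "0 < c" shows "rel_ent (c * x) (c * y) = c * rel_ent x y"
  using assms by (simp add: rel_ent_def algebra_simps)

lemma fisher_info_scale:
  assumes C1: "coordinatewise_C1 I F D" and c: "0 < c" and i: "i \<in> I"
  shows "fisher_info I (\<lambda>x. c * F x) (\<lambda>i x. c * D i x) i = ennreal c * fisher_info I F D i"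
proof -
  have [measurable]: "F \<in> borel_measurable (PiM I (\<lambda>_. borel))" "D i \<in> borel_measurable (PiM I (\<lambda>_. borel))"
    using C1 i by (auto simp: coordinatewise_C1_def)
  have "ennreal ((c * D i x)\<^sup>2 / (c * F x)) = ennreal c * ennreal ((D i x)\<^sup>2 / F x)" for x
  proof -
    have "(c * D i x)\<^sup>2 / (c * F x) = c * ((D i x)\<^sup>2 / F x)" using c by (simp add: power2_eq_square)
    then show ?thesis using c by (simp only: ennreal_mult'[OF less_imp_le[OF c]])
  qed
  then show ?thesis unfolding fisher_info_def by (simp add: nn_integral_cmult)
qed

lemma fibration_of_product:
  assumes I: "finite I" "k \<notin> I" and C1: "coordinatewise_C1 (insert k I) F D"
    and mass: "(\<integral>\<^sup>+x. ennreal (F x) \<partial>PiM (insert k I) (\<lambda>_. gauss1)) = 1"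
    and fisher: "fisher_info (insert k I) F D k < \<infinity>"
  shows "gaussian_fibration (PiM I (\<lambda>_. gauss1)) (\<lambda>t w. F (w(k := t))) (\<lambda>t w. D k (w(k := t)))"
proof -
  interpret P: prob_space "PiM I (\<lambda>_. gauss1)" by (rule prob_space_PiM_gauss1)
  have [measurable]: "F \<in> borel_measurable (PiM (insert k I) (\<lambda>_. borel))" "D k \<in> borel_measurable (PiM (insert k I) (\<lambda>_. borel))"
    using C1 by (auto simp: coordinatewise_C1_def)
  have upd: "(\<lambda>(t, w). w(k := t)) \<in> borel \<Otimes>\<^sub>M PiM I (\<lambda>_. gauss1) \<rightarrow>\<^sub>M PiM (insert k I) (\<lambda>_. borel :: real measure)"
    unfolding case_prod_unfold by (rule measurable_fun_upd[where J = I]) auto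
  note rev = gauss_product.product_nn_integral_insert_rev[OF I, symmetric]
  show ?thesis
  proof unfold_locales
    show "(\<lambda>(t, w). F (w(k := t))) \<in> borel_measurable (borel \<Otimes>\<^sub>M PiM I (\<lambda>_. gauss1))"
      "(\<lambda>(t, w). D k (w(k := t))) \<in> borel_measurable (borel \<Otimes>\<^sub>M PiM I (\<lambda>_. gauss1))"
      using measurable_compose[OF upd, of F borel] measurable_compose[OF upd, of "D k" borel] by (simp_all add: case_prod_unfold)
    show "(\<integral>\<^sup>+t. \<integral>\<^sup>+w. ennreal (F (w(k := t))) \<partial>PiM I (\<lambda>_. gauss1) \<partial>gauss1) = 1"
      using mass by (subst rev[where f = "\<lambda>x. ennreal (F x)"]) auto
    show "(\<integral>\<^sup>+t. \<integral>\<^sup>+w. ennreal ((D k (w(k := t)))\<^sup>2 / F (w(k := t))) \<partial>PiM I (\<lambda>_. gauss1) \<partial>gauss1) < \<infinity>"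
      using fisher unfolding fisher_info_def by (subst rev[where f = "\<lambda>x. ennreal ((D k x)\<^sup>2 / F x)"]) auto
    fix w t assume "w \<in> space (PiM I (\<lambda>_. gauss1))"
    then have w: "w(k := s) \<in> space (PiM (insert k I) (\<lambda>_. borel :: real measure))" for s
      by (simp add: space_PiM_gauss1 fun_upd_in_space_PiM)
    show "0 < F (w(k := t))" using C1 w by (auto simp: coordinatewise_C1_def)
    have "((\<lambda>s. F ((w(k := 0))(k := s))) has_real_derivative D k ((w(k := 0))(k := t))) (at t)"
      "continuous_on UNIV (\<lambda>s. D k ((w(k := 0))(k := s)))"
      using C1 w[of 0] unfolding coordinatewise_C1_def by blast+
    then show "((\<lambda>t. F (w(k := t))) has_real_derivative D k (w(k := t))) (at t)"
      "continuous_on UNIV (\<lambda>s. D k (w(k := s)))" by simp_all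
  qed
qed

text \<open>
  Stated for functions of arbitrary mass, since the slices of a normalised function are not
  normalised.
\<close>

definition log_sobolev :: "'i set \<Rightarrow> bool" where
  "log_sobolev I \<longleftrightarrow> (\<forall>F D m. coordinatewise_C1 I F D \<longrightarrow> 0 < m \<longrightarrow>
     (\<integral>\<^sup>+x. ennreal (F x) \<partial>PiM I (\<lambda>_. gauss1)) = ennreal m \<longrightarrow>
     (\<integral>\<^sup>+x. ennreal (rel_ent (F x) m) \<partial>PiM I (\<lambda>_. gauss1)) \<le> (\<Sum>i\<in>I. fisher_info I F D i) / 2)"

text \<open>
  The fibration over coordinate \<open>k\<close>: the log-Sobolev inequality in the other coordinates is applied to the
  slices of \<open>F\<close>, and the gain from the transport of the marginal in coordinate \<open>k\<close> is kept.
\<close>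

lemma log_sobolev_deficit_step:
  assumes I: "finite I" "k \<notin> I" and LSI: "log_sobolev I" and C1: "coordinatewise_C1 (insert k I) F D"
    and mass: "(\<integral>\<^sup>+x. ennreal (F x) \<partial>PiM (insert k I) (\<lambda>_. gauss1)) = 1"
    and fisher: "fisher_info (insert k I) F D k < \<infinity>"
  shows "(\<integral>\<^sup>+x. ennreal (rel_ent (F x) 1) \<partial>PiM (insert k I) (\<lambda>_. gauss1))
     + ennreal ((dist1 (\<lambda>t. (LINT w|PiM I (\<lambda>_. gauss1). F (w(k := t))) * std_normal_density t) std_normal_density)\<^sup>2) / 2
     \<le> (\<Sum>i\<in>insert k I. fisher_info (insert k I) F D i) / 2"
proof -
  interpret gaussian_fibration "PiM I (\<lambda>_. gauss1)" "\<lambda>t w. F (w(k := t))" "\<lambda>t w. D k (w(k := t))"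
    by (rule fibration_of_product[OF I C1 mass fisher])
  have [measurable]: "F \<in> borel_measurable (PiM (insert k I) (\<lambda>_. borel))"
    "\<And>i. i \<in> insert k I \<Longrightarrow> D i \<in> borel_measurable (PiM (insert k I) (\<lambda>_. borel))"
    using C1 by (auto simp: coordinatewise_C1_def)
  have upd[measurable]: "(\<lambda>(t, w). w(k := t)) \<in> borel \<Otimes>\<^sub>M PiM I (\<lambda>_. gauss1) \<rightarrow>\<^sub>M PiM (insert k I) (\<lambda>_. borel :: real measure)"
    unfolding case_prod_unfold by (rule measurable_fun_upd[where J = I]) auto
  note rev = gauss_product.product_nn_integral_insert_rev[OF I]
  have u_eq: "u = (\<lambda>t. (LINT w|PiM I (\<lambda>_. gauss1). F (w(k := t))) * std_normal_density t)"
    by (rule ext) (simp only: u_def marg_def)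
  define j where "j i t = (\<integral>\<^sup>+w. ennreal ((D i (w(k := t)))\<^sup>2 / F (w(k := t))) \<partial>PiM I (\<lambda>_. gauss1))" for i t
  have j[measurable]: "j i \<in> borel_measurable borel" if i: "i \<in> insert k I" for i
  proof -
    have "(\<lambda>x. ennreal ((D i x)\<^sup>2 / F x)) \<in> borel_measurable (PiM (insert k I) (\<lambda>_. borel))" using i by measurable
    from measurable_compose[OF upd this]
    have "(\<lambda>(t, w). ennreal ((D i (w(k := t)))\<^sup>2 / F (w(k := t)))) \<in> borel_measurable (borel \<Otimes>\<^sub>M PiM I (\<lambda>_. gauss1))"
      by (simp add: case_prod_unfold)
    then show ?thesis unfolding j_def[abs_def] by (rule borel_measurable_nn_integral)
  qed
  have fi: "fisher_info (insert k I) F D i = (\<integral>\<^sup>+t. j i t \<partial>gauss1)" if "i \<in> insert k I" for i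
    using that unfolding fisher_info_def j_def by (subst rev) auto
  have fibre: "(\<integral>\<^sup>+w. ennreal (rel_ent (F (w(k := t))) (marg t)) \<partial>PiM I (\<lambda>_. gauss1)) \<le> (\<Sum>i\<in>I. j i t) / 2" for t
    using LSI[unfolded log_sobolev_def, rule_format, OF coordinatewise_C1_slice[OF C1 I(2)] marg_pos nn_integral_F]
    by (simp add: fisher_info_def j_def)
  have "(\<integral>\<^sup>+x. ennreal (rel_ent (F x) 1) \<partial>PiM (insert k I) (\<lambda>_. gauss1))
     + ennreal ((dist1 u std_normal_density)\<^sup>2) / 2
    \<le> (\<integral>\<^sup>+t. \<integral>\<^sup>+w. ennreal (rel_ent (F (w(k := t))) 1) \<partial>PiM I (\<lambda>_. gauss1) \<partial>gauss1) + (\<integral>\<^sup>+t. ennreal (u t * gap t) \<partial>lborel)"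
    by (subst rev) (auto intro!: add_left_mono dist1_marginal_le)
  also have "\<dots> \<le> (\<integral>\<^sup>+t. (\<Sum>i\<in>I. j i t) / 2 \<partial>gauss1) + (\<integral>\<^sup>+t. j k t \<partial>gauss1) / 2"
    unfolding j_def[of k] by (rule log_sobolev_step[OF _ fibre]) (auto intro!: borel_measurable_divide_ennreal borel_measurable_sum j)
  also have "(\<integral>\<^sup>+t. (\<Sum>i\<in>I. j i t) / 2 \<partial>gauss1) = (\<Sum>i\<in>I. \<integral>\<^sup>+t. j i t \<partial>gauss1) / 2"
    by (subst nn_integral_divide) (auto simp: nn_integral_sum)
  also have "(\<Sum>i\<in>I. \<integral>\<^sup>+t. j i t \<partial>gauss1) / 2 + (\<integral>\<^sup>+t. j k t \<partial>gauss1) / 2 = (\<Sum>i\<in>insert k I. \<integral>\<^sup>+t. j i t \<partial>gauss1) / 2"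
    using I by (simp add: add_divide_distrib_ennreal[symmetric] add.commute)
  also have "(\<Sum>i\<in>insert k I. \<integral>\<^sup>+t. j i t \<partial>gauss1) = (\<Sum>i\<in>insert k I. fisher_info (insert k I) F D i)"
    by (rule sum.cong[OF refl fi[symmetric]])
  finally show ?thesis unfolding u_eq .
qed

text \<open>
  Induction on the coordinates, discarding the transport gain of \<open>log_sobolev_deficit_step\<close> and
  removing its normalisation by homogeneity. If the Fisher information in the new coordinate is
  infinite, the bound is trivial.
\<close>

lemma log_sobolev_product:
  assumes "finite I" shows "log_sobolev I"
  using assms
proof (induction I rule: finite_induct)
  case empty
  show ?case unfolding log_sobolev_def
  proof (intro allI impI)
    fix F :: "('a \<Rightarrow> real) \<Rightarrow> real" and D :: "'a \<Rightarrow> ('a \<Rightarrow> real) \<Rightarrow> real" and m :: real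
    assume C1: "coordinatewise_C1 {} F D" and m: "0 < m" and mass: "(\<integral>\<^sup>+x. ennreal (F x) \<partial>PiM {} (\<lambda>_. gauss1)) = ennreal m"
    have "F (\<lambda>_. undefined) = m"
      using C1 m mass by (auto simp: PiM_empty nn_integral_count_space_finite coordinatewise_C1_def)
    then show "(\<integral>\<^sup>+x. ennreal (rel_ent (F x) m) \<partial>PiM {} (\<lambda>_. gauss1)) \<le> (\<Sum>i\<in>{}. fisher_info {} F D i) / 2"
      using m by (simp add: PiM_empty nn_integral_count_space_finite rel_ent_def)
  qed
next
  case (insert k I)
  show ?case unfolding log_sobolev_def
  proof (intro allI impI)
    fix F D m
    assume C1: "coordinatewise_C1 (insert k I) F D" and m: "0 < (m::real)"
      and mass: "(\<integral>\<^sup>+x. ennreal (F x) \<partial>PiM (insert k I) (\<lambda>_. gauss1)) = ennreal m"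
    have [measurable]: "F \<in> borel_measurable (PiM (insert k I) (\<lambda>_. borel))" using C1 by (auto simp: coordinatewise_C1_def)
    let ?F = "\<lambda>x. 1 / m * F x" and ?D = "\<lambda>i x. 1 / m * D i x"
    show "(\<integral>\<^sup>+x. ennreal (rel_ent (F x) m) \<partial>PiM (insert k I) (\<lambda>_. gauss1)) \<le> (\<Sum>i\<in>insert k I. fisher_info (insert k I) F D i) / 2"
    proof (cases "fisher_info (insert k I) F D k < \<infinity>")
      case True
      have C1': "coordinatewise_C1 (insert k I) ?F ?D" by (rule coordinatewise_C1_scale[OF C1]) (use m in simp)
      have fi: "fisher_info (insert k I) ?F ?D i = ennreal (1 / m) * fisher_info (insert k I) F D i" if "i \<in> insert k I" for i
        by (rule fisher_info_scale[OF C1 _ that]) (use m in simp)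
      have mass': "(\<integral>\<^sup>+x. ennreal (?F x) \<partial>PiM (insert k I) (\<lambda>_. gauss1)) = 1"
      proof -
        have "(\<integral>\<^sup>+x. ennreal (?F x) \<partial>PiM (insert k I) (\<lambda>_. gauss1)) = (\<integral>\<^sup>+x. ennreal (1 / m) * ennreal (F x) \<partial>PiM (insert k I) (\<lambda>_. gauss1))"
          using m by (intro nn_integral_cong) (subst ennreal_mult'[symmetric], auto)
        also have "\<dots> = ennreal (1 / m) * ennreal m" by (subst nn_integral_cmult) (auto simp: mass)
        also have "\<dots> = 1" using m by (simp add: ennreal_mult'[symmetric])
        finally show ?thesis .
      qed
      have fisher': "fisher_info (insert k I) ?F ?D k < \<infinity>" using True by (subst fi) (simp_all add: ennreal_mult_less_top)
      have "(\<integral>\<^sup>+x. ennreal (rel_ent (F x) m) \<partial>PiM (insert k I) (\<lambda>_. gauss1))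
         = (\<integral>\<^sup>+x. ennreal m * ennreal (rel_ent (?F x) 1) \<partial>PiM (insert k I) (\<lambda>_. gauss1))"
      proof (intro nn_integral_cong)
        fix x show "ennreal (rel_ent (F x) m) = ennreal m * ennreal (rel_ent (?F x) 1)"
          using rel_ent_scale[OF m, of "?F x" 1] m by (simp add: ennreal_mult'[symmetric])
      qed
      also have "\<dots> = ennreal m * (\<integral>\<^sup>+x. ennreal (rel_ent (?F x) 1) \<partial>PiM (insert k I) (\<lambda>_. gauss1))"
        by (rule nn_integral_cmult) measurable
      also have "\<dots> \<le> ennreal m * ((\<Sum>i\<in>insert k I. fisher_info (insert k I) ?F ?D i) / 2)"
        by (intro mult_left_mono order_trans[OF _ log_sobolev_deficit_step[OF insert.hyps insert.IH C1' mass' fisher']]) auto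
      also have "\<dots> = ennreal m * (ennreal (1 / m) * (\<Sum>i\<in>insert k I. fisher_info (insert k I) F D i) / 2)"
      proof -
        have "(\<Sum>i\<in>insert k I. fisher_info (insert k I) ?F ?D i) = ennreal (1 / m) * (\<Sum>i\<in>insert k I. fisher_info (insert k I) F D i)"
          unfolding sum_distrib_left by (rule sum.cong[OF refl fi])
        then show ?thesis by (simp only:)
      qed
      also have "\<dots> = (ennreal m * ennreal (1 / m)) * (\<Sum>i\<in>insert k I. fisher_info (insert k I) F D i) / 2"
        by (simp only: ennreal_times_divide mult.assoc)
      also have "ennreal m * ennreal (1 / m) = 1" using m by (simp add: ennreal_mult'[symmetric])
      finally show ?thesis by simp
    next
      case False
      then have "fisher_info (insert k I) F D k = \<infinity>" by (simp add: less_top[symmetric])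
      then have "(\<Sum>i\<in>insert k I. fisher_info (insert k I) F D i) / 2 = \<infinity>"
        using insert.hyps by (simp add: ennreal_top_divide)
      then show ?thesis by simp
    qed
  qed
qed

section \<open>Gaussian coordinates, marginals and the deficit\<close>

lemma PiM_gauss1_eq_density:
  assumes J: "finite J"
  shows "PiM J (\<lambda>_. gauss1) = density (PiM J (\<lambda>_. lborel)) (\<lambda>x. ennreal (\<Prod>i\<in>J. std_normal_density (x i)))"
proof (rule gauss_product.PiM_eqI[OF J, symmetric])
  interpret product_sigma_finite "\<lambda>_. lborel :: real measure" by standard
  show "sets (density (PiM J (\<lambda>_. lborel)) (\<lambda>x. ennreal (\<Prod>i\<in>J. std_normal_density (x i)))) = sets (PiM J (\<lambda>_. gauss1))"
    by (auto intro!: sets_PiM_cong)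
  fix A assume "\<And>i. i \<in> J \<Longrightarrow> A i \<in> sets gauss1"
  then have A: "A i \<in> sets borel" if "i \<in> J" for i using that by simp
  have "emeasure (density (PiM J (\<lambda>_. lborel)) (\<lambda>x. ennreal (\<Prod>i\<in>J. std_normal_density (x i)))) (PiE J A)
     = (\<integral>\<^sup>+x. ennreal (\<Prod>i\<in>J. std_normal_density (x i)) * indicator (PiE J A) x \<partial>PiM J (\<lambda>_. lborel))"
    using A J by (intro emeasure_density) (auto intro!: sets_PiM_I_finite)
  also have "\<dots> = (\<integral>\<^sup>+x. (\<Prod>i\<in>J. ennreal (std_normal_density (x i)) * indicator (A i) (x i)) \<partial>PiM J (\<lambda>_. lborel))"
  proof (rule nn_integral_cong)
    fix x assume x: "x \<in> space (PiM J (\<lambda>_. lborel :: real measure))"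
    have "indicator (PiE J A) x = (\<Prod>i\<in>J. indicator (A i) (x i) :: ennreal)"
    proof (cases "x \<in> PiE J A")
      case True
      then have "(\<Prod>i\<in>J. indicator (A i) (x i) :: ennreal) = 1" by (intro prod.neutral) (auto simp: PiE_iff)
      then show ?thesis using True by simp
    next
      case False
      then obtain i where "i \<in> J" "x i \<notin> A i" using x by (auto simp: space_PiM PiE_iff)
      then show ?thesis using J False by (auto simp: indicator_def intro!: prod_zero[symmetric] bexI[of _ i])
    qed
    then show "ennreal (\<Prod>i\<in>J. std_normal_density (x i)) * indicator (PiE J A) x
      = (\<Prod>i\<in>J. ennreal (std_normal_density (x i)) * indicator (A i) (x i))"
      by (simp add: prod.distrib prod_ennreal)
  qed
  also have "\<dots> = (\<Prod>i\<in>J. \<integral>\<^sup>+t. ennreal (std_normal_density t) * indicator (A i) t \<partial>lborel)"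
    using A J by (intro product_nn_integral_prod) auto
  also have "\<dots> = (\<Prod>i\<in>J. emeasure gauss1 (A i))"
    using A by (intro prod.cong) (auto simp: emeasure_density)
  finally show "emeasure (density (PiM J (\<lambda>_. lborel)) (\<lambda>x. ennreal (\<Prod>i\<in>J. std_normal_density (x i)))) (PiE J A)
     = (\<Prod>i\<in>J. emeasure gauss1 (A i))" .
qed

lemma gauss_density_measurable[measurable]: "gauss_density \<in> borel_measurable borel"
  unfolding gauss_density_def[abs_def] by measurable

lemma gauss_density_pos: "0 < gauss_density x"
  by (simp add: gauss_density_def)

lemma sets_gauss[simp, measurable_cong]: "sets gauss = sets borel"
  by (simp add: gauss_def)

lemma space_gauss[simp]: "space gauss = UNIV"
  by (simp add: gauss_def)

context orthonormal_basis
begin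

lemma gauss_density_comb: "gauss_density (comb x) = (\<Prod>b\<in>B. std_normal_density (x b))"
proof -
  have "(\<Prod>b\<in>B. std_normal_density (x b)) = (1 / sqrt (2 * pi)) ^ card B * exp (\<Sum>b\<in>B. - (x b)\<^sup>2 / 2)"
    unfolding std_normal_density_def prod.distrib by (simp add: exp_sum finite_B)
  also have "(\<Sum>b\<in>B. - (x b)\<^sup>2 / 2) = - (norm (comb x))\<^sup>2 / 2"
    by (simp add: norm_comb sum_negf sum_divide_distrib)
  also have "(1 / sqrt (2 * pi)) ^ card B = (2 * pi) powr (- real DIM('a) / 2)"
  proof -
    have "1 / sqrt (2 * pi) = (2 * pi) powr (- 1 / 2)" by (simp add: powr_minus_divide powr_half_sqrt)
    then have "(1 / sqrt (2 * pi)) ^ card B = ((2 * pi) powr (- 1 / 2)) powr real (card B)"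
      by (simp add: powr_realpow)
    then show ?thesis by (simp add: powr_powr card_B)
  qed
  finally show ?thesis by (simp add: gauss_density_def)
qed

lemma nn_integral_gauss:
  assumes [measurable]: "g \<in> borel_measurable borel"
  shows "(\<integral>\<^sup>+x. g x \<partial>gauss) = (\<integral>\<^sup>+x. g (comb x) \<partial>PiM B (\<lambda>_. gauss1))"
proof -
  have "(\<integral>\<^sup>+x. g x \<partial>gauss) = (\<integral>\<^sup>+x. ennreal (gauss_density x) * g x \<partial>lborel)"
    unfolding gauss_def by (rule nn_integral_density) auto
  also have "\<dots> = (\<integral>\<^sup>+x. ennreal (gauss_density (comb x)) * g (comb x) \<partial>PiM B (\<lambda>_. lborel))"
    by (subst distr_comb_lborel[symmetric]) (simp add: nn_integral_distr)
  also have "\<dots> = (\<integral>\<^sup>+x. g (comb x) \<partial>PiM B (\<lambda>_. gauss1))"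
    unfolding PiM_gauss1_eq_density[OF finite_B] gauss_density_comb
    by (subst nn_integral_density) auto
  finally show ?thesis .
qed

lemma parseval: "(\<Sum>b\<in>B. (a \<bullet> b)\<^sup>2) = (norm a)\<^sup>2"
  using norm_comb[of "\<lambda>b. a \<bullet> b"] by (simp add: comb_coordinates)

text \<open>
  The Gaussian density factorises along \<open>\<xi>\<close>, so the Lebesgue average over the hyperplane becomes a
  Gaussian average times the one-dimensional density.
\<close>

lemma marginal_eq:
  assumes xi: "\<xi> \<in> B" and h[measurable]: "h \<in> borel_measurable borel"
    and c: "0 \<le> c" "perp_measure \<xi> = density (distr (PiM (B - {\<xi>}) (\<lambda>_. lborel)) borel (\<lambda>w. comb (w(\<xi> := 0)))) (\<lambda>_. ennreal c)"
  shows "marginal \<xi> (\<lambda>x. h x * gauss_density x) t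
    = c * ((LINT w|PiM (B - {\<xi>}) (\<lambda>_. gauss1). h (comb (w(\<xi> := t)))) * std_normal_density t)"
proof -
  let ?L = "PiM (B - {\<xi>}) (\<lambda>_. lborel :: real measure)"
  let ?g = "\<lambda>x. h x * gauss_density x"
  have s: "(\<lambda>w. comb (w(\<xi> := s))) \<in> borel_measurable ?L" for s
    using comb_upd_measurable[OF xi, of s]
    by (rule measurable_cong_sets[THEN equalityD1, THEN subsetD, rotated 2]) (auto intro!: sets_PiM_cong)
  have "marginal \<xi> ?g t = (LINT y|perp_measure \<xi>. ?g (y + t *\<^sub>R \<xi>))"
    unfolding marginal_def set_lebesgue_integral_def perp_measure_def
    using integral_density[of "\<lambda>y. ?g (y + t *\<^sub>R \<xi>)" "hausdorff_measure (DIM('a) - 1)" "indicator (hyperplane_perp \<xi>)"]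
    by (simp add: ennreal_indicator)
  also have "\<dots> = (LINT y|distr ?L borel (\<lambda>w. comb (w(\<xi> := 0))). c * ?g (y + t *\<^sub>R \<xi>))"
    unfolding c(2) using c(1) by (subst integral_density) auto
  also have "\<dots> = c * (LINT y|distr ?L borel (\<lambda>w. comb (w(\<xi> := 0))). ?g (y + t *\<^sub>R \<xi>))" by simp
  also have "(LINT y|distr ?L borel (\<lambda>w. comb (w(\<xi> := 0))). ?g (y + t *\<^sub>R \<xi>)) = (LINT w|?L. ?g (comb (w(\<xi> := t))))"
    by (subst integral_distr[OF s]) (simp_all only: comb_upd[OF xi, of _ t, symmetric], measurable)
  also have "\<dots> = (LINT w|?L. std_normal_density t * ((\<Prod>b\<in>B - {\<xi>}. std_normal_density (w b)) * h (comb (w(\<xi> := t)))))"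
  proof (rule Bochner_Integration.integral_cong[OF refl])
    fix w
    have "gauss_density (comb (w(\<xi> := t))) = std_normal_density t * (\<Prod>b\<in>B - {\<xi>}. std_normal_density ((w(\<xi> := t)) b))"
      unfolding gauss_density_comb using finite_B xi by (subst prod.remove[of B \<xi>]) auto
    also have "(\<Prod>b\<in>B - {\<xi>}. std_normal_density ((w(\<xi> := t)) b)) = (\<Prod>b\<in>B - {\<xi>}. std_normal_density (w b))"
      by (intro prod.cong) auto
    finally show "?g (comb (w(\<xi> := t))) = std_normal_density t * ((\<Prod>b\<in>B - {\<xi>}. std_normal_density (w b)) * h (comb (w(\<xi> := t))))"
      by (simp only: mult_ac)
  qed
  also have "\<dots> = std_normal_density t * (LINT w|?L. (\<Prod>b\<in>B - {\<xi>}. std_normal_density (w b)) * h (comb (w(\<xi> := t))))" by simp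
  also have "(LINT w|?L. (\<Prod>b\<in>B - {\<xi>}. std_normal_density (w b)) * h (comb (w(\<xi> := t)))) = (LINT w|PiM (B - {\<xi>}) (\<lambda>_. gauss1). h (comb (w(\<xi> := t))))"
    unfolding PiM_gauss1_eq_density[OF finite_Diff[OF finite_B]]
    using integral_density[of "\<lambda>w. h (comb (w(\<xi> := t)))" ?L "\<lambda>w. \<Prod>b\<in>B - {\<xi>}. std_normal_density (w b)"]
      measurable_compose[OF s[of t] h]
    by (simp add: prod_nonneg del: fun_upd_apply)
  finally show ?thesis by (simp only: mult_ac)
qed

end

text \<open>
  A positive continuous function is bounded below on a ball, hence not integrable if the ball has
  infinite measure; the integral of a non-integrable function is 0 by convention.
\<close>

lemma marginal_eq_0:
  fixes g :: "'a::euclidean_space \<Rightarrow> real"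
  assumes inf: "emeasure (perp_measure \<xi>) (cball 0 r) = \<infinity>"
    and cont: "continuous_on UNIV g" and pos: "\<And>x. 0 < g x"
  shows "marginal \<xi> g t = 0"
proof -
  have [measurable]: "g \<in> borel_measurable borel" using cont by (rule borel_measurable_continuous_onI)
  have "continuous_on (cball 0 r) (\<lambda>y. g (y + t *\<^sub>R \<xi>))"
    by (rule continuous_on_compose2[OF cont]) (auto intro!: continuous_intros)
  moreover have "cball (0::'a) r \<noteq> {}" using inf by auto
  ultimately obtain z where z: "\<And>y. y \<in> cball 0 r \<Longrightarrow> g (z + t *\<^sub>R \<xi>) \<le> g (y + t *\<^sub>R \<xi>)"
    using continuous_attains_inf[OF compact_cball] by metis
  have "\<not> integrable (perp_measure \<xi>) (\<lambda>y. g (y + t *\<^sub>R \<xi>))"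
  proof
    assume "integrable (perp_measure \<xi>) (\<lambda>y. g (y + t *\<^sub>R \<xi>))"
    then have fin: "(\<integral>\<^sup>+y. ennreal (norm (g (y + t *\<^sub>R \<xi>))) \<partial>perp_measure \<xi>) < \<infinity>" by (simp add: integrable_iff_bounded)
    have "ennreal (g (z + t *\<^sub>R \<xi>)) * emeasure (perp_measure \<xi>) (cball 0 r)
       = (\<integral>\<^sup>+y. ennreal (g (z + t *\<^sub>R \<xi>)) * indicator (cball 0 r) y \<partial>perp_measure \<xi>)"
      by (rule nn_integral_cmult_indicator[symmetric]) simp
    also have "\<dots> \<le> (\<integral>\<^sup>+y. ennreal (norm (g (y + t *\<^sub>R \<xi>))) \<partial>perp_measure \<xi>)"
      using z by (intro nn_integral_mono) (auto simp: indicator_def intro!: ennreal_leI order_trans[OF _ abs_ge_self])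
    finally show False using fin pos[of "z + t *\<^sub>R \<xi>"] by (simp add: inf ennreal_mult_top)
  qed
  moreover have "marginal \<xi> g t = (LINT y|perp_measure \<xi>. g (y + t *\<^sub>R \<xi>))"
    unfolding marginal_def set_lebesgue_integral_def perp_measure_def
    using integral_density[of "\<lambda>y. g (y + t *\<^sub>R \<xi>)" "hausdorff_measure (DIM('a) - 1)" "indicator (hyperplane_perp \<xi>)"]
    by (simp add: ennreal_indicator)
  ultimately show ?thesis by (simp add: not_integrable_integral_eq)
qed

lemma gradient_derivative:
  fixes f :: "'a::euclidean_space \<Rightarrow> real"
  assumes "f differentiable (at x)"
  shows "(f has_derivative (\<lambda>h. h \<bullet> gradient f x)) (at x)"
proof -
  obtain f' where f': "(f has_derivative f') (at x)" using assms by (auto simp: differentiable_def)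
  then interpret linear f' by (rule has_derivative_linear)
  have "f' = (\<lambda>h. h \<bullet> (\<Sum>b\<in>Basis. f' b *\<^sub>R b))"
  proof
    fix h
    have "f' h = f' (\<Sum>b\<in>Basis. (h \<bullet> b) *\<^sub>R b)" by (simp add: euclidean_representation)
    also have "\<dots> = h \<bullet> (\<Sum>b\<in>Basis. f' b *\<^sub>R b)" by (simp add: sum scale inner_sum_right mult.commute)
    finally show "f' h = h \<bullet> (\<Sum>b\<in>Basis. f' b *\<^sub>R b)" .
  qed
  then have "GDERIV f x :> (\<Sum>b\<in>Basis. f' b *\<^sub>R b)" using f' by (simp add: gderiv_def)
  moreover have "D = D'" if "GDERIV f x :> D" "GDERIV f x :> D'" for D D'
  proof -
    have "(\<lambda>h. h \<bullet> D) = (\<lambda>h. h \<bullet> D')"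
      using that unfolding gderiv_def by (rule has_derivative_unique)
    then show ?thesis by (metis inner_commute vector_eq_ldot)
  qed
  ultimately have "GDERIV f x :> gradient f x" unfolding gradient_def by (metis theI)
  then show ?thesis by (simp add: gderiv_def)
qed

lemma class_An_D:
  assumes "f \<in> class_An"
  shows "\<And>x. (f has_derivative (\<lambda>h. h \<bullet> gradient f x)) (at x)" "continuous_on UNIV (gradient f)"
    "\<And>x. 0 < f x" "has_bochner_integral gauss f 1" "integrable gauss (\<lambda>x. (norm (gradient f x))\<^sup>2 / f x)"
    "continuous_on UNIV f" "f \<in> borel_measurable borel" "gradient f \<in> borel_measurable borel"
proof -
  show d: "(f has_derivative (\<lambda>h. h \<bullet> gradient f x)) (at x)" for x
    using assms by (intro gradient_derivative) (simp add: class_An_def C1_fun_def)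
  show c: "continuous_on UNIV (gradient f)" and "\<And>x. 0 < f x" and "has_bochner_integral gauss f 1"
    and "integrable gauss (\<lambda>x. (norm (gradient f x))\<^sup>2 / f x)"
    using assms by (auto simp: class_An_def C1_fun_def)
  show cf: "continuous_on UNIV f"
    using has_derivative_continuous[OF d] by (simp add: continuous_on_eq_continuous_at)
  show "f \<in> borel_measurable borel" by (rule borel_measurable_continuous_onI[OF cf])
  show "gradient f \<in> borel_measurable borel" by (rule borel_measurable_continuous_onI[OF c])
qed

lemma (in orthonormal_basis) coordinatewise_C1_comb:
  assumes f: "f \<in> class_An"
  shows "coordinatewise_C1 B (\<lambda>x. f (comb x)) (\<lambda>b x. gradient f (comb x) \<bullet> b)"
proof -
  note fD = class_An_D[OF f]
  note [measurable] = fD(7,8)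
  have line: "((\<lambda>s. comb (x(b := s))) has_derivative (\<lambda>h. h *\<^sub>R b)) (at t)" if b: "b \<in> B" for x b t
  proof -
    have eq: "(\<lambda>s. comb (x(b := s))) = (\<lambda>s. comb (x(b := 0)) + s *\<^sub>R b)" by (rule ext, rule comb_upd[OF b])
    show ?thesis unfolding eq by (auto intro!: derivative_eq_intros)
  qed
  show ?thesis unfolding coordinatewise_C1_def
  proof (intro conjI ballI allI)
    show "(\<lambda>x. f (comb x)) \<in> borel_measurable (PiM B (\<lambda>_. borel))" by measurable
    show "(\<lambda>x. gradient f (comb x) \<bullet> b) \<in> borel_measurable (PiM B (\<lambda>_. borel))" for b by measurable
    fix x b assume b: "b \<in> B"
    show "((\<lambda>s. f (comb (x(b := s)))) has_real_derivative gradient f (comb (x(b := t))) \<bullet> b) (at t)" for t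
      unfolding has_field_derivative_def
      by (rule has_derivative_eq_rhs[OF has_derivative_compose[OF line[OF b] fD(1)]])
         (simp add: fun_eq_iff inner_commute mult.commute)
    show "continuous_on UNIV (\<lambda>s. gradient f (comb (x(b := s))) \<bullet> b)"
    proof (intro continuous_on_inner continuous_on_const continuous_on_compose2[OF fD(2)])
      show "continuous_on UNIV (\<lambda>s. comb (x(b := s)))"
        using has_derivative_continuous[OF line[OF b, of x]] by (simp add: continuous_on_eq_continuous_at)
    qed simp
  qed (rule fD(3))
qed

text \<open>
  Translation of \<open>log_sobolev_deficit_step\<close> from coordinates to the space. The finite bound forces \<open>f ln f\<close>
  to be integrable, so that \<open>Ent\<close> is the genuine entropy.
\<close>

lemma (in orthonormal_basis) gauss_deficit_ge:
  assumes f: "f \<in> class_An" and xi: "\<xi> \<in> B"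
  defines "m \<equiv> \<lambda>t. (LINT w|PiM (B - {\<xi>}) (\<lambda>_. gauss1). f (comb (w(\<xi> := t)))) * std_normal_density t"
  shows "m \<in> class_B" "(dist1 m std_normal_density)\<^sup>2 / 2 \<le> LS_deficit f"
proof -
  note fD = class_An_D[OF f]
  note [measurable] = fD(7,8)
  let ?F = "\<lambda>x. f (comb x)" and ?D = "\<lambda>b x. gradient f (comb x) \<bullet> b"
  define I where "I = (LINT x|gauss. (norm (gradient f x))\<^sup>2 / f x)"
  have B: "insert \<xi> (B - {\<xi>}) = B" "finite (B - {\<xi>})" "\<xi> \<notin> B - {\<xi>}" using xi finite_B by auto
  have C1: "coordinatewise_C1 B ?F ?D" by (rule coordinatewise_C1_comb[OF f])
  have I_nn: "(\<integral>\<^sup>+x. ennreal ((norm (gradient f x))\<^sup>2 / f x) \<partial>gauss) = ennreal I"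
    unfolding I_def using fD(3) by (intro nn_integral_eq_integral fD(5)) (auto simp: less_imp_le)
  have I0: "0 \<le> I" unfolding I_def using fD(3) by (intro integral_nonneg_AE) (auto simp: less_imp_le)
  have sum: "(\<Sum>b\<in>B. fisher_info B ?F ?D b) = ennreal I"
  proof -
    have "(\<Sum>b\<in>B. fisher_info B ?F ?D b) = (\<integral>\<^sup>+x. (\<Sum>b\<in>B. ennreal ((?D b x)\<^sup>2 / ?F x)) \<partial>PiM B (\<lambda>_. gauss1))"
      unfolding fisher_info_def by (rule nn_integral_sum[symmetric]) measurable
    also have "\<dots> = (\<integral>\<^sup>+x. ennreal ((norm (gradient f (comb x)))\<^sup>2 / f (comb x)) \<partial>PiM B (\<lambda>_. gauss1))"
      using fD(3) by (intro nn_integral_cong) (simp add: sum_ennreal less_imp_le sum_divide_distrib[symmetric] parseval)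
    also have "\<dots> = ennreal I"
      unfolding I_nn[symmetric] by (rule nn_integral_gauss[symmetric]) measurable
    finally show ?thesis .
  qed
  have fisher: "fisher_info B ?F ?D \<xi> < \<infinity>"
  proof -
    have "fisher_info B ?F ?D \<xi> \<le> (\<Sum>b\<in>B. fisher_info B ?F ?D b)"
      using finite_B xi by (intro member_le_sum) auto
    then show ?thesis by (auto simp: sum intro: le_less_trans)
  qed
  have f_nn: "(\<integral>\<^sup>+x. ennreal (f x) \<partial>gauss) = 1"
    using fD(3,4) by (subst nn_integral_eq_integral) (auto simp: has_bochner_integral_iff less_imp_le)
  have mass: "(\<integral>\<^sup>+x. ennreal (?F x) \<partial>PiM B (\<lambda>_. gauss1)) = 1"
    using nn_integral_gauss[of "\<lambda>x. ennreal (f x)"] f_nn by simp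
  interpret G: gaussian_fibration "PiM (B - {\<xi>}) (\<lambda>_. gauss1)" "\<lambda>t w. ?F (w(\<xi> := t))" "\<lambda>t w. ?D \<xi> (w(\<xi> := t))"
    using fibration_of_product[OF B(2,3), unfolded B(1), OF C1 mass fisher] .
  have "G.u = m" by (rule ext) (simp only: G.u_def G.marg_def m_def)
  then show "m \<in> class_B" using G.u_class_B by simp
  have "(\<integral>\<^sup>+x. ennreal (rel_ent (?F x) 1) \<partial>PiM B (\<lambda>_. gauss1)) + ennreal ((dist1 m std_normal_density)\<^sup>2) / 2
      \<le> ennreal I / 2"
    using log_sobolev_deficit_step[OF B(2,3) log_sobolev_product[OF B(2)], unfolded B(1), OF C1 mass fisher]
    unfolding sum m_def .
  also have "(\<integral>\<^sup>+x. ennreal (rel_ent (?F x) 1) \<partial>PiM B (\<lambda>_. gauss1)) = (\<integral>\<^sup>+x. ennreal (rel_ent (f x) 1) \<partial>gauss)"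
    by (rule nn_integral_gauss[symmetric]) measurable
  finally have main: "(\<integral>\<^sup>+x. ennreal (rel_ent (f x) 1) \<partial>gauss) + ennreal ((dist1 m std_normal_density)\<^sup>2 / 2) \<le> ennreal (I / 2)"
    using I0 by (simp add: divide_ennreal[symmetric])
  then have "(\<integral>\<^sup>+x. ennreal (rel_ent (f x) 1) \<partial>gauss) \<le> ennreal (I / 2)"
    by (rule order_trans[rotated]) simp
  then have fin: "(\<integral>\<^sup>+x. ennreal (rel_ent (f x) 1) \<partial>gauss) < \<infinity>" by (auto intro: le_less_trans)
  have nn: "0 \<le> rel_ent (f x) 1" for x using rel_ent_nonneg[OF fD(3), of 1] by simp
  have int: "integrable gauss (\<lambda>x. rel_ent (f x) 1)"
    using fin nn by (intro integrableI_nonneg) auto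
  have "prob_space (gauss :: 'a measure)"
    using nn_integral_gauss[of "\<lambda>_. 1"] prob_space.emeasure_space_1[OF prob_space_PiM_gauss1[of B]]
    by (intro prob_spaceI) simp
  then interpret gauss: prob_space "gauss :: 'a measure" .
  have intf: "integrable gauss f" "(LINT x|gauss. f x) = 1" using fD(4) by (auto simp: has_bochner_integral_iff)
  have "(LINT x|gauss. f x * ln (f x)) = (LINT x|gauss. rel_ent (f x) 1 + f x - 1)"
    by (intro Bochner_Integration.integral_cong) (auto simp: rel_ent_def)
  also have "\<dots> = (LINT x|gauss. rel_ent (f x) 1)"
    using int intf by (simp add: gauss.prob_space[simplified])
  finally have Ent: "Ent gauss f = (LINT x|gauss. rel_ent (f x) 1)" by (simp add: Ent_def intf)
  have "(\<integral>\<^sup>+x. ennreal (rel_ent (f x) 1) \<partial>gauss) = ennreal (Ent gauss f)"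
    unfolding Ent using nn by (intro nn_integral_eq_integral int) auto
  moreover have "0 \<le> Ent gauss f" unfolding Ent using nn by (intro integral_nonneg_AE) auto
  ultimately have "ennreal (Ent gauss f + (dist1 m std_normal_density)\<^sup>2 / 2) \<le> ennreal (I / 2)"
    using main by simp
  then have "Ent gauss f + (dist1 m std_normal_density)\<^sup>2 / 2 \<le> I / 2"
    using I0 by (simp add: ennreal_le_iff)
  then show "(dist1 m std_normal_density)\<^sup>2 / 2 \<le> LS_deficit f" by (simp add: LS_deficit_def I_def)
qed

lemma gauss_density_continuous: "continuous_on UNIV gauss_density"
  unfolding gauss_density_def[abs_def] by (intro continuous_intros) auto

lemma dist1_zero: "dist1 (\<lambda>_. 0) v = 0"
  unfolding dist1_def by (intro integral_eq_zero_AE) (simp add: AE_density)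

text \<open>
  The distance of the marginals is \<open>c\<close> times the distance \<open>d0\<close> of the Gaussian averages, where
  \<open>0 \<le> c \<le> 1\<close> is the ratio of Hausdorff to Lebesgue measure on the hyperplane (and \<open>c = 0\<close> covers
  vanishing marginals).
\<close>

lemma dist1_marginal_le_deficit:
  fixes f :: "'a::euclidean_space \<Rightarrow> real"
  assumes f: "f \<in> class_An" and xi: "norm \<xi> = 1"
  defines "d \<equiv> dist1 (marginal \<xi> (\<lambda>x. f x * gauss_density x)) (marginal \<xi> gauss_density)"
  shows "0 \<le> d" "d\<^sup>2 / 2 \<le> LS_deficit f"
proof -
  note fD = class_An_D[OF f]
  obtain B where B: "\<xi> \<in> B" "pairwise orthogonal B" "\<And>x. x \<in> B \<Longrightarrow> norm x = 1" "independent B" "card B = DIM('a)"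
    using vector_in_orthonormal_basis[OF xi] by metis
  interpret orthonormal_basis B by standard (use B independent_bound in auto)
  define m where "m t = (LINT w|PiM (B - {\<xi>}) (\<lambda>_. gauss1). f (comb (w(\<xi> := t)))) * std_normal_density t" for t
  have m: "m \<in> class_B" and defm: "(dist1 m std_normal_density)\<^sup>2 / 2 \<le> LS_deficit f"
    unfolding m_def using gauss_deficit_ge[OF f B(1)] by auto
  define d0 where "d0 = dist1 m std_normal_density"
  have d0: "0 \<le> d0" unfolding d0_def by (rule dist1_sq_le(1)[OF m std_normal_density_class_B])
  have "\<exists>c. 0 \<le> c \<and> c \<le> 1 \<and> d = c * d0"
  proof (cases "\<forall>r. emeasure (perp_measure \<xi>) (cball 0 r) < \<infinity>")
    case True
    obtain c where c: "0 \<le> c" "c \<le> 1" and pc: "perp_measure \<xi> = density (distr (PiM (B - {\<xi>}) (\<lambda>_. lborel)) borel (\<lambda>w. comb (w(\<xi> := 0)))) (\<lambda>_. ennreal c)"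
      using perp_measure_le_lebesgue[OF B(1)] True by blast
    have m1: "marginal \<xi> (\<lambda>x. f x * gauss_density x) = (\<lambda>t. c * m t)"
      unfolding m_def by (rule ext, rule marginal_eq[OF B(1) fD(7) c(1) pc])
    interpret P: prob_space "PiM (B - {\<xi>}) (\<lambda>_. gauss1)" by (rule prob_space_PiM_gauss1)
    have m2: "marginal \<xi> gauss_density = (\<lambda>t. c * std_normal_density t)"
    proof
      fix t
      show "marginal \<xi> gauss_density t = c * std_normal_density t"
        using marginal_eq[OF B(1) _ c(1) pc, of "\<lambda>_. 1" t] P.prob_space by simp
    qed
    have "d = c * d0"
    proof (cases "c = 0")
      case True then show ?thesis by (simp add: d_def m1 m2 dist1_zero)
    next
      case False
      then show ?thesis using c unfolding d_def m1 m2 d0_def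
        by (intro dist1_scale m std_normal_density_class_B) simp
    qed
    with c show ?thesis by blast
  next
    case False
    then obtain r where "\<not> emeasure (perp_measure \<xi>) (cball 0 r) < \<infinity>" by blast
    then have r: "emeasure (perp_measure \<xi>) (cball 0 r) = \<infinity>" by (simp add: less_top[symmetric])
    have "marginal \<xi> (\<lambda>x. f x * gauss_density x) = (\<lambda>_. 0)"
      by (rule ext, rule marginal_eq_0[OF r])
         (auto intro!: continuous_on_mult fD(6) gauss_density_continuous mult_pos_pos fD(3) gauss_density_pos)
    then have "d = 0" by (simp add: d_def dist1_zero)
    then show ?thesis by (intro exI[of _ 0]) simp
  qed
  then obtain c where c: "0 \<le> c" "c \<le> 1" "d = c * d0" by blast
  show "0 \<le> d" using c d0 by simp
  have "d \<le> d0" using c d0 by (simp add: mult_left_le_one_le)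
  then have "d\<^sup>2 \<le> d0\<^sup>2" using \<open>0 \<le> d\<close> by (intro power_mono)
  then show "d\<^sup>2 / 2 \<le> LS_deficit f" using defm by (simp add: d0_def)
qed

theorem theorem2p1:
  fixes f :: "real ^ 'n \<Rightarrow> real"
  assumes "f \<in> class_An"
  shows "LS_deficit f \<ge> 1/2 * (dist_n (\<lambda>x. f x * gauss_density x) gauss_density)\<^sup>2"
proof -
  define d where "d \<xi> = dist1 (marginal \<xi> (\<lambda>x. f x * gauss_density x)) (marginal \<xi> gauss_density)" for \<xi> :: "real ^ 'n"
  have d: "0 \<le> d \<xi>" "(d \<xi>)\<^sup>2 / 2 \<le> LS_deficit f" if "\<xi> \<in> sphere 0 1" for \<xi>
    using dist1_marginal_le_deficit[OF assms, of \<xi>] that by (auto simp: d_def)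
  have le: "d \<xi> \<le> sqrt (2 * LS_deficit f)" if "\<xi> \<in> sphere 0 1" for \<xi>
    using d[OF that] by (intro real_le_rsqrt) simp
  obtain \<xi>0 :: "real ^ 'n" where x0: "\<xi>0 \<in> sphere 0 1"
    using vector_choose_size[of 1] by auto
  have "(SUP \<xi>\<in>sphere 0 1. d \<xi>) \<le> sqrt (2 * LS_deficit f)"
    using x0 le by (intro cSUP_least) auto
  moreover have "0 \<le> (SUP \<xi>\<in>sphere 0 1. d \<xi>)"
    using x0 d(1)[OF x0] le by (intro cSUP_upper2[of _ _ \<xi>0]) (auto intro!: bdd_aboveI2)
  ultimately have "(SUP \<xi>\<in>sphere 0 1. d \<xi>)\<^sup>2 \<le> (sqrt (2 * LS_deficit f))\<^sup>2"
    by (intro power_mono)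
  moreover have "0 \<le> LS_deficit f" using d(2)[OF x0] by (rule order_trans[rotated]) simp
  ultimately show ?thesis by (simp add: dist_n_def d_def)
qed

end
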